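(* Let $X$ be a compact metric space and $T:X\to X$ continuous, expansive, with the specification property. If $\phi\in C^\alpha(X)$ has a unique equilibrium state $\mu_\phi$ with exponential decay of correlations, then $P:C^\alpha(X)\to\mathbb{R}$ is Fréchet differentiable at $\phi$ in the $\|\cdot\|_\alpha$ norm, with $DP(\phi)(\psi)=\int\psi\,d\mu_\phi$. On $C(X)$ with the $\|\cdot\|_\infty$ norm, the pressure is Gâteaux differentiable at $\phi$ with the same derivative.
   Context: $C^\alpha(X)$ is the Banach space of $\alpha$-Hölder real functions with Hölder norm $\|\cdot\|_\alpha$ (sup norm plus Hölder seminorm). $\mathcal{M}_T(X)$ is the set of $T$-invariant Borel probability measures; $h_\mu(T)$ is the measure-theoretic entropy. Let $d_n(x,y)=\max_{0\le k<n}d(T^kx,T^ky)$; $E\subset X$ is $(n,\epsilon)$-separated if $d_n(x,y)>\epsilon$ for distinct $x,y\in E$. With $S_n\phi=\sum_{k=0}^{n-1}\phi\circ T^k$ and $Q_n(\phi,\epsilon)=\sup\{\sum_{x\in E}e^{S_n\phi(x)}: E\ (n,\epsilon)\text{-separated}\}$, the topological pressure is $P(\phi)=\lim_{\epsilon\to0}\limsup_{n\to\infty}\frac1n\log Q_n(\phi,\epsilon)$. An equilibrium state for $\phi$ is $\mu\in\mathcal{M}_T(X)$ with $h_\mu(T)+\int\phi\,d\mu=P(\phi)$. Expansive has its standard meaning (existence of an expansiveness constant). Specification property: for every $\epsilon>0$ there is $M(\epsilon)\in\mathbb{N}$ such that any finite collection of orbit segments can be $\epsilon$-shadowed by a single periodic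 orbit with gaps of length at most $M(\epsilon)$. Exponential decay of correlations for $\mu$: there are $C>0$, $\gamma\in(0,1)$ with $|\mathrm{Cov}_\mu(f,g\circ T^n)|\le C\gamma^n\|f\|_\alpha\|g\|_\alpha$ for all $f,g\in C^\alpha(X)$, $n\ge0$. *)

theory Defs
  imports "HOL-Probability.Probability"
begin

section \<open>Function spaces and differentiability of functionals\<close>

text \<open>
  The compact space \<open>X\<close> is a type \<open>'a::metric_space\<close> with compact universe. Function spaces
  over \<open>X\<close> are carrier sets of functions \<open>'a \<Rightarrow> real\<close> with pointwise operations, together with a
  norm function, since the Hoelder space depends on the real parameter \<open>\<alpha>\<close> and hence is not a type.
\<close>

definition cont_space :: "('a::metric_space \<Rightarrow> real) set" where
  "cont_space = {f. continuous_on UNIV f}"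

definition holder_space :: "real \<Rightarrow> ('a::metric_space \<Rightarrow> real) set" where
  "holder_space \<alpha> = {f. \<exists>K. \<forall>x y. \<bar>f x - f y\<bar> \<le> K * dist x y powr \<alpha>}"

definition sup_norm :: "('a \<Rightarrow> real) \<Rightarrow> real" where
  "sup_norm f = (SUP x. \<bar>f x\<bar>)"

text \<open>
  The supremum includes the pairs with \<open>x = y\<close>, which contribute \<open>0 / 0 = 0\<close>; this avoids a
  supremum over the empty set of reals when \<open>X\<close> is a single point.
\<close>

definition holder_seminorm :: "real \<Rightarrow> ('a::metric_space \<Rightarrow> real) \<Rightarrow> real" where
  "holder_seminorm \<alpha> f = (SUP (x, y). \<bar>f x - f y\<bar> / dist x y powr \<alpha>)"

definition holder_norm :: "real \<Rightarrow> ('a::metric_space \<Rightarrow> real) \<Rightarrow> real" where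
  "holder_norm \<alpha> f = sup_norm f + holder_seminorm \<alpha> f"

definition bounded_linear_functional ::
  "('a \<Rightarrow> real) set \<Rightarrow> (('a \<Rightarrow> real) \<Rightarrow> real) \<Rightarrow> (('a \<Rightarrow> real) \<Rightarrow> real) \<Rightarrow> bool" where
  "bounded_linear_functional V N L \<longleftrightarrow>
     (\<forall>f\<in>V. \<forall>g\<in>V. L (\<lambda>x. f x + g x) = L f + L g) \<and>
     (\<forall>c. \<forall>f\<in>V. L (\<lambda>x. c * f x) = c * L f) \<and>
     (\<exists>K. \<forall>f\<in>V. \<bar>L f\<bar> \<le> K * N f)"

definition has_frechet_derivative ::
  "('a \<Rightarrow> real) set \<Rightarrow> (('a \<Rightarrow> real) \<Rightarrow> real) \<Rightarrow> (('a \<Rightarrow> real) \<Rightarrow> real) \<Rightarrow> ('a \<Rightarrow> real) \<Rightarrow>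
     (('a \<Rightarrow> real) \<Rightarrow> real) \<Rightarrow> bool" where
  "has_frechet_derivative V N F \<phi> L \<longleftrightarrow>
     bounded_linear_functional V N L \<and>
     (\<forall>\<epsilon>>0. \<exists>\<delta>>0. \<forall>\<psi>\<in>V. N \<psi> < \<delta> \<longrightarrow>
        \<bar>F (\<lambda>x. \<phi> x + \<psi> x) - F \<phi> - L \<psi>\<bar> \<le> \<epsilon> * N \<psi>)"

definition has_gateaux_derivative ::
  "('a \<Rightarrow> real) set \<Rightarrow> (('a \<Rightarrow> real) \<Rightarrow> real) \<Rightarrow> (('a \<Rightarrow> real) \<Rightarrow> real) \<Rightarrow> ('a \<Rightarrow> real) \<Rightarrow>
     (('a \<Rightarrow> real) \<Rightarrow> real) \<Rightarrow> bool" where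
  "has_gateaux_derivative V N F \<phi> L \<longleftrightarrow>
     bounded_linear_functional V N L \<and>
     (\<forall>\<psi>\<in>V. ((\<lambda>t. F (\<lambda>x. \<phi> x + t * \<psi> x)) has_real_derivative L \<psi>) (at 0))"

section \<open>Expansiveness and specification\<close>

text \<open>
  For a map that need not be invertible, expansiveness refers to forward orbits; for a
  homeomorphism (a continuous bijection of a compact space) it refers to two-sided orbits.
\<close>

definition expansive :: "('a::metric_space \<Rightarrow> 'a) \<Rightarrow> bool" where
  "expansive T \<longleftrightarrow> (\<exists>c>0.
     (\<forall>x y. (\<forall>n. dist ((T ^^ n) x) ((T ^^ n) y) \<le> c) \<longrightarrow> x = y) \<or>
     (bij T \<and>
      (\<forall>x y. (\<forall>n. dist ((T ^^ n) x) ((T ^^ n) y) \<le> c \<and>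
                  dist ((inv T ^^ n) x) ((inv T ^^ n) y) \<le> c) \<longrightarrow> x = y)))"

text \<open>
  The \<open>i\<close>-th segment is \<open>x i, T (x i), \<dots>, T\<^sup>\<ell>\<^sup>-\<^sup>1 (x i)\<close> with \<open>\<ell> = len i\<close>; it is followed by a gap of
  length \<open>gap i\<close>. The last gap is the one after which the orbit of \<open>z\<close> closes up.
\<close>

definition specification_property :: "('a::metric_space \<Rightarrow> 'a) \<Rightarrow> bool" where
  "specification_property T \<longleftrightarrow> (\<forall>\<epsilon>>0. \<exists>M::nat. \<forall>(k::nat) (x :: nat \<Rightarrow> 'a) (len :: nat \<Rightarrow> nat).
     0 < k \<and> (\<forall>i<k. 0 < len i) \<longrightarrow>
     (\<exists>(gap :: nat \<Rightarrow> nat) z.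
        (\<forall>i<k. gap i \<le> M) \<and>
        (T ^^ (\<Sum>i<k. len i + gap i)) z = z \<and>
        (\<forall>i<k. \<forall>j<len i.
           dist ((T ^^ ((\<Sum>l<i. len l + gap l) + j)) z) ((T ^^ j) (x i)) < \<epsilon>)))"

section \<open>Topological pressure\<close>

definition birkhoff_sum :: "('a \<Rightarrow> 'a) \<Rightarrow> ('a \<Rightarrow> real) \<Rightarrow> nat \<Rightarrow> 'a \<Rightarrow> real" where
  "birkhoff_sum T \<phi> n x = (\<Sum>k<n. \<phi> ((T ^^ k) x))"

text \<open>
  Only \<open>n \<ge> 1\<close> is meaningful here; the value at \<open>n = 0\<close> does not affect the pressure.
\<close>

definition bowen_dist :: "('a::metric_space \<Rightarrow> 'a) \<Rightarrow> nat \<Rightarrow> 'a \<Rightarrow> 'a \<Rightarrow> real" where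
  "bowen_dist T n x y = (MAX k\<in>{..<n}. dist ((T ^^ k) x) ((T ^^ k) y))"

definition separated :: "('a::metric_space \<Rightarrow> 'a) \<Rightarrow> nat \<Rightarrow> real \<Rightarrow> 'a set \<Rightarrow> bool" where
  "separated T n \<epsilon> E \<longleftrightarrow> (\<forall>x\<in>E. \<forall>y\<in>E. x \<noteq> y \<longrightarrow> bowen_dist T n x y > \<epsilon>)"

text \<open>
  If \<open>X\<close> is compact, \<open>T\<close> continuous, \<open>n \<ge> 1\<close> and \<open>\<epsilon> > 0\<close>, separated sets are finite with
  uniformly bounded cardinality, so for continuous \<open>\<phi>\<close> the sums and the real supremum are genuine.
\<close>

definition partition_sum ::
  "('a::metric_space \<Rightarrow> 'a) \<Rightarrow> ('a \<Rightarrow> real) \<Rightarrow> nat \<Rightarrow> real \<Rightarrow> real" where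
  "partition_sum T \<phi> n \<epsilon> = (SUP E\<in>{E. separated T n \<epsilon> E}. \<Sum>x\<in>E. exp (birkhoff_sum T \<phi> n x))"

text \<open>
  The \<open>limsup\<close> is monotone in \<open>\<epsilon>\<close>, so the limit exists in the extended reals.
\<close>

definition pressure :: "('a::metric_space \<Rightarrow> 'a) \<Rightarrow> ('a \<Rightarrow> real) \<Rightarrow> ereal" where
  "pressure T \<phi> =
     Lim (at_right 0) (\<lambda>\<epsilon>. limsup (\<lambda>n. ereal (1 / real n * ln (partition_sum T \<phi> n \<epsilon>))))"

section \<open>Invariant measures, entropy and equilibrium states\<close>

definition invariant_measures :: "('a::metric_space \<Rightarrow> 'a) \<Rightarrow> 'a measure set" where
  "invariant_measures T = {\<mu>. prob_space \<mu> \<and> sets \<mu> = sets borel \<and> distr \<mu> borel T = \<mu>}"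

definition finite_borel_partition :: "'a::metric_space set set \<Rightarrow> bool" where
  "finite_borel_partition \<xi> \<longleftrightarrow> finite \<xi> \<and> partition_on UNIV \<xi> \<and> \<xi> \<subseteq> sets borel"

text \<open>
  The join of the partitions \<open>T\<^sup>-\<^sup>i \<xi>\<close> for \<open>i < n\<close>. It may contain the empty set, which contributes
  nothing to the entropy because \<open>0 * ln 0 = 0\<close>.
\<close>

definition iterated_join :: "('a \<Rightarrow> 'a) \<Rightarrow> 'a set set \<Rightarrow> nat \<Rightarrow> 'a set set" where
  "iterated_join T \<xi> n = {\<Inter>i\<in>{..<n}. (T ^^ i) -` A i | A. \<forall>i<n. A i \<in> \<xi>}"

definition partition_entropy :: "'a measure \<Rightarrow> 'a set set \<Rightarrow> real" where
  "partition_entropy \<mu> \<xi> = - (\<Sum>A\<in>\<xi>. measure \<mu> A * ln (measure \<mu> A))"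

definition entropy_wrt :: "'a measure \<Rightarrow> ('a \<Rightarrow> 'a) \<Rightarrow> 'a set set \<Rightarrow> real" where
  "entropy_wrt \<mu> T \<xi> = lim (\<lambda>n. 1 / real n * partition_entropy \<mu> (iterated_join T \<xi> n))"

definition measure_entropy :: "'a::metric_space measure \<Rightarrow> ('a \<Rightarrow> 'a) \<Rightarrow> ereal" where
  "measure_entropy \<mu> T = (SUP \<xi>\<in>{\<xi>. finite_borel_partition \<xi>}. ereal (entropy_wrt \<mu> T \<xi>))"

definition equilibrium_state ::
  "('a::metric_space \<Rightarrow> 'a) \<Rightarrow> ('a \<Rightarrow> real) \<Rightarrow> 'a measure \<Rightarrow> bool" where
  "equilibrium_state T \<phi> \<mu> \<longleftrightarrow>
     \<mu> \<in> invariant_measures T \<and> measure_entropy \<mu> T + ereal (\<integral>x. \<phi> x \<partial>\<mu>) = pressure T \<phi>"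

section \<open>Decay of correlations\<close>

definition covariance :: "'a measure \<Rightarrow> ('a \<Rightarrow> real) \<Rightarrow> ('a \<Rightarrow> real) \<Rightarrow> real" where
  "covariance \<mu> f g = (\<integral>x. f x * g x \<partial>\<mu>) - (\<integral>x. f x \<partial>\<mu>) * (\<integral>x. g x \<partial>\<mu>)"

definition exponential_decay_of_correlations ::
  "real \<Rightarrow> ('a::metric_space \<Rightarrow> 'a) \<Rightarrow> 'a measure \<Rightarrow> bool" where
  "exponential_decay_of_correlations \<alpha> T \<mu> \<longleftrightarrow>
     (\<exists>C>0. \<exists>\<gamma>\<in>{0<..<1}. \<forall>f\<in>holder_space \<alpha>. \<forall>g\<in>holder_space \<alpha>. \<forall>n.
        \<bar>covariance \<mu> f (g \<circ> (T ^^ n))\<bar> \<le> C * \<gamma> ^ n * holder_norm \<alpha> f * holder_norm \<alpha> g)"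

end

(*
  The pressure is convex and 1-Lipschitz for the sup norm, and by expansiveness it is computed at one
  fixed scale c. Given t_j -> 0+, choose nearly optimal (n_j, c)-separated sets E_j for phi + t_j psi.
  By Jensen, the difference quotient in direction psi is bounded, up to O(t_j), by the integral of psi
  against the orbit averages of the Gibbs weights on E_j. Misiurewicz's argument shows that every
  cluster point nu of these averages has entropy at least P(phi) - int phi dnu, and the upper half of
  the variational principle makes nu an equilibrium state of phi, hence nu = mu. This bounds the
  right derivative by int psi dmu; convexity gives the matching lower bound. Frechet
  differentiability follows since the Hoelder unit ball is totally bounded for the sup norm.
*)

theory Submission
  imports Defs
begin

section \<open>Entropy of finite labellings\<close>

text \<open>Only a limsup is available, so lower estimates of partition sums hold for infinitely
  many n and upper ones for all large n. A single scale \<open>c\<close> valid for every potential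
  lets both be used at the same n and on the same separated set, for \<open>\<phi>\<close> and for
  its perturbation. The tolerance in the choice of \<open>E_j\<close> is the square of
  \<open>t_j\<close>, negligible against \<open>t_j\<close> in the quotient. The averages belong to
  \<open>\<phi> + t_j \<psi>\<close> rather than to \<open>\<phi>\<close>: by convexity the slope at
  the far end bounds the quotient from above, and as the potentials converge uniformly, the limit
  still sees only \<open>\<phi>\<close>. The upper half of the variational principle has to
  approximate atoms from inside by closed sets; the limit measure comes from a Riesz construction
  through open outer approximations, which provides exactly that. Entropy is computed for finite
  labellings: a join becomes a pair or a word of labels, a coarser partition becomes a composition,
  and the same lemmas serve invariant Borel measures and finitely supported Gibbs weights, which
  need not be invariant.\<close>

definition label_prob :: "'a measure \<Rightarrow> ('a \<Rightarrow> 'l) \<Rightarrow> 'l \<Rightarrow> real" where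
  "label_prob M c l = measure M (c -` {l})"

definition label_entropy :: "'a measure \<Rightarrow> ('a \<Rightarrow> 'l) \<Rightarrow> real" where
  "label_entropy M c = (\<Sum>l\<in>range c. - label_prob M c l * ln (label_prob M c l))"

text \<open>Preimages can then be written without intersecting them with \<open>space M\<close>.
  Both the Borel measures on X and \<open>measure_pmf\<close> are of this kind.\<close>

locale prob_space_UNIV = prob_space +
  assumes space_UNIV: "space M = UNIV"
begin

lemma simple_labelD:
  assumes "simple_function M c"
  shows "finite (range c)" and "c -` S \<in> sets M"
  using simple_functionD(1)[OF assms] simple_functionD(2)[OF assms, of S] space_UNIV by auto

lemma label_prob_nonneg: "0 \<le> label_prob M c l" and label_prob_le_1: "label_prob M c l \<le> 1"
  by (auto simp: label_prob_def)

lemma label_prob_comp: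
  assumes "simple_function M c"
  shows "label_prob M (h \<circ> c) m = (\<Sum>l | l \<in> range c \<and> h l = m. label_prob M c l)"
proof -
  have "(h \<circ> c) -` {m} = (\<Union>l\<in>{l \<in> range c. h l = m}. c -` {l})"
    by auto
  also have "prob \<dots> = (\<Sum>l | l \<in> range c \<and> h l = m. prob (c -` {l}))"
    using simple_labelD[OF assms]
    by (intro finite_measure_finite_Union) (auto simp: disjoint_family_on_def)
  finally show ?thesis by (simp add: label_prob_def)
qed

lemma sum_label_prob:
  assumes "simple_function M c"
  shows "(\<Sum>l\<in>range c. label_prob M c l) = 1"
proof -
  have "label_prob M ((\<lambda>_. ()) \<circ> c) () = 1"
    using prob_space by (simp add: label_prob_def space_UNIV vimage_def)
  then show ?thesis using label_prob_comp[OF assms, of "\<lambda>_. ()" "()"] by simp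
qed

lemma label_prob_comp_ge:
  assumes "simple_function M c"
  shows "label_prob M c l \<le> label_prob M (h \<circ> c) (h l)"
  unfolding label_prob_def
  using simple_labelD(2)[OF assms, of "h -` {h l}"]
  by (intro finite_measure_mono) (auto simp: vimage_comp)

text \<open>Summing over the fine labels instead of the coarse ones allows the entropies of several
  marginals of one labelling to be compared term by term.\<close>

lemma label_entropy_comp:
  assumes c: "simple_function M c"
  shows "label_entropy M (h \<circ> c) =
    (\<Sum>l\<in>range c. - label_prob M c l * ln (label_prob M (h \<circ> c) (h l)))"
proof -
  note fin = simple_labelD(1)[OF c]
  have "label_entropy M (h \<circ> c) = (\<Sum>m\<in>h ` range c. \<Sum>l | l \<in> range c \<and> h l = m.
      - label_prob M c l * ln (label_prob M (h \<circ> c) (h l)))"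
    unfolding label_entropy_def image_comp[symmetric] 
    by (intro sum.cong refl, subst (1) label_prob_comp[OF c])
       (auto simp: sum_distrib_right sum_negf)
  also have "\<dots> = (\<Sum>l\<in>range c. - label_prob M c l * ln (label_prob M (h \<circ> c) (h l)))"
    using fin by (intro sum.image_gen[symmetric])
  finally show ?thesis .
qed

lemma label_entropy_comp_le:
  assumes c: "simple_function M c"
  shows "label_entropy M (h \<circ> c) \<le> label_entropy M c"
proof -
  have "- label_prob M c l * ln (label_prob M (h \<circ> c) (h l)) \<le> - label_prob M c l * ln (label_prob M c l)" for l
  proof (cases "label_prob M c l = 0")
    case False
    then have "0 < label_prob M c l"
      using label_prob_nonneg[of c l] by linarith
    then show ?thesis
      using label_prob_comp_ge[OF c, of l h] by (simp add: mult_left_mono)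
  qed simp
  then show ?thesis
    unfolding label_entropy_comp[OF c] by (subst label_entropy_def) (intro sum_mono)
qed

text \<open>Nonnegativity of the relative entropy of the label distribution with respect to the
  weights \<open>exp (s l) / Z\<close>, obtained from \<open>ln r \<le> r - 1\<close> label by
  label. This is the variational principle for finitely many states.\<close>

lemma gibbs_inequality:
  assumes c: "simple_function M c"
  shows "label_entropy M c + (\<Sum>l\<in>range c. label_prob M c l * s l) \<le> ln (\<Sum>l\<in>range c. exp (s l))"
proof -
  define Z where "Z = (\<Sum>l\<in>range c. exp (s l))"
  have Z: "0 < Z" unfolding Z_def using simple_labelD(1)[OF c] by (intro sum_pos) auto
  have le: "label_prob M c l * (s l - ln (label_prob M c l) - ln Z) \<le> exp (s l) / Z - label_prob M c l" for l
  proof (cases "label_prob M c l = 0")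
    case True then show ?thesis using Z by simp
  next
    case False
    then have p: "0 < label_prob M c l"
      using label_prob_nonneg[of c l] by linarith
    have "s l - ln (label_prob M c l) - ln Z = ln (exp (s l) / (label_prob M c l * Z))"
      using p Z by (simp add: ln_div ln_mult)
    also have "\<dots> \<le> exp (s l) / (label_prob M c l * Z) - 1"
      using p Z by (intro ln_le_minus_one) auto
    finally have "label_prob M c l * (s l - ln (label_prob M c l) - ln Z)
        \<le> label_prob M c l * (exp (s l) / (label_prob M c l * Z) - 1)"
      using p by (simp add: mult_left_mono)
    also have "\<dots> = exp (s l) / Z - label_prob M c l"
      using p Z by (simp add: field_simps)
    finally show ?thesis .
  qed
  have "label_entropy M c + (\<Sum>l\<in>range c. label_prob M c l * s l) - ln Z
     = (\<Sum>l\<in>range c. label_prob M c l * (s l - ln (label_prob M c l) - ln Z))"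
    using sum_label_prob[OF c]
    by (simp add: label_entropy_def algebra_simps sum.distrib sum_subtractf sum_negf
       flip: sum_distrib_left)
  also have "\<dots> \<le> (\<Sum>l\<in>range c. exp (s l) / Z - label_prob M c l)"
    by (intro sum_mono le)
  also have "\<dots> = 0"
    using Z sum_label_prob[OF c] by (simp add: sum_subtractf Z_def flip: sum_divide_distrib)
  finally show ?thesis by (simp add: Z_def)
qed

lemma label_entropy_le_ln_card:
  assumes "simple_function M c"
  shows "label_entropy M c \<le> ln (card (range c))"
  using gibbs_inequality[OF assms, of "\<lambda>_. 0"] by simp

lemma label_entropy_nonneg: "0 \<le> label_entropy M c"
proof -
  have "0 \<le> - label_prob M c l * ln (label_prob M c l)" for l
    using label_prob_nonneg[of c l] label_prob_le_1[of c l]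
    by (cases "label_prob M c l = 0") (auto simp: mult_le_0_iff)
  then show ?thesis unfolding label_entropy_def by (intro sum_nonneg)
qed

text \<open>The conditional mutual information of \<open>x\<close> and \<open>y\<close> given
  \<open>z\<close> is nonnegative: the joint law is compared with \<open>pxz * pyz / pz\<close>, the
  law that makes \<open>x\<close> and \<open>y\<close> independent given \<open>z\<close>, and
  \<open>ln r \<le> r - 1\<close> is applied to the ratio.\<close>

lemma label_entropy_submodular:
  assumes x: "simple_function M x" and y: "simple_function M y" and z: "simple_function M z"
  shows "label_entropy M (\<lambda>u. (x u, y u, z u)) + label_entropy M z
    \<le> label_entropy M (\<lambda>u. (x u, z u)) + label_entropy M (\<lambda>u. (y u, z u))"
proof -
  define w where "w u = (x u, y u, z u)" for u
  have w: "simple_function M w"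
    unfolding w_def using x y z by (intro simple_function_Pair)
  note xz = simple_function_Pair[OF x z] and yz = simple_function_Pair[OF y z]
  define p where "p = label_prob M w"
  define pxz where "pxz = label_prob M (\<lambda>u. (x u, z u))"
  define pyz where "pyz = label_prob M (\<lambda>u. (y u, z u))"
  define pz where "pz = label_prob M z"
  have nn: "0 \<le> p v" "0 \<le> pxz v1" "0 \<le> pyz v2" "0 \<le> pz v3" for v v1 v2 v3
    by (auto simp: p_def pxz_def pyz_def pz_def label_prob_nonneg)
  have exz: "(\<lambda>u. (x u, z u)) = (\<lambda>(a,b,e). (a,e)) \<circ> w" and eyz: "(\<lambda>u. (y u, z u)) = (\<lambda>(a,b,e). (b,e)) \<circ> w"
    and ez: "z = (\<lambda>(a,b,e). e) \<circ> w" by (auto simp: w_def)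
  have ez1: "z = snd \<circ> (\<lambda>u. (x u, z u))" and ez2: "z = snd \<circ> (\<lambda>u. (y u, z u))" by auto
  have le: "p (a,b,e) * (ln (pxz (a,e)) + ln (pyz (b,e)) - ln (p (a,b,e)) - ln (pz e))
     \<le> pxz (a,e) * pyz (b,e) / pz e - p (a,b,e)" for a b e
  proof (cases "p (a,b,e) = 0")
    case True then show ?thesis using nn by simp
  next
    case False
    then have 0: "0 < p (a,b,e)" using nn(1)[of "(a,b,e)"] by linarith
    have "p (a,b,e) \<le> pxz (a,e)" "p (a,b,e) \<le> pyz (b,e)" "p (a,b,e) \<le> pz e"
      using label_prob_comp_ge[OF w, of "(a,b,e)" "\<lambda>(a,b,e). (a,e)"]
        label_prob_comp_ge[OF w, of "(a,b,e)" "\<lambda>(a,b,e). (b,e)"]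
        label_prob_comp_ge[OF w, of "(a,b,e)" "\<lambda>(a,b,e). e"]
      unfolding p_def pxz_def pyz_def pz_def exz[symmetric] eyz[symmetric] ez[symmetric] by auto
    then have 1: "0 < pxz (a,e)" "0 < pyz (b,e)" "0 < pz e" using 0 by linarith+
    have "ln (pxz (a,e)) + ln (pyz (b,e)) - ln (p (a,b,e)) - ln (pz e)
        = ln (pxz (a,e) * pyz (b,e) / (p (a,b,e) * pz e))"
      using 0 1 by (simp add: ln_mult ln_div)
    also have "\<dots> \<le> pxz (a,e) * pyz (b,e) / (p (a,b,e) * pz e) - 1"
      using 0 1 by (intro ln_le_minus_one) auto
    finally have "p (a,b,e) * (ln (pxz (a,e)) + ln (pyz (b,e)) - ln (p (a,b,e)) - ln (pz e))
       \<le> p (a,b,e) * (pxz (a,e) * pyz (b,e) / (p (a,b,e) * pz e) - 1)"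
      using 0 by (simp add: mult_left_mono)
    also have "\<dots> = pxz (a,e) * pyz (b,e) / pz e - p (a,b,e)"
      using 0 1 by (simp add: field_simps)
    finally show ?thesis .
  qed
  have marg: "(\<Sum>a\<in>range x. pxz (a,e)) = pz e" "(\<Sum>b\<in>range y. pyz (b,e)) = pz e" for e
  proof -
    have "pz e = (\<Sum>l | l \<in> range (\<lambda>u. (x u, z u)) \<and> snd l = e. pxz l)"
      unfolding pz_def pxz_def by (subst (1) ez1, rule label_prob_comp[OF xz])
    \<comment> \<open>Pairs that never occur have probability 0, so the whole slice may be
      summed.\<close>
    also have "\<dots> = (\<Sum>l\<in>range x \<times> {e}. pxz l)"
    proof (intro sum.mono_neutral_left ballI)
      fix i assume "i \<in> range x \<times> {e} - {l \<in> range (\<lambda>u. (x u, z u)). snd l = e}"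
      then have "i \<notin> range (\<lambda>u. (x u, z u))" by auto
      then have "(\<lambda>u. (x u, z u)) -` {i} = {}" by blast
      then show "pxz i = 0" unfolding pxz_def label_prob_def by simp
    qed (use simple_labelD(1)[OF x] in auto)
    also have "range x \<times> {e} = (\<lambda>a. (a,e)) ` range x" by auto
    also have "sum pxz \<dots> = (\<Sum>a\<in>range x. pxz (a,e))"
      by (subst sum.reindex) (auto simp: inj_on_def)
    finally show "(\<Sum>a\<in>range x. pxz (a,e)) = pz e" by simp
    have "pz e = (\<Sum>l | l \<in> range (\<lambda>u. (y u, z u)) \<and> snd l = e. pyz l)"
      unfolding pz_def pyz_def by (subst (1) ez2, rule label_prob_comp[OF yz])
    also have "\<dots> = (\<Sum>l\<in>range y \<times> {e}. pyz l)"
    proof (intro sum.mono_neutral_left ballI)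
      fix i assume "i \<in> range y \<times> {e} - {l \<in> range (\<lambda>u. (y u, z u)). snd l = e}"
      then have "i \<notin> range (\<lambda>u. (y u, z u))" by auto
      then have "(\<lambda>u. (y u, z u)) -` {i} = {}" by blast
      then show "pyz i = 0" unfolding pyz_def label_prob_def by simp
    qed (use simple_labelD(1)[OF y] in auto)
    also have "range y \<times> {e} = (\<lambda>a. (a,e)) ` range y" by auto
    also have "sum pyz \<dots> = (\<Sum>a\<in>range y. pyz (a,e))"
      by (subst sum.reindex) (auto simp: inj_on_def)
    finally show "(\<Sum>b\<in>range y. pyz (b,e)) = pz e" by simp
  qed
  have "label_entropy M w + label_entropy M z
     - label_entropy M (\<lambda>u. (x u, z u)) - label_entropy M (\<lambda>u. (y u, z u))
     = (\<Sum>(a,b,e)\<in>range w. p (a,b,e) * (ln (pxz (a,e)) + ln (pyz (b,e)) - ln (p (a,b,e)) - ln (pz e)))"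
  proof -
    have "label_entropy M (\<lambda>u. (x u, z u)) = (\<Sum>(a,b,e)\<in>range w. - p (a,b,e) * ln (pxz (a,e)))"
      unfolding pxz_def p_def exz by (subst label_entropy_comp[OF w]) (auto intro!: sum.cong)
    moreover have "label_entropy M (\<lambda>u. (y u, z u)) = (\<Sum>(a,b,e)\<in>range w. - p (a,b,e) * ln (pyz (b,e)))"
      unfolding pyz_def p_def eyz by (subst label_entropy_comp[OF w]) (auto intro!: sum.cong)
    moreover have "label_entropy M z = (\<Sum>(a,b,e)\<in>range w. - p (a,b,e) * ln (pz e))"
      unfolding pz_def p_def by (subst (1 2) ez, subst label_entropy_comp[OF w]) (auto intro!: sum.cong)
    moreover have "label_entropy M w = (\<Sum>(a,b,e)\<in>range w. - p (a,b,e) * ln (p (a,b,e)))"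
      unfolding p_def label_entropy_def by (auto intro!: sum.cong)
    ultimately show ?thesis
      by (simp add: case_prod_unfold algebra_simps sum.distrib sum_subtractf sum_negf)
  qed
  also have "\<dots> \<le> (\<Sum>(a,b,e)\<in>range w. pxz (a,e) * pyz (b,e) / pz e - p (a,b,e))"
    using le by (intro sum_mono) auto
  also have "\<dots> = (\<Sum>(a,b,e)\<in>range w. pxz (a,e) * pyz (b,e) / pz e) - 1"
    using sum_label_prob[OF w] by (simp add: sum_subtractf case_prod_unfold p_def)
  \<comment> \<open>Enlarging to the full product only adds nonnegative terms, and there the sum
    over \<open>a\<close> and \<open>b\<close> factorises for each \<open>e\<close>. A label with
    \<open>pz e = 0\<close> contributes 0, since division by 0 gives 0.\<close>
  also have "(\<Sum>(a,b,e)\<in>range w. pxz (a,e) * pyz (b,e) / pz e)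
      \<le> (\<Sum>(a,b,e)\<in>range x \<times> range y \<times> range z. pxz (a,e) * pyz (b,e) / pz e)"
    using simple_labelD(1)[OF x] simple_labelD(1)[OF y] simple_labelD(1)[OF z] nn
    by (intro sum_mono2) (auto simp: w_def)
  also have "\<dots> = (\<Sum>a\<in>range x. \<Sum>b\<in>range y. \<Sum>e\<in>range z. pxz (a,e) * pyz (b,e) / pz e)"
    by (simp add: sum.cartesian_product case_prod_unfold)
  also have "\<dots> = (\<Sum>a\<in>range x. \<Sum>e\<in>range z. \<Sum>b\<in>range y. pxz (a,e) * pyz (b,e) / pz e)"
    by (intro sum.cong refl, rule sum.swap)
  also have "\<dots> = (\<Sum>e\<in>range z. \<Sum>a\<in>range x. \<Sum>b\<in>range y. pxz (a,e) * pyz (b,e) / pz e)"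
    by (rule sum.swap)
  also have "\<dots> = (\<Sum>e\<in>range z. (\<Sum>a\<in>range x. pxz (a,e)) * (\<Sum>b\<in>range y. pyz (b,e)) / pz e)"
    by (simp add: sum_product sum_divide_distrib)
  also have "\<dots> = (\<Sum>e\<in>range z. pz e)" by (simp add: marg)
  also have "\<dots> = 1" unfolding pz_def by (rule sum_label_prob[OF z])
  finally show ?thesis by (simp add: w_def)
qed

lemma label_entropy_subadditive:
  assumes x: "simple_function M x" and y: "simple_function M y"
  shows "label_entropy M (\<lambda>u. (x u, y u)) \<le> label_entropy M x + label_entropy M y"
proof -
  \<comment> \<open>Conditioning on a constant label is no conditioning, so submodularity becomes
    subadditivity.\<close>
  define z where "z = (\<lambda>_::'a. ())"
  have z: "simple_function M z"
    unfolding z_def by simp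
  have "label_entropy M (\<lambda>u. (x u, y u)) = label_entropy M ((\<lambda>(a,b,_). (a,b)) \<circ> (\<lambda>u. (x u, y u, z u)))"
    by (simp add: comp_def)
  also have "\<dots> \<le> label_entropy M (\<lambda>u. (x u, y u, z u))"
    by (intro label_entropy_comp_le simple_function_Pair x y z)
  also have "\<dots> \<le> label_entropy M (\<lambda>u. (x u, z u)) + label_entropy M (\<lambda>u. (y u, z u))"
    using label_entropy_submodular[OF x y z] label_entropy_nonneg[of z] by simp
  also have "\<dots> \<le> label_entropy M x + label_entropy M y"
    using label_entropy_comp_le[OF x, of "\<lambda>a. (a, ())"] label_entropy_comp_le[OF y, of "\<lambda>a. (a, ())"]
    by (simp add: comp_def z_def)
  finally show ?thesis .
qed

end

section \<open>The Riesz representation on a compact metric space\<close>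

text \<open>The complement of \<open>U\<close> may be empty, where \<open>infdist\<close> returns the junk value 0.\<close>

definition depth :: "'a::metric_space set \<Rightarrow> 'a \<Rightarrow> real" where
  "depth U x = (if U = UNIV then 1 else infdist x (- U))"

lemma continuous_on_depth: "continuous_on S (depth U)"
  unfolding depth_def by (cases "U = UNIV") (auto intro!: continuous_intros)

lemma depth_nonneg: "0 \<le> depth U x"
  by (simp add: depth_def infdist_nonneg)

lemma depth_pos_iff:
  assumes "open U"
  shows "0 < depth U x \<longleftrightarrow> x \<in> U"
proof (cases "U = UNIV")
  case False
  then have "x \<in> - U \<longleftrightarrow> infdist x (- U) = 0"
    using assms by (intro in_closed_iff_infdist_zero) auto
  then show ?thesis using False infdist_nonneg[of x "- U"] by (auto simp: depth_def)
qed (simp add: depth_def)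

lemma depth_eq_0:
  assumes "open U" "x \<notin> U"
  shows "depth U x = 0"
  using depth_pos_iff[OF assms(1), of x] depth_nonneg[of U x] assms(2) by linarith

text \<open>The i-th summand is the slice of \<open>y\<close> between the heights i and i+1. This
  layer-cake decomposition is what later compares the functional with an integral.\<close>

lemma sum_truncations:
  fixes y :: real
  assumes "0 \<le> y"
  shows "(\<Sum>i<N. min 1 (max 0 (y - real i))) = min y (real N)"
  using assms by (induction N) (auto simp: min_def max_def)

lemma compact_bounded_continuous:
  fixes f :: "'a::metric_space \<Rightarrow> real"
  assumes "compact (UNIV :: 'a set)" "f \<in> cont_space"
  obtains B where "0 < B" "\<And>x. \<bar>f x\<bar> \<le> B"
proof -
  have "bounded (range f)"
    using compact_imp_bounded compact_continuous_image assms unfolding cont_space_def by blast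
  then show ?thesis using that bounded_pos[of "range f"] by auto
qed

text \<open>The setting of the Riesz-Markov theorem, with the functional normalised so that a
  probability measure results.\<close>

locale positive_functional =
  fixes L :: "('a::metric_space \<Rightarrow> real) \<Rightarrow> real"
  assumes compact_UNIV: "compact (UNIV :: 'a set)"
    and L_add: "f \<in> cont_space \<Longrightarrow> g \<in> cont_space \<Longrightarrow> L (\<lambda>x. f x + g x) = L f + L g"
    and L_scale: "f \<in> cont_space \<Longrightarrow> L (\<lambda>x. c * f x) = c * L f"
    and L_nonneg: "f \<in> cont_space \<Longrightarrow> (\<And>x. 0 \<le> f x) \<Longrightarrow> 0 \<le> L f"
    and L_one: "L (\<lambda>_. 1) = 1"
begin

lemma L_const: "L (\<lambda>_. c) = c"
  using L_scale[of "\<lambda>_. 1" c] L_one by (simp add: cont_space_def)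

lemma L_mono:
  assumes "f \<in> cont_space" "g \<in> cont_space" "\<And>x. f x \<le> g x"
  shows "L f \<le> L g"
proof -
  have "0 \<le> L (\<lambda>x. g x + (- 1) * f x)"
    using assms by (intro L_nonneg) (auto simp: cont_space_def intro!: continuous_intros)
  also have "\<dots> = L g + L (\<lambda>x. (- 1) * f x)"
    using assms by (intro L_add) (auto simp: cont_space_def intro!: continuous_intros)
  also have "L (\<lambda>x. (- 1) * f x) = - L f" using assms(1) by (subst L_scale) auto
  finally show ?thesis by simp
qed

lemma L_sum:
  assumes "\<And>i. i \<in> I \<Longrightarrow> f i \<in> cont_space"
  shows "L (\<lambda>x. \<Sum>i\<in>I. f i x) = (\<Sum>i\<in>I. L (f i))"
proof (cases "finite I")
  case True
  then show ?thesis using assms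
  proof (induction I)
    case (insert i I)
    then show ?case
      using L_add[of "f i" "\<lambda>x. \<Sum>i\<in>I. f i x"]
      by (auto simp: cont_space_def intro!: continuous_intros)
  qed (simp add: L_const)
qed (simp add: L_const)

section \<open>Outer measure generated by continuous functions below indicators\<close>

definition minorants :: "'a set \<Rightarrow> ('a \<Rightarrow> real) set" where
  "minorants U = {f \<in> cont_space. (\<forall>x. 0 \<le> f x \<and> f x \<le> 1) \<and> (\<forall>x. x \<notin> U \<longrightarrow> f x = 0)}"

definition inner_mass :: "'a set \<Rightarrow> ennreal" where
  "inner_mass U = (SUP f\<in>minorants U. ennreal (L f))"

definition outer_mass :: "'a set \<Rightarrow> ennreal" where
  "outer_mass A = (INF U\<in>{U. open U \<and> A \<subseteq> U}. inner_mass U)"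

lemma minorants_mono: "U \<subseteq> V \<Longrightarrow> minorants U \<subseteq> minorants V"
  by (auto simp: minorants_def)

lemma inner_mass_mono: "U \<subseteq> V \<Longrightarrow> inner_mass U \<le> inner_mass V"
  unfolding inner_mass_def by (intro SUP_subset_mono minorants_mono) auto

lemma outer_mass_open: "open U \<Longrightarrow> outer_mass U = inner_mass U"
  unfolding outer_mass_def by (intro antisym INF_lower INF_greatest inner_mass_mono) auto

lemma outer_mass_mono: "A \<subseteq> B \<Longrightarrow> outer_mass A \<le> outer_mass B"
  unfolding outer_mass_def by (intro INF_superset_mono) auto

lemma L_le_inner_mass: "f \<in> minorants U \<Longrightarrow> ennreal (L f) \<le> inner_mass U"
  unfolding inner_mass_def by (intro SUP_upper)

lemma L_minorant_nonneg: "f \<in> minorants U \<Longrightarrow> 0 \<le> L f"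
  by (intro L_nonneg) (auto simp: minorants_def)

lemma inner_mass_le_1: "inner_mass U \<le> 1"
  unfolding inner_mass_def
proof (intro SUP_least)
  fix f assume "f \<in> minorants U"
  then have "L f \<le> L (\<lambda>_. 1)" by (intro L_mono) (auto simp: minorants_def cont_space_def)
  then show "ennreal (L f) \<le> 1" using L_one by simp
qed

lemma inner_mass_UNIV: "inner_mass UNIV = 1"
proof (rule antisym[OF inner_mass_le_1])
  show "1 \<le> inner_mass UNIV"
    using L_le_inner_mass[of "\<lambda>_. 1" UNIV] L_one by (auto simp: minorants_def cont_space_def)
qed

lemma inner_mass_empty: "inner_mass {} = 0"
proof -
  have "minorants {} = {\<lambda>_. 0}" by (auto simp: minorants_def cont_space_def)
  then show ?thesis by (simp add: inner_mass_def L_const)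
qed

text \<open>Cutting off at height \<open>\<epsilon>\<close> makes the support a compact subset of the open set.\<close>

lemma truncate_minorant:
  assumes f: "f \<in> minorants U" and e: "0 < e"
  obtains f' where "f' \<in> cont_space" "\<And>x. 0 \<le> f' x" "\<And>x. f' x \<le> f x" "L f \<le> L f' + e"
    "\<And>x. f x < e \<Longrightarrow> f' x = 0"
proof -
  define f' where "f' x = max 0 (f x - e)" for x
  have 1: "f' \<in> cont_space"
    using f by (auto simp: f'_def minorants_def cont_space_def intro!: continuous_intros)
  have "L f \<le> L (\<lambda>x. f' x + e)"
    using 1 f by (intro L_mono) (auto simp: f'_def minorants_def cont_space_def intro!: continuous_intros)
  also have "\<dots> = L f' + e"
    using 1 L_const[of e] by (subst L_add) (auto simp: cont_space_def)
  finally have "L f \<le> L f' + e" .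
  moreover have "0 \<le> f' x" "f' x \<le> f x" "f x < e \<Longrightarrow> f' x = 0" for x 
    using f e by (auto simp: f'_def minorants_def)
  ultimately show ?thesis using 1 that by blast
qed

text \<open>After truncation, a minorant of the union lives on a compact set \<open>K\<close>.
  Finitely many \<open>U i\<close> cover \<open>K\<close>, and a partition of unity splits the
  function into minorants of these.\<close>

lemma inner_mass_countably_subadditive:
  fixes U :: "nat \<Rightarrow> 'a set"
  assumes U: "\<And>i. open (U i)"
  shows "inner_mass (\<Union>i. U i) \<le> (\<Sum>i. inner_mass (U i))"
  unfolding inner_mass_def[of "\<Union>i. U i"]
proof (intro SUP_least)
  fix f assume f: "f \<in> minorants (\<Union>i. U i)"
  show "ennreal (L f) \<le> (\<Sum>i. inner_mass (U i))"
  proof (rule ennreal_le_epsilon)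
    fix e :: real assume e: "0 < e"
    obtain f' where f': "f' \<in> cont_space" "\<And>x. 0 \<le> f' x" "\<And>x. f' x \<le> f x" "L f \<le> L f' + e"
      "\<And>x. f x < e \<Longrightarrow> f' x = 0" using truncate_minorant[OF f e] by blast
    define K where "K = {x. e \<le> f x}"
    have cf: "continuous_on UNIV f" using f by (auto simp: minorants_def cont_space_def)
    have "closed K" unfolding K_def using cf by (intro closed_Collect_le) auto
    then have K: "compact K" using compact_UNIV compact_Int_closed[of UNIV K] by simp
    have "K \<subseteq> (\<Union>i. U i)" using f e by (force simp: K_def minorants_def)
    then obtain I where I: "finite I" "K \<subseteq> (\<Union>i\<in>I. U i)"
      using compactE_image[OF K, of UNIV U] U by auto
    then obtain n where n: "I \<subseteq> {..<n}" using finite_nat_iff_bounded by auto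
    define D where "D x = (\<Sum>i<n. depth (U i) x)" for x
    have D_cont: "continuous_on S D" for S
      unfolding D_def by (intro continuous_intros continuous_on_depth)
    have D_pos: "0 < D x" if "x \<in> K" for x
    proof -
      obtain i where "i < n" "x \<in> U i" using I n \<open>x \<in> K\<close> by auto
      then have "0 < depth (U i) x" "i \<in> {..<n}" using depth_pos_iff U by auto
      then show ?thesis unfolding D_def by (intro sum_pos2[of _ i]) (auto simp: depth_nonneg)
    qed
    \<comment> \<open>\<open>D\<close> may vanish off \<open>K\<close>. Replacing the denominator by
      \<open>max (D x) d\<close> keeps it continuous and positive; on \<open>K\<close> nothing
      changes, and off \<open>K\<close> the numerator \<open>f'\<close> is 0.\<close>
    obtain d where d: "0 < d" "\<And>x. x \<in> K \<Longrightarrow> d \<le> D x"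
    proof (cases "K = {}")
      case False
      then obtain x where "x \<in> K" "\<forall>y\<in>K. D x \<le> D y"
        using continuous_attains_inf[OF K _ D_cont] by auto
      then show ?thesis using D_pos that by auto
    qed (use that[of 1] in auto)
    define g where "g i = (\<lambda>x. f' x * (depth (U i) x / max (D x) d))" for i
    have g_cont: "g i \<in> cont_space" for i
      using f'(1) d(1) unfolding g_def cont_space_def
      by (auto intro!: continuous_intros continuous_on_depth D_cont)
    have g: "g i \<in> minorants (U i)" if "i < n" for i
    proof -
      have "depth (U i) x \<le> D x" for x
        unfolding D_def using that by (intro member_le_sum) (auto simp: depth_nonneg)
      then have q: "0 \<le> depth (U i) x / max (D x) d" "depth (U i) x / max (D x) d \<le> 1" for x
        using d(1) depth_nonneg[of "U i" x] by (auto simp: divide_le_eq_1 le_max_iff_disj)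
      have f'_le: "f' x \<le> 1" for x using order_trans[OF f'(3)[of x], of 1] f by (auto simp: minorants_def)
      have "0 \<le> g i x" for x
        using mult_nonneg_nonneg[OF f'(2)[of x] q(1)[of x]] by (simp only: g_def)
      moreover have "g i x \<le> 1" for x
        using mult_le_one[OF f'_le[of x] q[of x]] by (simp only: g_def)
      moreover have "g i x = 0" if "x \<notin> U i" for x
        using depth_eq_0[OF U that] by (simp add: g_def)
      ultimately show ?thesis
        using g_cont by (simp add: minorants_def)
    qed
    have "f' = (\<lambda>x. \<Sum>i<n. g i x)"
    proof (rule ext)
      fix x show "f' x = (\<Sum>i<n. g i x)"
      proof (cases "x \<in> K")
        case True
        then have "max (D x) d = D x" "D x \<noteq> 0" using d D_pos[of x] by auto
        then show ?thesis unfolding g_def sum_distrib_left[symmetric] sum_divide_distrib[symmetric]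
          by (simp add: D_def[symmetric])
      next
        case False
        then show ?thesis using f'(5)[of x] by (simp add: g_def K_def)
      qed
    qed
    then have "L f' = (\<Sum>i<n. L (g i))" using L_sum[of "{..<n}" g] g_cont by simp
    then have "ennreal (L f) \<le> ennreal ((\<Sum>i<n. L (g i)) + e)"
      using f'(4) by (intro ennreal_leI) simp
    also have "\<dots> = (\<Sum>i<n. ennreal (L (g i))) + ennreal e"
    proof -
      have "0 \<le> L (g i)" if "i \<in> {..<n}" for i using L_minorant_nonneg[OF g] that by auto
      then have "(\<Sum>i<n. ennreal (L (g i))) = ennreal (\<Sum>i<n. L (g i))" "0 \<le> (\<Sum>i<n. L (g i))"
        by (auto intro: sum_ennreal sum_nonneg)
      then show ?thesis using e by (simp only: ennreal_plus less_imp_le)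
    qed
    also have "\<dots> \<le> (\<Sum>i<n. inner_mass (U i)) + ennreal e"
      using L_le_inner_mass[OF g] by (intro add_right_mono sum_mono) auto
    also have "\<dots> \<le> (\<Sum>i. inner_mass (U i)) + ennreal e"
      by (intro add_right_mono sum_le_suminf) auto
    finally show "ennreal (L f) \<le> (\<Sum>i. inner_mass (U i)) + ennreal e" .
  qed
qed

lemma outer_mass_close:
  assumes "0 < e"
  obtains U where "open U" "A \<subseteq> U" "inner_mass U \<le> outer_mass A + ennreal e"
proof -
  have "outer_mass A \<le> 1"
    unfolding outer_mass_def by (rule INF_lower2[of UNIV]) (auto simp: inner_mass_UNIV)
  also have "\<dots> < \<top>" by simp
  finally have "outer_mass A < outer_mass A + ennreal e"
    using assms by auto
  then have "\<exists>U\<in>{U. open U \<and> A \<subseteq> U}. inner_mass U < outer_mass A + ennreal e"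
    by (subst (asm) (1) outer_mass_def) (simp add: INF_less_iff)
  then show ?thesis using that by (auto intro: less_imp_le)
qed

lemma outer_measure_space_outer_mass: "outer_measure_space (Pow UNIV) outer_mass"
  unfolding outer_measure_space_def
proof (intro conjI)
  show "positive (Pow UNIV) outer_mass"
    by (simp add: positive_def outer_mass_open inner_mass_empty)
  show "increasing (Pow UNIV) outer_mass"
    by (auto simp: increasing_def outer_mass_mono)
  show "countably_subadditive (Pow UNIV) outer_mass"
    unfolding countably_subadditive_def
  proof (intro allI impI)
    fix A :: "nat \<Rightarrow> 'a set"
    show "outer_mass (\<Union>i. A i) \<le> (\<Sum>i. outer_mass (A i))"
    proof (rule ennreal_le_epsilon)
      fix e :: real assume e: "0 < e"
      have "\<exists>U. open U \<and> A i \<subseteq> U \<and> inner_mass U \<le> outer_mass (A i) + ennreal (e * (1/2) ^ Suc i)" for i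
        using outer_mass_close[of "e * (1/2) ^ Suc i" "A i"] e by auto
      then obtain U where U: "\<And>i. open (U i)" "\<And>i. A i \<subseteq> U i"
        "\<And>i. inner_mass (U i) \<le> outer_mass (A i) + ennreal (e * (1/2) ^ Suc i)" by metis
      have "outer_mass (\<Union>i. A i) \<le> outer_mass (\<Union>i. U i)"
        using U(2) by (intro outer_mass_mono) auto
      also have "\<dots> \<le> (\<Sum>i. inner_mass (U i))"
        using U(1) by (subst outer_mass_open) (auto intro: inner_mass_countably_subadditive)
      also have "\<dots> \<le> (\<Sum>i. outer_mass (A i) + ennreal (e * (1/2) ^ Suc i))"
        by (intro suminf_le U(3)) auto
      also have "\<dots> = (\<Sum>i. outer_mass (A i)) + (\<Sum>i. ennreal (e * (1/2) ^ Suc i))"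
        by (rule suminf_add[symmetric]) auto
      also have "(\<Sum>i. ennreal (e * (1/2) ^ Suc i)) = ennreal e"
        using sums_mult[OF power_half_series, of e] e by (intro suminf_ennreal_eq) auto
      finally show "outer_mass (\<Union>i. A i) \<le> (\<Sum>i. outer_mass (A i)) + ennreal e" .
    qed
  qed
qed

text \<open>Caratheodory's criterion. Let \<open>f\<close> be a minorant of
  \<open>U \<inter> V\<close>, cut down by \<open>d\<close> to \<open>f'\<close>, and let
  \<open>g\<close> be a minorant of \<open>W\<close>, the part of \<open>V\<close> where
  \<open>f < d\<close>. At each point at most one of \<open>f'\<close> and \<open>g\<close> is
  nonzero, so their sum is a minorant of \<open>V\<close>; and \<open>W\<close> contains
  \<open>A - U\<close> because \<open>f\<close> vanishes off \<open>U\<close>.\<close>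

lemma open_additive:
  assumes U: "open U"
  shows "outer_mass (U \<inter> A) + outer_mass (A - U) \<le> outer_mass A"
proof (rule ennreal_le_epsilon)
  fix e :: real assume "0 < e"
  define d where "d = e / 2"
  have d: "0 < d" "ennreal e = ennreal d + ennreal d"
    using \<open>0 < e\<close> by (auto simp: d_def simp flip: ennreal_plus)
  obtain V where V: "open V" "A \<subseteq> V" "inner_mass V \<le> outer_mass A + ennreal d"
    using outer_mass_close[OF d(1)] by blast
  have key: "ennreal (L f) + outer_mass (A - U) \<le> inner_mass V + ennreal d" if f: "f \<in> minorants (U \<inter> V)" for f
  proof -
    obtain f' where f': "f' \<in> cont_space" "\<And>x. 0 \<le> f' x" "\<And>x. f' x \<le> f x" "L f \<le> L f' + d"
      "\<And>x. f x < d \<Longrightarrow> f' x = 0" using truncate_minorant[OF f d(1)] by blast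
    define W where "W = V \<inter> {x. f x < d}"
    have cf: "continuous_on UNIV f" using f by (auto simp: minorants_def cont_space_def)
    have W: "open W" unfolding W_def using V(1) cf by (intro open_Int open_Collect_less) auto
    have "A - U \<subseteq> W" using V(2) f d(1) by (auto simp: W_def minorants_def)
    then have "ennreal (L f) + outer_mass (A - U) \<le> ennreal (L f) + inner_mass W"
      using outer_mass_mono[of "A - U" W] outer_mass_open[OF W] by (intro add_left_mono) simp
    also have "\<dots> \<le> (ennreal (L f') + ennreal d) + inner_mass W"
      using f'(4) d(1) L_nonneg[OF f'(1,2)]
      by (intro add_right_mono) (simp add: ennreal_leI flip: ennreal_plus)
    also have "\<dots> = (SUP g\<in>minorants W. ennreal (L f') + ennreal (L g)) + ennreal d"
    proof -
      have "minorants W \<noteq> {}" by (auto simp: minorants_def cont_space_def intro!: exI[of _ "\<lambda>_. 0"])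
      then show ?thesis unfolding inner_mass_def by (simp add: ennreal_SUP_add_right ac_simps)
    qed
    also have "(SUP g\<in>minorants W. ennreal (L f') + ennreal (L g)) \<le> inner_mass V"
    proof (intro SUP_least)
      fix g assume g: "g \<in> minorants W"
      have "(\<lambda>x. f' x + g x) \<in> minorants V"
      proof -
        have "f' x + g x \<le> 1" for x
          using f'(5)[of x] order_trans[OF f'(3)[of x], of 1] f g
          by (cases "f x < d") (auto simp: minorants_def W_def)
        moreover have "f' x = 0 \<and> g x = 0" if "x \<notin> V" for x
          using f'(2)[of x] f'(3)[of x] f g that by (auto simp: minorants_def W_def intro: antisym)
        ultimately show ?thesis
          using f'(1,2) g by (auto simp: minorants_def cont_space_def intro!: continuous_intros)
      qed
      from L_le_inner_mass[OF this]
      show "ennreal (L f') + ennreal (L g) \<le> inner_mass V"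
        using L_add[OF f'(1), of g] g L_minorant_nonneg[OF g] L_nonneg[OF f'(1,2)]
        by (simp add: minorants_def)
    qed
    finally show ?thesis by (simp add: add_right_mono)
  qed
  have "U \<inter> A \<subseteq> U \<inter> V" using V(2) by auto
  from outer_mass_mono[OF this] have "outer_mass (U \<inter> A) \<le> inner_mass (U \<inter> V)"
    by (simp add: outer_mass_open open_Int U V(1))
  then have "outer_mass (U \<inter> A) + outer_mass (A - U) \<le> inner_mass (U \<inter> V) + outer_mass (A - U)"
    by (rule add_right_mono)
  also have "\<dots> = (SUP f\<in>minorants (U \<inter> V). ennreal (L f) + outer_mass (A - U))"
  proof -
    have "minorants (U \<inter> V) \<noteq> {}" by (auto simp: minorants_def cont_space_def intro!: exI[of _ "\<lambda>_. 0"])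
    then show ?thesis unfolding inner_mass_def[of "U \<inter> V"] by (simp add: ennreal_SUP_add_left)
  qed
  also have "\<dots> \<le> inner_mass V + ennreal d" by (intro SUP_least key)
  also have "\<dots> \<le> outer_mass A + ennreal e"
    unfolding d(2) add.assoc[symmetric] by (intro add_right_mono V(3))
  finally show "outer_mass (U \<inter> A) + outer_mass (A - U) \<le> outer_mass A + ennreal e" .
qed

text \<open>Open sets satisfy Caratheodory's condition by \<open>open_additive\<close>; the sets
  satisfying it form a sigma-algebra, which therefore contains all Borel sets.\<close>

lemma measure_space_outer_mass: "measure_space UNIV (sets borel) outer_mass"
proof -
  interpret P: sigma_algebra "UNIV :: 'a set" "Pow UNIV" by (rule sigma_algebra_Pow)
  have ms: "measure_space UNIV (lambda_system UNIV (Pow UNIV) outer_mass) outer_mass"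
    by (rule P.caratheodory_lemma[OF outer_measure_space_outer_mass])
  then interpret S: sigma_algebra "UNIV :: 'a set" "lambda_system UNIV (Pow UNIV) outer_mass"
    by (simp add: measure_space_def)
  have "U \<in> lambda_system UNIV (Pow UNIV) outer_mass" if "open U" for U
  proof -
    have "outer_mass (U \<inter> A) + outer_mass ((UNIV - U) \<inter> A) = outer_mass A" for A
    proof (rule antisym)
      show "outer_mass (U \<inter> A) + outer_mass ((UNIV - U) \<inter> A) \<le> outer_mass A"
        using open_additive[OF that, of A] by (simp add: Diff_eq Int_commute)
      have "outer_mass ((U \<inter> A) \<union> ((UNIV - U) \<inter> A)) \<le> outer_mass (U \<inter> A) + outer_mass ((UNIV - U) \<inter> A)"
        using outer_measure_space_outer_mass
        by (intro subadditiveD[OF P.countably_subadditive_subadditive])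
           (auto simp: outer_measure_space_def)
      also have "(U \<inter> A) \<union> ((UNIV - U) \<inter> A) = A" by auto
      finally show "outer_mass A \<le> outer_mass (U \<inter> A) + outer_mass ((UNIV - U) \<inter> A)" .
    qed
    then show ?thesis by (auto simp: lambda_system_def)
  qed
  then have "sigma_sets UNIV {U. open U} \<subseteq> lambda_system UNIV (Pow UNIV) outer_mass"
    by (intro S.sigma_sets_subset) blast
  then have "sets borel \<subseteq> lambda_system UNIV (Pow UNIV) outer_mass"
    unfolding borel_def by simp
  then show ?thesis
    using measure_down[OF ms] sets.sigma_algebra_axioms[of "borel :: 'a measure"] by simp
qed

section \<open>The representing measure and its integral\<close>

definition riesz_measure :: "'a measure" where
  "riesz_measure = measure_of UNIV (sets borel) outer_mass"

lemma sets_riesz_measure: "sets riesz_measure = sets borel"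
  unfolding riesz_measure_def using sets.sets_measure_of_eq[of "borel :: 'a measure"] by simp

lemma space_riesz_measure: "space riesz_measure = UNIV"
  using sets_eq_imp_space_eq[OF sets_riesz_measure] by simp

lemma emeasure_riesz_measure: "A \<in> sets borel \<Longrightarrow> emeasure riesz_measure A = outer_mass A"
  using measure_space_outer_mass unfolding riesz_measure_def
  by (subst emeasure_measure_of_sigma) (auto simp: measure_space_def)

lemma prob_space_riesz_measure: "prob_space riesz_measure"
  by (rule prob_spaceI) (simp add: space_riesz_measure emeasure_riesz_measure outer_mass_open inner_mass_UNIV)

text \<open>Built into the definition of the outer mass as an infimum over open sets. The upper
  variational bound relies on this regularity.\<close>

lemma riesz_measure_outer_regular:
  assumes A: "A \<in> sets borel" and e: "0 < e"
  obtains U where "open U" "A \<subseteq> U" "measure riesz_measure U < measure riesz_measure A + e"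
proof -
  interpret prob_space riesz_measure by (rule prob_space_riesz_measure)
  obtain U where U: "open U" "A \<subseteq> U" "inner_mass U \<le> outer_mass A + ennreal (e/2)"
    using outer_mass_close[of "e/2"] e by auto
  then have "emeasure riesz_measure U \<le> emeasure riesz_measure A + ennreal (e/2)"
    using A by (simp add: emeasure_riesz_measure outer_mass_open)
  then have "measure riesz_measure U \<le> measure riesz_measure A + e/2"
    using e by (simp add: emeasure_eq_measure flip: ennreal_plus)
  then show ?thesis using that U e by force
qed

lemma integrable_riesz_measure:
  assumes "f \<in> cont_space"
  shows "integrable riesz_measure f"
proof -
  interpret prob_space riesz_measure by (rule prob_space_riesz_measure)
  obtain B where "\<And>x. \<bar>f x\<bar> \<le> B" using compact_bounded_continuous[OF compact_UNIV assms] by metis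
  moreover have "f \<in> borel_measurable riesz_measure"
    using borel_measurable_continuous_onI assms
    by (auto simp: cont_space_def measurable_cong_sets[OF sets_riesz_measure refl])
  ultimately show ?thesis by (intro integrable_const_bound[of _ B]) auto
qed

text \<open>The function is cut into \<open>N\<close> horizontal slices of height 1/N. Each rescaled
  slice \<open>h i\<close> is a minorant of the open level set \<open>A i\<close>, so its value
  under \<open>L\<close> is at most the measure of \<open>A i\<close>, and the indicators of these
  sets sum to at most \<open>N * f + 1\<close>. After division the error is 1/N.\<close>

lemma L_le_integral_unit:
  assumes f: "f \<in> cont_space" "\<And>x. 0 \<le> f x" "\<And>x. f x \<le> 1"
  shows "L f \<le> (\<integral>x. f x \<partial>riesz_measure)"
proof (rule field_le_epsilon)
  fix e :: real assume e: "0 < e"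
  interpret prob_space riesz_measure by (rule prob_space_riesz_measure)
  obtain n where "inverse (real (Suc n)) < e" using reals_Archimedean[OF e] by blast
  define N where "N = Suc n"
  have N: "0 < N" "inverse (real N) < e" using \<open>inverse (real (Suc n)) < e\<close> by (auto simp: N_def)
  define h where "h i = (\<lambda>x. min 1 (max 0 (N * f x - real i)))" for i
  define A where "A i = {x. real i < N * f x}" for i
  have h_cont: "h i \<in> cont_space" for i
    using f(1) by (auto simp: h_def cont_space_def intro!: continuous_intros)
  have A: "open (A i)" for i
    using f(1) by (auto simp: A_def cont_space_def intro!: open_Collect_less continuous_intros)
  then have A_sets: "A i \<in> sets riesz_measure" for i by (simp add: sets_riesz_measure)
  have "N * L f = L (\<lambda>x. \<Sum>i<N. h i x)"
    using f N unfolding h_def by (subst sum_truncations) (auto simp: min_absorb1 mult_le_cancel_left1 L_scale)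
  also have "\<dots> = (\<Sum>i<N. L (h i))" by (rule L_sum[OF h_cont])
  also have "\<dots> \<le> (\<Sum>i<N. prob (A i))"
  proof (intro sum_mono)
    fix i assume "i \<in> {..<N}"
    have "h i \<in> minorants (A i)" using h_cont by (auto simp: minorants_def A_def h_def)
    from L_le_inner_mass[OF this] have "ennreal (L (h i)) \<le> emeasure riesz_measure (A i)"
      using A by (simp add: emeasure_riesz_measure outer_mass_open)
    then show "L (h i) \<le> prob (A i)" by (simp add: emeasure_eq_measure)
  qed
  also have "\<dots> = (\<integral>x. (\<Sum>i<N. indicator (A i) x) \<partial>riesz_measure)"
    using A_sets by (subst Bochner_Integration.integral_sum) (auto simp: space_riesz_measure intro!: integrable_real_indicator emeasure_finite[THEN less_top[THEN iffD1]] simp: less_top)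
  also have "\<dots> \<le> (\<integral>x. N * f x + 1 \<partial>riesz_measure)"
  proof (intro integral_mono)
    show "integrable riesz_measure (\<lambda>x. \<Sum>i<N. indicator (A i) x :: real)"
      using A_sets by (auto intro!: integrable_real_indicator simp: less_top[symmetric])
    show "integrable riesz_measure (\<lambda>x. N * f x + 1)"
      using integrable_riesz_measure[OF f(1)] by auto
    fix x
    \<comment> \<open>On \<open>A i\<close> the shifted function \<open>N * f + 1\<close> exceeds
      i+1, so its i-th slice is full.\<close>
    have "(\<Sum>i<N. indicator (A i) x) \<le> (\<Sum>i<N. min 1 (max 0 ((N * f x + 1) - real i)))"
      by (intro sum_mono) (auto simp: A_def indicator_def)
    also have "\<dots> \<le> N * f x + 1" using f(2)[of x] by (subst sum_truncations) auto
    finally show "(\<Sum>i<N. indicator (A i) x) \<le> N * f x + 1" .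
  qed
  also have "\<dots> = N * (\<integral>x. f x \<partial>riesz_measure) + 1"
    using integrable_riesz_measure[OF f(1)] prob_space by simp
  finally have "L f \<le> (\<integral>x. f x \<partial>riesz_measure) + inverse N"
    using N(1) by (simp add: field_simps)
  then show "L f \<le> (\<integral>x. f x \<partial>riesz_measure) + e" using N(2) by simp
qed

lemma L_eq_integral:
  assumes f: "f \<in> cont_space"
  shows "L f = (\<integral>x. f x \<partial>riesz_measure)"
proof -
  interpret prob_space riesz_measure by (rule prob_space_riesz_measure)
  have le: "L f \<le> (\<integral>x. f x \<partial>riesz_measure)" if f: "f \<in> cont_space" for f
  proof -
    obtain B where B: "0 < B" "\<And>x. \<bar>f x\<bar> \<le> B"
      using compact_bounded_continuous[OF compact_UNIV f] by metis
    \<comment> \<open>With this factor \<open>k * f + 1 / 2\<close> takes values between 0 and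
      1.\<close>
    define k where "k = 1 / (2 * B)"
    have k: "0 < k" using B(1) by (simp add: k_def)
    define h where "h x = k * f x + 1 / 2" for x
    have h: "h \<in> cont_space"
      using f by (auto simp: h_def cont_space_def intro!: continuous_intros)
    have bnd: "0 \<le> h x" "h x \<le> 1" for x using B(1) B(2)[of x] by (auto simp: h_def k_def field_simps)
    have "L h = L (\<lambda>x. k * f x) + L (\<lambda>_. 1 / 2)"
      unfolding h_def using f
      by (intro L_add) (auto simp: cont_space_def intro!: continuous_intros)
    then have "L h = k * L f + 1 / 2"
      by (simp only: L_scale[OF f] L_const)
    moreover have "(\<integral>x. h x \<partial>riesz_measure) = k * (\<integral>x. f x \<partial>riesz_measure) + 1 / 2"
      unfolding h_def using integrable_riesz_measure[OF f] prob_space by simp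
    ultimately have "k * L f \<le> k * (\<integral>x. f x \<partial>riesz_measure)"
      using L_le_integral_unit[OF h bnd] by simp
    then show ?thesis using k by simp
  qed
  have "(\<lambda>x. - 1 * f x) \<in> cont_space" using f by (auto simp: cont_space_def intro!: continuous_intros)
  from le[OF this] have "- L f \<le> - (\<integral>x. f x \<partial>riesz_measure)" using L_scale[OF f, of "-1"] by simp
  with le[OF f] show ?thesis by simp
qed

end

section \<open>Entropy of an invariant measure through words\<close>

text \<open>Division of \<open>n\<close> by \<open>q\<close> with remainder bounds
  \<open>a n / n\<close> by \<open>a q / q\<close> up to a constant over \<open>n\<close>, hence the
  quotients converge to their infimum, which is finite by nonnegativity. That the limit lies below
  every single quotient is used as well.\<close>

lemma fekete:
  fixes a :: "nat \<Rightarrow> real"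
  assumes sub: "\<And>m n. a (m + n) \<le> a m + a n" and nonneg: "\<And>n. 0 \<le> a n"
  obtains l where "(\<lambda>n. a n / real n) \<longlonglongrightarrow> l" "\<And>q. 0 < q \<Longrightarrow> l \<le> a q / real q"
proof -
  define l where "l = (INF q\<in>{0<..}. a q / real q)"
  have bdd: "bdd_below ((\<lambda>q. a q / real q) ` {0<..})"
    using nonneg by (intro bdd_belowI2[of _ 0]) auto
  have lower: "l \<le> a q / real q" if "0 < q" for q
    unfolding l_def using that by (intro cINF_lower bdd) auto
  have mult: "a (q * k + r) \<le> real k * a q + a r" for q k r
  proof (induction k)
    case (Suc k)
    have "a (q * Suc k + r) \<le> a q + a (q * k + r)"
      using sub[of q "q * k + r"] by (simp add: algebra_simps)
    with Suc show ?case by (simp add: algebra_simps)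
  qed simp
  have one: "a r \<le> real r * a 1 + a 0" for r using mult[of 1 r 0] by simp
  have upper: "a n / real n \<le> a q / real q + (real q * a 1 + a 0) / real n" if "0 < q" "0 < n" for q n
  proof -
    have "a n \<le> real (n div q) * a q + a (n mod q)" using mult[of q "n div q" "n mod q"] by simp
    also have "a (n mod q) \<le> real (n mod q) * a 1 + a 0" by (rule one)
    also have "real (n mod q) * a 1 \<le> real q * a 1"
      using that nonneg by (intro mult_right_mono) (auto intro: less_imp_le mod_less_divisor)
    also have "real (n div q) * a q \<le> real n / real q * a q"
      using nonneg by (intro mult_right_mono of_nat_div_le_of_nat)
    finally have "a n \<le> real n / real q * a q + (real q * a 1 + a 0)" by simp
    then show ?thesis using that by (simp add: field_simps)
  qed
  have "(\<lambda>n. a n / real n) \<longlonglongrightarrow> l"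
  proof (rule LIMSEQ_I)
    fix e :: real assume e: "0 < e"
    have "\<exists>q\<in>{0<..}. a q / real q < l + e / 2"
      using e bdd unfolding l_def by (subst cINF_less_iff[symmetric]) auto
    then obtain q where q: "0 < q" "a q / real q < l + e / 2" by auto
    have "(\<lambda>n. (real q * a 1 + a 0) / real n) \<longlonglongrightarrow> 0" by (rule lim_const_over_n)
    then have "eventually (\<lambda>n. (real q * a 1 + a 0) / real n < e / 2) sequentially"
      using e by (intro order_tendstoD) auto
    then obtain N where N: "\<And>n. N \<le> n \<Longrightarrow> (real q * a 1 + a 0) / real n < e / 2"
      by (auto simp: eventually_sequentially)
    have "norm (a n / real n - l) < e" if "max 1 N \<le> n" for n
    proof -
      from that have n: "0 < n" "N \<le> n" by auto
      show ?thesis using upper[OF q(1) n(1)] N[OF n(2)] q(2) lower[OF n(1)]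
        unfolding real_norm_def by linarith
    qed
    then show "\<exists>N. \<forall>n\<ge>N. norm (a n / real n - l) < e" by blast
  qed
  then show ?thesis using that lower by blast
qed

text \<open>The itinerary of a point. Its fibres are the atoms of the iterated join, and appending
  lists takes the place of refining partitions.\<close>

definition word :: "('a \<Rightarrow> 'a) \<Rightarrow> ('a \<Rightarrow> 'l) \<Rightarrow> nat \<Rightarrow> 'a \<Rightarrow> 'l list" where
  "word T c n x = map (\<lambda>i. c ((T ^^ i) x)) [0..<n]"

lemma length_word [simp]: "length (word T c n x) = n"
  by (simp add: word_def)

lemma nth_word [simp]: "i < n \<Longrightarrow> word T c n x ! i = c ((T ^^ i) x)"
  by (simp add: word_def)

lemma word_eq_iff: "word T c n x = w \<longleftrightarrow> length w = n \<and> (\<forall>i<n. c ((T ^^ i) x) = w ! i)"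
  by (auto simp: list_eq_iff_nth_eq)

lemma word_add: "word T c (m + n) x = word T c m x @ word T c n ((T ^^ m) x)"
  by (rule nth_equalityI) (auto simp: nth_append funpow_add[THEN fun_cong, simplified, symmetric] add.commute)

lemma word_Suc: "word T c (Suc n) x = word T c n x @ [c ((T ^^ n) x)]"
  by (simp add: word_def)

lemma simple_function_word:
  assumes "\<And>i. simple_function M (\<lambda>x. c ((T ^^ i) x))"
  shows "simple_function M (word T c n)"
proof (induction n)
  case 0
  then show ?case by (simp add: word_def)
next
  case (Suc n)
  have "simple_function M ((\<lambda>(a, b). a @ [b]) \<circ> (\<lambda>x. (word T c n x, c ((T ^^ n) x))))"
    by (intro simple_function_compose simple_function_Pair Suc assms)
  then show ?case by (simp add: comp_def word_Suc[abs_def])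
qed

context prob_space_UNIV
begin

lemma label_entropy_superset:
  assumes "finite S" "range c \<subseteq> S"
  shows "label_entropy M c = (\<Sum>l\<in>S. - label_prob M c l * ln (label_prob M c l))"
  unfolding label_entropy_def
proof (intro sum.mono_neutral_left assms ballI)
  fix l assume "l \<in> S - range c"
  then have "c -` {l} = {}" by auto
  then show "- label_prob M c l * ln (label_prob M c l) = 0" by (simp add: label_prob_def)
qed

text \<open>The shift stays inside the last entropy because \<open>M\<close> need not be invariant:
  the lemma is also applied to Gibbs weights on a separated set.\<close>

lemma label_entropy_word_add:
  assumes "\<And>i. simple_function M (\<lambda>x. c ((T ^^ i) x))"
  shows "label_entropy M (word T c (m + n))
    \<le> label_entropy M (word T c m) + label_entropy M (\<lambda>x. word T c n ((T ^^ m) x))"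
proof -
  note sm = simple_function_word[of M c T, OF assms]
  \<comment> \<open>The shifted word is the tail of a longer word and inherits measurability from
    it.\<close>
  have sn: "simple_function M (\<lambda>x. word T c n ((T ^^ m) x))"
  proof -
    have eq: "drop m \<circ> word T c (m + n) = (\<lambda>x. word T c n ((T ^^ m) x))"
      by (auto simp: word_add)
    show ?thesis using simple_function_compose[OF sm[of "m + n"], of "drop m"] unfolding eq .
  qed
  have "(\<lambda>(a, b). a @ b) \<circ> (\<lambda>x. (word T c m x, word T c n ((T ^^ m) x))) = word T c (m + n)"
    by (auto simp: word_add)
  then have "label_entropy M (word T c (m + n))
      \<le> label_entropy M (\<lambda>x. (word T c m x, word T c n ((T ^^ m) x)))"
    using label_entropy_comp_le[OF simple_function_Pair[OF sm[of m] sn], of "\<lambda>(a, b). a @ b"] by simp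
  also have "\<dots> \<le> label_entropy M (word T c m) + label_entropy M (\<lambda>x. word T c n ((T ^^ m) x))"
    by (intro label_entropy_subadditive sm sn)
  finally show ?thesis .
qed

text \<open>Connects the entropy of partitions with that of words. The nonempty members of the join
  are exactly the fibres of the words that occur; the empty set, which may also be a member,
  contributes 0.\<close>

lemma partition_entropy_join:
  assumes c: "\<And>i. simple_function M (\<lambda>x. c ((T ^^ i) x))"
  shows "partition_entropy M (iterated_join T ((\<lambda>l. c -` {l}) ` range c) n) = label_entropy M (word T c n)"
proof -
  let ?\<xi> = "(\<lambda>l. c -` {l}) ` range c" and ?w = "word T c n"
  note sw = simple_function_word[of M c T, OF c, of n]
  have join: "B \<in> iterated_join T ?\<xi> n \<longleftrightarrow> (\<exists>l. (\<forall>i<n. l i \<in> range c) \<and> B = ?w -` {map l [0..<n]})" for B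
  proof
    assume "B \<in> iterated_join T ?\<xi> n"
    then obtain A where A: "\<forall>i<n. A i \<in> ?\<xi>" "B = (\<Inter>i\<in>{..<n}. (T ^^ i) -` A i)"
      by (auto simp: iterated_join_def)
    have "\<exists>l. i < n \<longrightarrow> l \<in> range c \<and> A i = c -` {l}" for i
    proof (cases "i < n")
      case True
      then have "A i \<in> ?\<xi>" using A(1) by simp
      then obtain l where "A i = c -` {l}" "l \<in> range c" by (rule imageE)
      then show ?thesis by (intro exI[of _ l]) simp
    qed simp
    then have "\<exists>l. \<forall>i. i < n \<longrightarrow> l i \<in> range c \<and> A i = c -` {l i}" by (intro choice allI)
    then obtain l where "\<And>i. i < n \<Longrightarrow> l i \<in> range c \<and> A i = c -` {l i}" by auto
    then show "\<exists>l. (\<forall>i<n. l i \<in> range c) \<and> B = ?w -` {map l [0..<n]}"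
      using A(2) by (intro exI[of _ l]) (auto simp: word_eq_iff)
  next
    assume "\<exists>l. (\<forall>i<n. l i \<in> range c) \<and> B = ?w -` {map l [0..<n]}"
    then obtain l where l: "\<forall>i<n. l i \<in> range c" "B = ?w -` {map l [0..<n]}" by blast
    then show "B \<in> iterated_join T ?\<xi> n"
      unfolding iterated_join_def by (auto intro!: exI[of _ "\<lambda>i. c -` {l i}"] simp: word_eq_iff)
  qed
  let ?W = "(\<lambda>w. ?w -` {w}) ` range ?w"
  have 1: "?W \<subseteq> iterated_join T ?\<xi> n"
  proof
    fix A assume "A \<in> ?W"
    then obtain x where "A = ?w -` {?w x}" by auto
    then show "A \<in> iterated_join T ?\<xi> n"
      unfolding join by (intro exI[of _ "\<lambda>i. c ((T ^^ i) x)"]) (auto simp: word_def)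
  qed
  have 2: "A = {}" if "A \<in> iterated_join T ?\<xi> n - ?W" for A
  proof -
    from that join[of A] obtain l where l: "A = ?w -` {map l [0..<n]}" "A \<notin> ?W" by auto
    then have "map l [0..<n] \<notin> range ?w" by (metis image_eqI)
    then have "?w x \<noteq> map l [0..<n]" for x by (metis rangeI)
    then show "A = {}" using l(1) by auto
  qed
  have "finite ?W" using simple_labelD(1)[OF sw] by simp
  moreover have "iterated_join T ?\<xi> n \<subseteq> insert {} ?W" using 2 by blast
  ultimately have fin: "finite (iterated_join T ?\<xi> n)" using finite_subset by blast
  have "partition_entropy M (iterated_join T ?\<xi> n) = - (\<Sum>A\<in>?W. measure M A * ln (measure M A))"
    unfolding partition_entropy_def using 1 2 fin
    by (intro arg_cong[of _ _ uminus] sum.mono_neutral_right) force+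
  also have "(\<Sum>A\<in>?W. measure M A * ln (measure M A))
      = (\<Sum>w\<in>range ?w. measure M (?w -` {w}) * ln (measure M (?w -` {w})))"
    by (subst sum.reindex) (auto simp: inj_on_def set_eq_iff)
  finally show ?thesis by (simp add: label_entropy_def label_prob_def sum_negf)
qed

end

lemma continuous_on_funpow:
  fixes T :: "'a::topological_space \<Rightarrow> 'a"
  assumes "continuous_on UNIV T"
  shows "continuous_on S (T ^^ i)"
proof -
  have "continuous_on UNIV (T ^^ i)"
    by (induction i) (auto intro!: continuous_intros continuous_on_compose2[OF assms] simp: id_def)
  then show ?thesis by (rule continuous_on_subset) simp
qed

section \<open>Stationarity and the entropy of an invariant measure\<close>

locale invariant_system =
  fixes T :: "'a::metric_space \<Rightarrow> 'a" and M :: "'a measure"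
  assumes continuous_T: "continuous_on UNIV T"
    and invariant: "M \<in> invariant_measures T"
begin

sublocale prob_space_UNIV M
proof -
  interpret prob_space M using invariant by (simp add: invariant_measures_def)
  have "space M = UNIV"
    using invariant sets_eq_imp_space_eq[of M borel] by (simp add: invariant_measures_def)
  then show "prob_space_UNIV M" by unfold_locales
qed

lemma sets_M: "sets M = sets borel"
  using invariant by (simp add: invariant_measures_def)

lemma continuous_iterate: "continuous_on S (T ^^ i)"
  by (rule continuous_on_funpow[OF continuous_T])

lemma measurable_iterate: "T ^^ i \<in> measurable M M"
  using borel_measurable_continuous_onI[OF continuous_iterate, of i]
  by (simp add: measurable_cong_sets[OF sets_M sets_M])

lemma distr_iterate: "distr M M (T ^^ i) = M"
proof (induction i)
  case 0
  then show ?case by (simp add: id_def distr_id)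
next
  case (Suc i)
  have T1: "T \<in> measurable M M" using measurable_iterate[of 1] by simp
  have "distr M M T = M"
    using invariant sets_M by (simp add: invariant_measures_def cong: distr_cong)
  moreover have "distr M M (T ^^ Suc i) = distr (distr M M (T ^^ i)) M T"
    using measurable_iterate[of i] T1 by (subst distr_distr) (auto simp: comp_def)
  ultimately show ?case using Suc by (simp only:)
qed

lemma measure_iterate:
  assumes "A \<in> sets M"
  shows "measure M ((T ^^ i) -` A) = measure M A"
proof -
  have "measure M A = measure (distr M M (T ^^ i)) A" by (simp add: distr_iterate)
  also have "\<dots> = measure M ((T ^^ i) -` A)"
    using measurable_iterate assms by (subst measure_distr) (auto simp: space_UNIV)
  finally show ?thesis by simp
qed

lemma integral_iterate:
  fixes f :: "'a \<Rightarrow> real"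
  assumes "f \<in> borel_measurable M"
  shows "(\<integral>x. f ((T ^^ i) x) \<partial>M) = (\<integral>x. f x \<partial>M)"
  using integral_distr[OF measurable_iterate assms, of i] by (simp add: distr_iterate)

lemma simple_function_iterate:
  assumes "simple_function M c"
  shows "simple_function M (\<lambda>x. c ((T ^^ i) x))"
  using simple_function_comp[OF measurable_iterate assms] by (simp add: comp_def)

lemma label_entropy_iterate:
  assumes c: "simple_function M c"
  shows "label_entropy M (\<lambda>x. c ((T ^^ i) x)) = label_entropy M c"
proof -
  have "label_prob M (\<lambda>x. c ((T ^^ i) x)) l = label_prob M c l" for l
    using measure_iterate[OF simple_labelD(2)[OF c, of "{l}"], of i]
    by (simp add: label_prob_def vimage_def)
  then show ?thesis
    using label_entropy_superset[OF simple_labelD(1)[OF c], of "\<lambda>x. c ((T ^^ i) x)"]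
    by (auto simp: label_entropy_def)
qed

text \<open>Invariance removes the shift in \<open>label_entropy_word_add\<close>, so the word
  entropies are subadditive and Fekete's lemma applies. Hence the \<open>lim\<close> in
  \<open>entropy_wrt\<close> is a genuine limit.\<close>

lemma entropy_wrt_label:
  assumes c: "simple_function M c"
  defines "h \<equiv> entropy_wrt M T ((\<lambda>l. c -` {l}) ` range c)"
  shows "(\<lambda>n. label_entropy M (word T c n) / n) \<longlonglongrightarrow> h"
    and "0 < q \<Longrightarrow> h \<le> label_entropy M (word T c q) / q"
proof -
  note sc = simple_function_iterate[OF c]
  note sw = simple_function_word[of M c T, OF sc]
  have "label_entropy M (word T c (m + n)) \<le> label_entropy M (word T c m) + label_entropy M (word T c n)" for m n
    using label_entropy_word_add[of c T, OF sc, of m n] label_entropy_iterate[OF sw, of n m] by simp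
  then obtain l where l: "(\<lambda>n. label_entropy M (word T c n) / real n) \<longlonglongrightarrow> l"
    "\<And>q. 0 < q \<Longrightarrow> l \<le> label_entropy M (word T c q) / real q"
    using fekete[of "\<lambda>n. label_entropy M (word T c n)"] label_entropy_nonneg by metis
  have "h = l"
    unfolding h_def entropy_wrt_def partition_entropy_join[of c T, OF sc] using l(1) by (intro limI) simp
  with l show "(\<lambda>n. label_entropy M (word T c n) / n) \<longlonglongrightarrow> h"
    and "0 < q \<Longrightarrow> h \<le> label_entropy M (word T c q) / q" by auto
qed

lemma measure_entropy_ge:
  assumes c: "simple_function M c" and K: "\<And>q. 0 < q \<Longrightarrow> K \<le> label_entropy M (word T c q) / q"
  shows "ereal K \<le> measure_entropy M T"
proof -
  let ?\<xi> = "(\<lambda>l. c -` {l}) ` range c"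
  have "finite_borel_partition ?\<xi>"
    using simple_labelD[OF c] sets_M
    by (auto simp: finite_borel_partition_def partition_on_def disjoint_def)
  then have "ereal (entropy_wrt M T ?\<xi>) \<le> measure_entropy M T"
    unfolding measure_entropy_def by (intro SUP_upper) auto
  moreover have "K \<le> entropy_wrt M T ?\<xi>"
    using entropy_wrt_label(1)[OF c] K
    by (intro LIMSEQ_le_const) (auto intro!: exI[of _ 1])
  ultimately show ?thesis by (meson ereal_less_eq(3) order_trans)
qed

text \<open>Since the defining limit exists, a bound at infinitely many multiples of some block
  length \<open>m\<close> is enough; \<open>m\<close> may depend on the labelling and on
  \<open>e\<close>.\<close>

lemma measure_entropy_le:
  assumes K: "\<And>c :: 'a \<Rightarrow> 'a set. \<And>e::real. simple_function M c \<Longrightarrow> 0 < e \<Longrightarrow>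
    \<exists>m>0. \<exists>\<^sub>F n in sequentially. label_entropy M (word T c (m * n)) / (m * n) \<le> K + e"
  shows "measure_entropy M T \<le> ereal K"
  unfolding measure_entropy_def
proof (intro SUP_least, clarify)
  fix \<xi> :: "'a set set" assume \<xi>: "finite_borel_partition \<xi>"
  have ex1: "\<exists>!A. A \<in> \<xi> \<and> x \<in> A" for x
  proof -
    have "\<Union>\<xi> = UNIV" "disjoint \<xi>"
      using \<xi> by (simp_all add: finite_borel_partition_def partition_on_def)
    moreover from this obtain A where "A \<in> \<xi>" "x \<in> A" by blast
    ultimately show ?thesis by (intro ex1I[of _ A]) (auto simp: disjoint_def)
  qed
  \<comment> \<open>Each point is labelled by the atom containing it, so the fibres of
    \<open>c\<close> are the members of the partition themselves.\<close>
  define c where "c x = (THE A. A \<in> \<xi> \<and> x \<in> A)" for x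
  have c: "c x \<in> \<xi>" "x \<in> c x" for x using theI'[OF ex1, of x] by (auto simp: c_def)
  have c_eq: "c x = A" if "A \<in> \<xi>" "x \<in> A" for x A using ex1[of x] c[of x] that by blast
  have vim: "c -` {A} = A" if "A \<in> \<xi>" for A using c c_eq that by auto
  have range: "range c = \<xi>"
  proof
    show "\<xi> \<subseteq> range c"
    proof
      fix A assume A: "A \<in> \<xi>"
      moreover have "{} \<notin> \<xi>" using \<xi> by (simp add: finite_borel_partition_def partition_on_def)
      ultimately obtain x where "x \<in> A" by fastforce
      then show "A \<in> range c" using c_eq A by blast
    qed
  qed (use c in auto)
  have \<xi>_eq: "(\<lambda>l. c -` {l}) ` range c = \<xi>" unfolding range using vim by auto
  have sc: "simple_function M c"
    unfolding simple_function_def space_UNIV Int_UNIV_right range using \<xi> vim sets_M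
    by (auto simp: finite_borel_partition_def)
  have lim: "(\<lambda>n. label_entropy M (word T c n) / n) \<longlonglongrightarrow> entropy_wrt M T \<xi>"
    using entropy_wrt_label(1)[OF sc] \<xi>_eq by simp
  have "entropy_wrt M T \<xi> \<le> K"
  proof (rule field_le_epsilon)
    fix e :: real assume "0 < e"
    from K[OF sc this] obtain m where m: "0 < m"
      "\<exists>\<^sub>F n in sequentially. label_entropy M (word T c (m * n)) / (m * n) \<le> K + e" by blast
    have "filterlim (\<lambda>n. m * n) sequentially sequentially"
      using m(1) by (intro filterlim_subseq) (auto simp: strict_mono_def)
    from filterlim_compose[OF lim this]
    have lim': "(\<lambda>n. label_entropy M (word T c (m * n)) / (m * n)) \<longlonglongrightarrow> entropy_wrt M T \<xi>" by simp
    show "entropy_wrt M T \<xi> \<le> K + e"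
    proof (rule ccontr)
      assume "\<not> entropy_wrt M T \<xi> \<le> K + e"
      then have "eventually (\<lambda>n. K + e < label_entropy M (word T c (m * n)) / (m * n)) sequentially"
        using lim' by (intro order_tendstoD) auto
      then show False
        using m(2) unfolding frequently_def not_le by contradiction
    qed
  qed
  then show "ereal (entropy_wrt M T \<xi>) \<le> ereal K" by simp
qed

end

section \<open>Pressure of an expansive map\<close>

text \<open>Splits a limsup into two halves of different strength: upper estimates hold eventually,
  lower ones only frequently.\<close>

lemma bounded_limsup_real:
  fixes u :: "nat \<Rightarrow> real"
  assumes "\<And>n. \<bar>u n\<bar> \<le> D"
  obtains r where "limsup (\<lambda>n. ereal (u n)) = ereal r"
    "\<And>e. 0 < e \<Longrightarrow> eventually (\<lambda>n. u n < r + e) sequentially"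
    "\<And>e. 0 < e \<Longrightarrow> \<exists>\<^sub>F n in sequentially. r - e < u n"
proof -
  let ?L = "limsup (\<lambda>n. ereal (u n))"
  have "u n \<le> D" "- D \<le> u n" for n using assms[of n] by linarith+
  then have "?L \<le> ereal D" "ereal (- D) \<le> ?L"
    by (auto intro!: Limsup_bounded le_Limsup simp: always_eventually)
  then obtain r where r: "?L = ereal r" by (cases ?L) auto
  have "eventually (\<lambda>n. u n < r + e) sequentially" if "0 < e" for e
    using Limsup_lessD[of sequentially "\<lambda>n. ereal (u n)" "ereal (r + e)"] that r by simp
  moreover have "\<exists>\<^sub>F n in sequentially. r - e < u n" if "0 < e" for e
  proof (rule ccontr)
    assume "\<not> (\<exists>\<^sub>F n in sequentially. r - e < u n)"
    then have "eventually (\<lambda>n. ereal (u n) \<le> ereal (r - e)) sequentially"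
      by (simp add: frequently_def not_less)
    then have "?L \<le> ereal (r - e)" by (rule Limsup_bounded)
    then show False using r that by simp
  qed
  ultimately show ?thesis using that r by blast
qed

lemma limsup_le_real:
  fixes u :: "nat \<Rightarrow> real"
  assumes "\<And>e. 0 < e \<Longrightarrow> eventually (\<lambda>n. u n < r + e) sequentially"
  shows "limsup (\<lambda>n. ereal (u n)) \<le> ereal r"
proof (rule ereal_le_epsilon2)
  fix e :: real assume "0 < e"
  then have "eventually (\<lambda>n. ereal (u n) \<le> ereal r + ereal e) sequentially"
    using assms[of e] by (auto elim!: eventually_mono)
  then show "limsup (\<lambda>n. ereal (u n)) \<le> ereal r + ereal e" by (rule Limsup_bounded)
qed

lemma bowen_dist_le_iff: "0 < n \<Longrightarrow> bowen_dist T n x y \<le> e \<longleftrightarrow> (\<forall>k<n. dist ((T ^^ k) x) ((T ^^ k) y) \<le> e)"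
  unfolding bowen_dist_def by (subst Max_le_iff) auto

lemma bowen_dist_gt_iff: "0 < n \<Longrightarrow> e < bowen_dist T n x y \<longleftrightarrow> (\<exists>k<n. e < dist ((T ^^ k) x) ((T ^^ k) y))"
  using bowen_dist_le_iff[of n T x y e] by (metis not_le)

text \<open>If the cells of the labelling have diameter at most \<open>e\<close>, itineraries tell
  separated points apart. This serves to count separated sets and to read off the entropy of weights
  on them.\<close>

lemma separated_word_inj_on:
  assumes E: "separated T n e E" "0 < n" and c: "\<And>x y. c x = c y \<Longrightarrow> dist x y \<le> e"
  shows "inj_on (word T c n) E"
proof (rule inj_onI, rule ccontr)
  fix x y assume xy: "x \<in> E" "y \<in> E" "word T c n x = word T c n y" "x \<noteq> y"
  have "dist ((T ^^ k) x) ((T ^^ k) y) \<le> e" if "k < n" for k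
    using arg_cong[OF xy(3), of "\<lambda>w. w ! k"] that by (intro c) simp
  then have "bowen_dist T n x y \<le> e" using E(2) by (simp add: bowen_dist_le_iff)
  moreover have "e < bowen_dist T n x y" using E(1) xy by (simp add: separated_def)
  ultimately show False by simp
qed

lemma birkhoff_sum_abs_le:
  assumes "\<And>x. \<bar>f x\<bar> \<le> B"
  shows "\<bar>birkhoff_sum T f n x\<bar> \<le> n * B"
proof -
  have "\<bar>birkhoff_sum T f n x\<bar> \<le> (\<Sum>k<n. \<bar>f ((T ^^ k) x)\<bar>)"
    unfolding birkhoff_sum_def by (rule sum_abs)
  also have "\<dots> \<le> (\<Sum>k<n. B)" by (intro sum_mono assms)
  finally show ?thesis by simp
qed

lemma compact_finite_subcover:
  assumes "compact K" "\<And>i. open (U i)" "K \<subseteq> (\<Union>i. U i)"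
  shows "\<exists>I. finite I \<and> K \<subseteq> (\<Union>i\<in>I. U i)"
proof (rule compactE_image[OF assms(1), of UNIV U])
  fix C assume "finite C" "K \<subseteq> (\<Union>i\<in>C. U i)"
  then show "\<exists>I. finite I \<and> K \<subseteq> (\<Union>i\<in>I. U i)" by (intro exI conjI)
qed (use assms(2,3) in simp_all)

definition weight_sum :: "('a \<Rightarrow> 'a) \<Rightarrow> ('a \<Rightarrow> real) \<Rightarrow> nat \<Rightarrow> 'a set \<Rightarrow> real" where
  "weight_sum T f n E = (\<Sum>x\<in>E. exp (birkhoff_sum T f n x))"

locale compact_system =
  fixes T :: "'a::metric_space \<Rightarrow> 'a"
  assumes compact_UNIV: "compact (UNIV :: 'a set)"
    and continuous_T: "continuous_on UNIV T"
begin

section \<open>Cardinality and weights of separated sets\<close>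

lemma finite_net:
  assumes "0 < e"
  obtains F and g :: "'a \<Rightarrow> 'a" where "finite F" "range g \<subseteq> F" "\<And>x. dist x (g x) < e"
proof -
  have "x \<in> ball x e" for x using assms by simp
  then have cov: "(UNIV :: 'a set) \<subseteq> (\<Union>x. ball x e)" by blast
  have "\<exists>F. finite F \<and> (UNIV :: 'a set) \<subseteq> (\<Union>x\<in>F. ball x e)"
    by (rule compact_finite_subcover[where U = "\<lambda>x. ball x e", OF compact_UNIV open_ball cov])
  then obtain F where "finite F \<and> (UNIV :: 'a set) \<subseteq> (\<Union>x\<in>F. ball x e)" ..
  note F = conjunct1[OF this] conjunct2[OF this]
  have "\<exists>y. y \<in> F \<and> dist x y < e" for x
  proof -
    have "x \<in> (\<Union>y\<in>F. ball y e)" using F(2) by blast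
    then show ?thesis by (auto simp: dist_commute)
  qed
  then obtain g where "\<And>x. g x \<in> F \<and> dist x (g x) < e" by metis
  then show ?thesis using that F(1) by blast
qed

lemma continuous_iterate_on: "continuous_on S (T ^^ i)"
  by (rule continuous_on_funpow[OF continuous_T])

text \<open>Labelling each point by a nearby point of a finite e/2-net makes itineraries injective
  on separated sets, and there are at most \<open>card F ^ n\<close> itineraries.\<close>

lemma card_separated_le:
  assumes "0 < e"
  obtains N where "0 < N" "\<And>n E. separated T n e E \<Longrightarrow> 0 < n \<Longrightarrow> finite E \<and> card E \<le> N ^ n"
proof -
  obtain F g where F: "finite F" "range g \<subseteq> F" "\<And>x. dist x (g x :: 'a) < e / 2"
    using finite_net[of "e / 2"] assms by auto
  have "finite E \<and> card E \<le> card F ^ n" if "separated T n e E" "0 < n" for n E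
  proof -
    have inj: "inj_on (word T g n) E"
    proof (rule separated_word_inj_on[OF that])
      fix x y assume "g x = g y"
      then show "dist x y \<le> e"
        using dist_triangle2[of x y "g x"] F(3)[of x] F(3)[of y] by simp
    qed
    have "g x \<in> F" for x using F(2) by blast
    then have sub: "word T g n ` E \<subseteq> {w. set w \<subseteq> F \<and> length w = n}"
      unfolding word_def by auto
    then have "finite (word T g n ` E)" using finite_lists_length_eq[OF F(1)] finite_subset by blast
    moreover have "card (word T g n ` E) \<le> card F ^ n"
      using card_mono[OF finite_lists_length_eq[OF F(1)] sub] by (simp add: card_lists_length_eq[OF F(1)])
    ultimately show ?thesis using inj by (auto simp: card_image finite_image_iff)
  qed
  moreover have "0 < card F" using F by (auto simp: card_gt_0_iff)
  ultimately show ?thesis using that by blast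
qed

text \<open>Cardinalities are bounded, so a separated set of maximal cardinality exists; a point far
  from all its members could still be added.\<close>

lemma separated_maximal:
  assumes "0 < e" "0 < n"
  obtains E where "separated T n e E" "\<And>x. \<exists>y\<in>E. bowen_dist T n x y \<le> e"
proof -
  obtain N where N: "\<And>E. separated T n e E \<Longrightarrow> finite E \<and> card E \<le> N ^ n"
    using card_separated_le[OF assms(1)] assms(2) by metis
  let ?C = "card ` {E. separated T n e E}"
  have "finite ?C" using N by (auto intro: finite_subset[of _ "{..N ^ n}"])
  moreover have "?C \<noteq> {}" by (auto simp: separated_def intro!: exI[of _ "{}"])
  ultimately obtain E where E: "separated T n e E" "card E = Max ?C"
  proof -
    have "Max ?C \<in> ?C" by (rule Max_in) fact+
    then show ?thesis using that by (auto simp: image_iff)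
  qed
  have "\<exists>y\<in>E. bowen_dist T n x y \<le> e" for x
  proof (rule ccontr)
    assume far: "\<not> (\<exists>y\<in>E. bowen_dist T n x y \<le> e)"
    have sym: "bowen_dist T n y x = bowen_dist T n x y" for y by (simp add: bowen_dist_def dist_commute)
    have self: "bowen_dist T n x x \<le> e" using assms by (simp add: bowen_dist_le_iff)
    have sep: "separated T n e (insert x E)"
      unfolding separated_def
    proof (intro ballI impI)
      fix u v assume uv: "u \<in> insert x E" "v \<in> insert x E" "u \<noteq> v"
      have far': "e < bowen_dist T n x y" if "y \<in> E" for y using far that by (simp add: not_le)
      consider "u = x" "v \<in> E" | "v = x" "u \<in> E" | "u \<in> E" "v \<in> E" using uv by blast
      then show "e < bowen_dist T n u v"
      proof cases
        case 1 then show ?thesis using far' by simp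
      next
        case 2 then show ?thesis using far'[of u] sym[of u] by simp
      next
        case 3 then show ?thesis using E(1) uv(3) by (simp add: separated_def)
      qed
    qed
    have "x \<notin> E" using far self by blast
    then have "card (insert x E) = Suc (card E)"
      using N[OF E(1)] by simp
    then have "Suc (card E) \<in> ?C" using sep by (metis imageI mem_Collect_eq)
    then have "Suc (card E) \<le> Max ?C" using \<open>finite ?C\<close> by (intro Max_ge)
    then show False using E(2) by simp
  qed
  then show ?thesis using that E(1) by blast
qed

lemma weight_sum_bound:
  assumes N: "finite E \<and> card E \<le> N ^ n" "0 < N" and B: "\<And>x. \<bar>f x\<bar> \<le> B"
  shows "weight_sum T f n E \<le> exp (n * (B + ln N))"
proof -
  have "weight_sum T f n E \<le> (\<Sum>x\<in>E. exp (n * B))"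
    unfolding weight_sum_def using birkhoff_sum_abs_le[of f B, OF B, of T n]
    by (intro sum_mono) (simp add: abs_le_iff)
  also have "\<dots> \<le> real (N ^ n) * exp (n * B)"
    using N by simp
  also have "\<dots> = exp (n * (B + ln N))"
    using N(2) by (simp add: algebra_simps exp_add exp_of_nat_mult)
  finally show ?thesis .
qed

lemma bdd_above_weight_sums:
  assumes "0 < e" "0 < n" and f: "f \<in> cont_space"
  shows "bdd_above (weight_sum T f n ` {E. separated T n e E})"
proof -
  obtain N where N: "0 < N" "\<And>n E. separated T n e E \<Longrightarrow> 0 < n \<Longrightarrow> finite E \<and> card E \<le> N ^ n"
    using card_separated_le[OF assms(1)] by metis
  obtain B where B: "\<And>x. \<bar>f x\<bar> \<le> B" using compact_bounded_continuous[OF compact_UNIV f] by metis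
  show ?thesis
    using weight_sum_bound[OF N(2) N(1) B] assms(2) by (intro bdd_aboveI2) auto
qed

lemma partition_sum_weight: "partition_sum T f n e = (SUP E\<in>{E. separated T n e E}. weight_sum T f n E)"
  by (simp add: partition_sum_def weight_sum_def)

lemma weight_sum_le_partition_sum:
  assumes "0 < e" "0 < n" "f \<in> cont_space" "separated T n e E"
  shows "weight_sum T f n E \<le> partition_sum T f n e"
  unfolding partition_sum_weight using assms by (intro cSUP_upper bdd_above_weight_sums) auto

lemma separated_singleton: "separated T n e {x}"
  by (simp add: separated_def)

lemma partition_sum_lower:
  assumes "0 < e" "0 < n" and f: "f \<in> cont_space" and B: "\<And>x. \<bar>f x\<bar> \<le> B"
  shows "exp (- (n * B)) \<le> partition_sum T f n e"
proof -
  fix x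
  have "exp (- (n * B)) \<le> weight_sum T f n {x}"
    using birkhoff_sum_abs_le[of f B, OF B, of T n x] by (simp add: weight_sum_def abs_le_iff)
  also have "\<dots> \<le> partition_sum T f n e"
    using assms separated_singleton by (intro weight_sum_le_partition_sum)
  finally show ?thesis .
qed

lemma partition_sum_pos:
  assumes "0 < e" "0 < n" and f: "f \<in> cont_space"
  shows "0 < partition_sum T f n e"
proof -
  obtain B where B: "\<And>x. \<bar>f x\<bar> \<le> B" using compact_bounded_continuous[OF compact_UNIV f] by metis
  show ?thesis using partition_sum_lower[OF assms B] less_le_trans[OF exp_gt_zero] by blast
qed

definition finite_pressure :: "('a \<Rightarrow> real) \<Rightarrow> nat \<Rightarrow> real \<Rightarrow> real" where
  "finite_pressure f n e = 1 / real n * ln (partition_sum T f n e)"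

lemma finite_pressure_bounded:
  assumes "0 < e" and f: "f \<in> cont_space"
  obtains D where "\<And>n. \<bar>finite_pressure f n e\<bar> \<le> D"
proof -
  obtain N where N: "0 < N" "\<And>n E. separated T n e E \<Longrightarrow> 0 < n \<Longrightarrow> finite E \<and> card E \<le> N ^ n"
    using card_separated_le[OF assms(1)] by metis
  obtain B where B: "0 < B" "\<And>x. \<bar>f x\<bar> \<le> B" using compact_bounded_continuous[OF compact_UNIV f] by metis
  have "\<bar>finite_pressure f n e\<bar> \<le> B + ln N" for n
  \<comment> \<open>At \<open>n = 0\<close> the factor \<open>1 / real n\<close> is 0, so the bound
    holds there too.\<close>
  proof (cases "n = 0")
    case True
    then show ?thesis using B(1) N(1) by (simp add: finite_pressure_def)
  next
    case False
    then have n: "0 < n" by simp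
    have "partition_sum T f n e \<le> exp (n * (B + ln N))"
      unfolding partition_sum_weight using separated_singleton weight_sum_bound[OF N(2) N(1) B(2)] n
      by (intro cSUP_least) auto
    then have "ln (partition_sum T f n e) \<le> n * (B + ln N)"
      using partition_sum_pos[OF assms(1) n f] by (subst ln_exp[symmetric], subst ln_le_cancel_iff) auto
    moreover have "- (n * B) \<le> ln (partition_sum T f n e)"
      using partition_sum_lower[OF assms(1) n f B(2)] partition_sum_pos[OF assms(1) n f]
      by (subst ln_exp[symmetric], subst ln_le_cancel_iff) auto
    moreover have "0 \<le> real n * ln N" using N(1) by simp
    ultimately have "\<bar>ln (partition_sum T f n e)\<bar> \<le> n * (B + ln N)"
      by (auto simp: abs_le_iff algebra_simps)
    then show ?thesis using n by (simp add: finite_pressure_def abs_mult field_simps)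
  qed
  then show ?thesis using that by blast
qed

definition scale_pressure :: "('a \<Rightarrow> real) \<Rightarrow> real \<Rightarrow> ereal" where
  "scale_pressure f e = limsup (\<lambda>n. ereal (finite_pressure f n e))"

lemma finite_pressure_antimono:
  assumes "0 < d" "d \<le> e" and f: "f \<in> cont_space"
  shows "finite_pressure f n e \<le> finite_pressure f n d"
proof (cases "n = 0")
  case False
  then have n: "0 < n" by simp
  have "partition_sum T f n e \<le> partition_sum T f n d"
    unfolding partition_sum_weight using assms n separated_singleton
    by (intro cSUP_subset_mono bdd_above_weight_sums) (force simp: separated_def)+
  then show ?thesis
    using partition_sum_pos[OF _ n f, of e] partition_sum_pos[OF _ n f, of d] assms
    by (simp add: finite_pressure_def divide_right_mono)
qed (simp add: finite_pressure_def)

lemma scale_pressure_antimono: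
  assumes "0 < d" "d \<le> e" "f \<in> cont_space"
  shows "scale_pressure f e \<le> scale_pressure f d"
  unfolding scale_pressure_def using finite_pressure_antimono[OF assms]
  by (intro Limsup_mono) auto

text \<open>
  One- and two-sided expansiveness are treated alike through a section \<open>R\<close> of \<open>T\<^sup>b\<close> commuting
  with \<open>T\<close>: the identity in the one-sided case, an iterate of \<open>T\<^sup>-\<^sup>1\<close> in the two-sided case.
\<close>

lemma expansive_window:
  assumes "expansive T"
  obtains c where "0 < c" "\<And>d. 0 < d \<Longrightarrow> \<exists>b N R. b \<le> N \<and> (\<forall>x. (T ^^ b) (R x) = x) \<and>
    (\<forall>k x. R ((T ^^ k) x) = (T ^^ k) (R x)) \<and>
    (\<forall>x y. d < dist x y \<longrightarrow> (\<exists>i\<le>N. c < dist ((T ^^ i) (R x)) ((T ^^ i) (R y))))"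
proof -
  \<comment> \<open>Compactness: pairs at distance at least \<open>d\<close> form a compact set off
    the diagonal, so finitely many of the open sets \<open>U i\<close> cover it, and one time bound
    \<open>N\<close> serves all pairs.\<close>
  have cov: "\<exists>N. \<forall>x y. d < dist x y \<longrightarrow> (\<exists>i\<le>N. (x, y) \<in> U i)"
    if "\<And>i :: nat. open (U i)" "\<And>x y. x \<noteq> y \<Longrightarrow> \<exists>i. (x, y) \<in> U i" "0 < d" for U :: "nat \<Rightarrow> ('a \<times> 'a) set" and d :: real
  proof -
    let ?K = "{p :: 'a \<times> 'a. d \<le> dist (fst p) (snd p)}"
    have "compact (UNIV :: ('a \<times> 'a) set)" using compact_Times[OF compact_UNIV compact_UNIV] by simp
    moreover have "closed ?K" by (intro closed_Collect_le continuous_intros)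
    ultimately have "compact ?K" using compact_Int_closed[of UNIV ?K] by simp
    moreover have "?K \<subseteq> (\<Union>i\<in>UNIV. U i)"
    proof
      fix p assume "p \<in> ?K"
      then have "fst p \<noteq> snd p" using that(3) by auto
      then have "\<exists>i. p \<in> U i" using that(2)[of "fst p" "snd p"] by simp
      then show "p \<in> (\<Union>i\<in>UNIV. U i)" by blast
    qed
    ultimately have "\<exists>I. finite I \<and> ?K \<subseteq> (\<Union>i\<in>I. U i)"
      by (intro compact_finite_subcover that(1))
    then obtain I where "finite I \<and> ?K \<subseteq> (\<Union>i\<in>I. U i)" ..
    note I = conjunct1[OF this] conjunct2[OF this]
    then obtain N where N: "I \<subseteq> {..N}" using finite_nat_iff_bounded_le by auto
    have "\<exists>i\<le>N. (x, y) \<in> U i" if "d < dist x y" for x y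
    proof -
      have "(x, y) \<in> ?K" using that by simp
      then show ?thesis using I N by blast
    qed
    then show ?thesis by blast
  qed
  have open_far: "open {p. c < dist (f (fst p)) (f (snd p))}" if "continuous_on UNIV f" for c and f :: "'a \<Rightarrow> 'a"
    by (intro open_Collect_less continuous_intros continuous_on_compose2[OF that]) auto
  obtain c where "c > 0 \<and> ((\<forall>x y. (\<forall>n. dist ((T ^^ n) x) ((T ^^ n) y) \<le> c) \<longrightarrow> x = y) \<or>
     (bij T \<and> (\<forall>x y. (\<forall>n. dist ((T ^^ n) x) ((T ^^ n) y) \<le> c \<and>
                  dist ((inv T ^^ n) x) ((inv T ^^ n) y) \<le> c) \<longrightarrow> x = y)))"
    using assms unfolding expansive_def ..
  note c = conjunct1[OF this] conjunct2[OF this]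
  from c(2) show ?thesis
  proof
    assume one: "\<forall>x y. (\<forall>n. dist ((T ^^ n) x) ((T ^^ n) y) \<le> c) \<longrightarrow> x = y"
    show ?thesis
    proof (rule that[OF c(1)])
      fix d :: real assume d: "0 < d"
      let ?U = "\<lambda>i. {p. c < dist ((T ^^ i) (fst p)) ((T ^^ i) (snd p))}"
      have ex: "\<exists>i. (x, y) \<in> ?U i" if "x \<noteq> y" for x y
      proof (rule ccontr)
        assume "\<nexists>i. (x, y) \<in> ?U i"
        then have "\<forall>n. dist ((T ^^ n) x) ((T ^^ n) y) \<le> c" by (simp add: not_less)
        then show False using one that by simp
      qed
      have "\<exists>N. \<forall>x y. d < dist x y \<longrightarrow> (\<exists>i\<le>N. (x, y) \<in> ?U i)"
        by (rule cov[OF _ ex d]) (intro open_far continuous_iterate_on)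
      then obtain N where "\<And>x y. d < dist x y \<Longrightarrow> \<exists>i\<le>N. (x, y) \<in> ?U i" by blast
      then show "\<exists>b N R. b \<le> N \<and> (\<forall>x. (T ^^ b) (R x) = x) \<and>
        (\<forall>k x. R ((T ^^ k) x) = (T ^^ k) (R x)) \<and>
        (\<forall>x y. d < dist x y \<longrightarrow> (\<exists>i\<le>N. c < dist ((T ^^ i) (R x)) ((T ^^ i) (R y))))"
        by (intro exI[of _ 0] exI[of _ N] exI[of _ "\<lambda>x. x"]) auto
    qed
  next
    assume two: "bij T \<and> (\<forall>x y. (\<forall>n. dist ((T ^^ n) x) ((T ^^ n) y) \<le> c \<and>
                  dist ((inv T ^^ n) x) ((inv T ^^ n) y) \<le> c) \<longrightarrow> x = y)"
    then have bij: "bij T" by blast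
    have inv1: "T (inv T x) = x" "inv T (T x) = x" for x
      using bij by (auto simp: bij_def surj_f_inv_f)
    have "continuous_on (T ` UNIV) (inv T)"
      using inv1 by (intro continuous_on_inv[OF continuous_T compact_UNIV]) auto
    then have cont_inv: "continuous_on UNIV (inv T)" using bij by (simp add: bij_def)
    have cont_inv_it: "continuous_on UNIV (inv T ^^ i)" for i
      by (rule continuous_on_funpow[OF cont_inv])
    have it: "(T ^^ n) ((inv T ^^ n) x) = x" for n x
      by (induction n arbitrary: x) (auto simp: funpow_swap1 inv1)
    have comm: "(inv T ^^ n) ((T ^^ k) x) = (T ^^ k) ((inv T ^^ n) x)" for n k x
    proof (induction n)
      case (Suc n)
      have "inv T ((T ^^ k) y) = (T ^^ k) (inv T y)" for y
        by (metis funpow_swap1 inv1)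
      then show ?case using Suc by simp
    qed simp
    show ?thesis
    proof (rule that[OF c(1)])
      fix d :: real assume d: "0 < d"
      let ?U = "\<lambda>i. {p. c < dist ((T ^^ i) (fst p)) ((T ^^ i) (snd p))} \<union>
        {p. c < dist ((inv T ^^ i) (fst p)) ((inv T ^^ i) (snd p))}"
      have ex: "\<exists>i. (x, y) \<in> ?U i" if "x \<noteq> y" for x y
      proof (rule ccontr)
        assume "\<nexists>i. (x, y) \<in> ?U i"
        then have "\<forall>n. dist ((T ^^ n) x) ((T ^^ n) y) \<le> c \<and> dist ((inv T ^^ n) x) ((inv T ^^ n) y) \<le> c"
          by (simp add: not_less)
        then show False using two that by simp
      qed
      have "\<exists>N. \<forall>x y. d < dist x y \<longrightarrow> (\<exists>i\<le>N. (x, y) \<in> ?U i)"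
        by (rule cov[OF _ ex d]) (intro open_Un open_far continuous_iterate_on cont_inv_it)
      then obtain N where N: "\<And>x y. d < dist x y \<Longrightarrow> \<exists>i\<le>N. (x, y) \<in> ?U i" by blast
      \<comment> \<open>Moving both points back by \<open>N\<close> steps turns the two-sided window
        from -N to N into the forward window from 0 to 2N.\<close>
      have "\<exists>i\<le>2 * N. c < dist ((T ^^ i) ((inv T ^^ N) x)) ((T ^^ i) ((inv T ^^ N) y))"
        if xy: "d < dist x y" for x y
      proof -
        obtain i where "i \<le> N \<and> (x, y) \<in> ?U i" using N[OF xy] ..
        note i = conjunct1[OF this] conjunct2[OF this]
        have fwd: "(T ^^ (N + i)) ((inv T ^^ N) z) = (T ^^ i) z" for z
          by (simp add: funpow_add add.commute[of N] it)
        have bwd: "(T ^^ (N - i)) ((inv T ^^ N) z) = (inv T ^^ i) z" for z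
        proof -
          have "(inv T ^^ N) z = (inv T ^^ (N - i)) ((inv T ^^ i) z)"
            using i(1) funpow_add[of "N - i" i "inv T"] by simp
          then show ?thesis by (simp add: it)
        qed
        from i(2) show ?thesis
        proof
          assume "(x, y) \<in> {p. c < dist ((T ^^ i) (fst p)) ((T ^^ i) (snd p))}"
          then show ?thesis using i(1) fwd by (intro exI[of _ "N + i"]) auto
        next
          assume "(x, y) \<in> {p. c < dist ((inv T ^^ i) (fst p)) ((inv T ^^ i) (snd p))}"
          then show ?thesis using i(1) bwd by (intro exI[of _ "N - i"]) auto
        qed
      qed
      then show "\<exists>b N R. b \<le> N \<and> (\<forall>x. (T ^^ b) (R x) = x) \<and>
        (\<forall>k x. R ((T ^^ k) x) = (T ^^ k) (R x)) \<and>
        (\<forall>x y. d < dist x y \<longrightarrow> (\<exists>i\<le>N. c < dist ((T ^^ i) (R x)) ((T ^^ i) (R y))))"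
        using it comm by (intro exI[of _ N] exI[of _ "2 * N"] exI[of _ "inv T ^^ N"]) auto
    qed
  qed
qed

text \<open>The section \<open>R\<close> turns d-separation during \<open>n\<close> steps into
  c-separation during \<open>n + N\<close> steps. The orbit of \<open>x\<close> is a stretch of that
  of \<open>R x\<close>, starting at time \<open>b\<close>, and the \<open>N\<close> extra terms of
  the Birkhoff sum are each at least \<open>- B\<close>.\<close>

lemma partition_sum_window:
  assumes d: "0 < d" and c: "0 < c" and n: "0 < n" and f: "f \<in> cont_space" and B: "\<And>x. \<bar>f x\<bar> \<le> B"
    and b: "b \<le> N" and R: "\<And>x. (T ^^ b) (R x) = x" "\<And>k x. R ((T ^^ k) x) = (T ^^ k) (R x)"
    and far: "\<And>x y. d < dist x y \<Longrightarrow> \<exists>i\<le>N. c < dist ((T ^^ i) (R x)) ((T ^^ i) (R y))"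
  shows "partition_sum T f n d \<le> exp (N * B) * partition_sum T f (n + N) c"
  unfolding partition_sum_weight[of f n d]
proof (rule cSUP_least)
  show "{E. separated T n d E} \<noteq> {}" using separated_singleton by blast
  fix E assume "E \<in> {E. separated T n d E}"
  then have E: "separated T n d E" by simp
  have inj: "inj_on R S" for S by (metis inj_onI R(1))
  have sep: "separated T (n + N) c (R ` E)"
    unfolding separated_def
  proof (intro ballI impI)
    fix x' y' assume "x' \<in> R ` E" "y' \<in> R ` E" "x' \<noteq> y'"
    then obtain x y where xy: "x \<in> E" "y \<in> E" "x' = R x" "y' = R y" "x \<noteq> y" by auto
    then obtain k where k: "k < n" "d < dist ((T ^^ k) x) ((T ^^ k) y)"
      using E n by (auto simp: separated_def bowen_dist_gt_iff)
    from far[OF k(2)] obtain i where i: "i \<le> N" "c < dist ((T ^^ i) (R ((T ^^ k) x))) ((T ^^ i) (R ((T ^^ k) y)))"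
      by blast
    then have "c < dist ((T ^^ (i + k)) x') ((T ^^ (i + k)) y')"
      by (simp add: R(2) xy funpow_add)
    then show "c < bowen_dist T (n + N) x' y'"
      using n k(1) i(1) by (subst bowen_dist_gt_iff) (auto intro!: exI[of _ "i + k"])
  qed
  have le: "birkhoff_sum T f n x \<le> N * B + birkhoff_sum T f (n + N) (R x)" for x
  proof -
    have "birkhoff_sum T f n x = (\<Sum>k<n. f ((T ^^ (k + b)) (R x)))"
      unfolding birkhoff_sum_def by (simp add: funpow_add R(1))
    also have "\<dots> = (\<Sum>k\<in>{b..<b+n}. f ((T ^^ k) (R x)))"
      using sum.shift_bounds_nat_ivl[of "\<lambda>k. f ((T ^^ k) (R x))" 0 b n]
      by (simp add: atLeast0LessThan add.commute)
    finally have 1: "birkhoff_sum T f n x = (\<Sum>k\<in>{b..<b+n}. f ((T ^^ k) (R x)))" .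
    have "{b..<b+n} \<subseteq> {..<n + N}" using b by auto
    then have "birkhoff_sum T f (n + N) (R x)
        = (\<Sum>k\<in>{..<n + N} - {b..<b+n}. f ((T ^^ k) (R x))) + birkhoff_sum T f n x"
      unfolding 1 birkhoff_sum_def[of T f "n + N"] by (intro sum.subset_diff) auto
    moreover have "(\<Sum>k\<in>{..<n + N} - {b..<b+n}. f ((T ^^ k) (R x))) \<ge> (\<Sum>k\<in>{..<n + N} - {b..<b+n}. - B)"
      using B by (intro sum_mono) (simp add: abs_le_iff minus_le_iff)
    moreover have "card ({..<n + N} - {b..<b+n}) = N"
      using \<open>{b..<b+n} \<subseteq> {..<n + N}\<close> by (subst card_Diff_subset) auto
    ultimately show ?thesis by simp
  qed
  have "weight_sum T f n E \<le> (\<Sum>x\<in>E. exp (N * B) * exp (birkhoff_sum T f (n + N) (R x)))"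
    unfolding weight_sum_def exp_add[symmetric] using le by (intro sum_mono) simp
  also have "\<dots> = exp (N * B) * weight_sum T f (n + N) (R ` E)"
    unfolding weight_sum_def by (simp add: sum.reindex[OF inj] sum_distrib_left)
  also have "\<dots> \<le> exp (N * B) * partition_sum T f (n + N) c"
    using n c f sep by (intro mult_left_mono weight_sum_le_partition_sum) auto
  finally show "weight_sum T f n E \<le> exp (N * B) * partition_sum T f (n + N) c" .
qed

text \<open>Passing from scale \<open>d\<close> to scale \<open>c\<close> lengthens the time by a
  constant and costs a constant factor, both lost on division by \<open>n\<close>. So the pressure
  at scale \<open>d\<close> is the same for all \<open>d \<le> c\<close>, and the limit over scales
  is already attained at \<open>c\<close>, which does not depend on the potential.\<close>

lemma expansive_pressure:
  assumes "expansive T"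
  obtains c where "0 < c" "\<And>f. f \<in> cont_space \<Longrightarrow> \<exists>P. pressure T f = ereal P \<and>
    (\<forall>e>0. \<forall>d>0. eventually (\<lambda>n. finite_pressure f n d < P + e) sequentially) \<and>
    (\<forall>e>0. \<exists>\<^sub>F n in sequentially. P - e < finite_pressure f n c)"
proof -
  obtain c where c: "0 < c" "\<And>d. 0 < d \<Longrightarrow> \<exists>b N R. b \<le> N \<and> (\<forall>x. (T ^^ b) (R x) = x) \<and>
    (\<forall>k x. R ((T ^^ k) x) = (T ^^ k) (R x)) \<and>
    (\<forall>x y. d < dist x y \<longrightarrow> (\<exists>i\<le>N. c < dist ((T ^^ i) (R x)) ((T ^^ i) (R y))))"
    using expansive_window[OF assms] by blast
  show ?thesis
  proof (rule that[OF c(1)])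
    fix f :: "'a \<Rightarrow> real" assume f: "f \<in> cont_space"
    obtain D where D: "\<And>n. \<bar>finite_pressure f n c\<bar> \<le> D"
      using finite_pressure_bounded[OF c(1) f] by metis
    obtain B where B: "0 < B" "\<And>x. \<bar>f x\<bar> \<le> B" using compact_bounded_continuous[OF compact_UNIV f] by metis
    obtain P where P: "scale_pressure f c = ereal P"
      "\<And>e. 0 < e \<Longrightarrow> eventually (\<lambda>n. finite_pressure f n c < P + e) sequentially"
      "\<And>e. 0 < e \<Longrightarrow> \<exists>\<^sub>F n in sequentially. P - e < finite_pressure f n c"
      unfolding scale_pressure_def using bounded_limsup_real[of "\<lambda>n. finite_pressure f n c", OF D] by metis
    have small: "eventually (\<lambda>n. finite_pressure f n d < P + e) sequentially" if d: "0 < d" and e: "0 < e" for d e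
    proof -
      obtain b N R where R: "b \<le> N" "\<And>x. (T ^^ b) (R x) = x" "\<And>k x. R ((T ^^ k) x) = (T ^^ k) (R x)"
        "\<And>x y. d < dist x y \<Longrightarrow> \<exists>i\<le>N. c < dist ((T ^^ i) (R x)) ((T ^^ i) (R y))"
        using c(2)[OF d] by metis
      \<comment> \<open>The two error terms are \<open>N * B\<close> from the change of scale and
        \<open>N * D\<close> from normalising by \<open>n\<close> in place of
        \<open>n + N\<close>.\<close>
      have le: "finite_pressure f n d \<le> finite_pressure f (n + N) c + (real N * (B + D)) / real n" if n: "0 < n" for n
      proof -
        note pos = partition_sum_pos[OF c(1) _ f, of "n + N"]
        have "ln (partition_sum T f n d) \<le> ln (exp (N * B) * partition_sum T f (n + N) c)"
          using partition_sum_window[OF d c(1) n f B(2) R] partition_sum_pos[OF d n f]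
          by (intro ln_mono) auto
        also have "\<dots> = N * B + ln (partition_sum T f (n + N) c)"
          using pos n by (subst ln_mult) auto
        also have "ln (partition_sum T f (n + N) c) = (real n + real N) * finite_pressure f (n + N) c"
          using n by (simp add: finite_pressure_def)
        also have "\<dots> \<le> n * finite_pressure f (n + N) c + N * D"
          using D[of "n + N"] by (simp add: distrib_right abs_le_iff mult_left_mono)
        finally have "ln (partition_sum T f n d) \<le> n * finite_pressure f (n + N) c + N * (B + D)"
          by (simp add: algebra_simps)
        then have "1 / real n * ln (partition_sum T f n d)
            \<le> 1 / real n * (n * finite_pressure f (n + N) c + N * (B + D))"
          by (intro mult_left_mono) auto
        also have "\<dots> = finite_pressure f (n + N) c + (real N * (B + D)) / real n"
          using n by (simp add: add_divide_distrib)
        finally show ?thesis unfolding finite_pressure_def[of f n d] .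
      qed
      have "eventually (\<lambda>n. finite_pressure f (n + N) c < P + e / 2) sequentially"
        using P(2)[of "e / 2"] e by (subst eventually_sequentially_seg) auto
      moreover have "eventually (\<lambda>n. (real N * (B + D)) / real n < e / 2) sequentially"
        using e by (intro order_tendstoD[OF lim_const_over_n]) auto
      ultimately show ?thesis
        using eventually_gt_at_top[of 0]
      proof eventually_elim
        case (elim n)
        then show ?case using le[of n] by linarith
      qed
    qed
    have "scale_pressure f d = ereal P" if "0 < d" "d \<le> c" for d
    proof (rule antisym)
      show "scale_pressure f d \<le> ereal P"
        unfolding scale_pressure_def by (intro limsup_le_real small that)
      show "ereal P \<le> scale_pressure f d" using scale_pressure_antimono[OF that f] P(1) by simp
    qed
    then have "eventually (\<lambda>d. scale_pressure f d = ereal P) (at_right 0)"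
      using c(1) by (intro eventually_at_rightI[of 0 c]) auto
    then have "(scale_pressure f \<longlongrightarrow> ereal P) (at_right 0)" by (rule tendsto_eventually)
    then have "pressure T f = ereal P"
      unfolding pressure_def scale_pressure_def finite_pressure_def by (intro tendsto_Lim) auto
    then show "\<exists>P. pressure T f = ereal P \<and>
      (\<forall>e>0. \<forall>d>0. eventually (\<lambda>n. finite_pressure f n d < P + e) sequentially) \<and>
      (\<forall>e>0. \<exists>\<^sub>F n in sequentially. P - e < finite_pressure f n c)"
      using small P(3) by blast
  qed
qed

end

section \<open>The upper half of the variational principle\<close>

text \<open>This is \<open>ln y \<le> y - 1\<close> at \<open>y = 1 / sqrt x\<close>. It makes the
  entropy of a small atom small with an explicit rate.\<close>

lemma neg_xlnx_le:
  fixes x :: real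
  assumes "0 \<le> x"
  shows "- x * ln x \<le> 2 * sqrt x"
proof (cases "x = 0")
  case False
  then have x: "0 < x" using assms by simp
  have "ln (1 / sqrt x) \<le> 1 / sqrt x - 1" using x by (intro ln_le_minus_one) simp
  then have "- ln x \<le> 2 * (1 / sqrt x)" using x by (simp add: ln_div ln_sqrt)
  then have "x * (- ln x) \<le> x * (2 * (1 / sqrt x))" using x by (intro mult_left_mono) auto
  also have "\<dots> = 2 * sqrt x" using x by (simp add: field_simps)
  finally show ?thesis by simp
qed simp

text \<open>Counts words in which every position is either undecided or forced; this is the source
  of the factor \<open>2 ^ n\<close> in \<open>word_weight_le\<close>.\<close>

lemma card_two_choices:
  assumes "\<And>v. v \<in> V \<Longrightarrow> length v = n" "\<And>v j. v \<in> V \<Longrightarrow> j < n \<Longrightarrow> v ! j = None \<or> v ! j = Some (k j)"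
  shows "card V \<le> 2 ^ n"
proof -
  let ?B = "{bs :: bool list. set bs \<subseteq> UNIV \<and> length bs = n}"
  let ?h = "\<lambda>bs. map (\<lambda>j. if bs ! j then Some (k j) else None) [0..<n]"
  have fin: "finite ?B" by (rule finite_lists_length_eq) simp
  have "V \<subseteq> ?h ` ?B"
  proof
    fix v assume v: "v \<in> V"
    define bs where "bs = map (\<lambda>j. v ! j \<noteq> None) [0..<n]"
    have "v = ?h bs"
    proof (rule nth_equalityI)
      fix j assume "j < length v"
      then have "j < n" using assms(1)[OF v] by simp
      then show "v ! j = ?h bs ! j" using assms(2)[OF v, of j] by (auto simp: bs_def)
    qed (simp add: assms(1)[OF v])
    moreover have "bs \<in> ?B" by (simp add: bs_def)
    ultimately show "v \<in> ?h ` ?B" by (rule image_eqI)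
  qed
  then have "card V \<le> card ?B" using fin by (rule surj_card_le[rotated])
  also have "\<dots> = 2 ^ n" by (subst card_lists_length_eq) auto
  finally show ?thesis .
qed

context invariant_system
begin

text \<open>
  In terms of conditional entropies, the claim is \<open>H(d\<^sub>0, \<dots>, d\<^sub>n | g d\<^sub>0, \<dots>, g d\<^sub>n) \<le> n H(d | g d)\<close>.
\<close>

lemma label_entropy_word_refine:
  assumes d: "simple_function M d"
  shows "label_entropy M (word T d n)
    \<le> label_entropy M (word T (g \<circ> d) n) + n * (label_entropy M d - label_entropy M (g \<circ> d))"
proof (induction n)
  case 0
  have 0: "word T d 0 = (\<lambda>_. [])" by (auto simp: word_def)
  have "label_entropy M (word T d 0) \<le> ln (card (range (word T d 0)))"
    by (rule label_entropy_le_ln_card) (simp add: 0)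
  moreover have "card (range (word T d 0)) = 1" by (simp add: 0)
  ultimately have "label_entropy M (word T d 0) \<le> 0" by simp
  also have "0 \<le> label_entropy M (word T (g \<circ> d) 0)" by (rule label_entropy_nonneg)
  finally show ?case unfolding of_nat_0 mult_zero_left add_0_right .
next
  case (Suc n)
  define E where "E = word T d n"
  define F where "F = word T (g \<circ> d) n"
  define dn where "dn = (\<lambda>x. d ((T ^^ n) x))"
  define fn where "fn = (\<lambda>x. g (d ((T ^^ n) x)))"
  have gd: "simple_function M (g \<circ> d)" using d by (rule simple_function_compose)
  have sE: "simple_function M E" unfolding E_def by (rule simple_function_word) (rule simple_function_iterate[OF d])
  have sF: "simple_function M F" unfolding F_def by (rule simple_function_word) (rule simple_function_iterate[OF gd])
  have sF1: "simple_function M (word T (g \<circ> d) (Suc n))" by (rule simple_function_word) (rule simple_function_iterate[OF gd])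
  have sd: "simple_function M dn" unfolding dn_def by (rule simple_function_iterate[OF d])
  have sf: "simple_function M fn" unfolding fn_def using simple_function_iterate[OF gd, of n] by (simp add: comp_def)
  have F_eq: "F = map g \<circ> E" by (auto simp: E_def F_def word_def)
  have fn_eq: "fn = g \<circ> dn" by (auto simp: fn_def dn_def)
  have Hd: "label_entropy M dn = label_entropy M d" unfolding dn_def by (rule label_entropy_iterate[OF d])
  have Hf: "label_entropy M fn = label_entropy M (g \<circ> d)"
    using label_entropy_iterate[OF gd, of n] by (simp add: fn_def comp_def)
  \<comment> \<open>In conditional form this is H(fn | E, F) \<le> H(fn | F), and \<open>b\<close>
    is H(dn | E, fn) \<le> H(dn | fn). As \<open>F\<close> is determined by \<open>E\<close> and
    \<open>fn\<close> by \<open>dn\<close>, a pair of such labels has at most the entropy of its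
    finer component.\<close>
  have a: "label_entropy M (\<lambda>u. (E u, fn u, F u)) + label_entropy M F
      \<le> label_entropy M (\<lambda>u. (E u, F u)) + label_entropy M (\<lambda>u. (fn u, F u))"
    by (rule label_entropy_submodular[OF sE sf sF])
  have b: "label_entropy M (\<lambda>u. (E u, dn u, fn u)) + label_entropy M fn
      \<le> label_entropy M (\<lambda>u. (E u, fn u)) + label_entropy M (\<lambda>u. (dn u, fn u))"
    by (rule label_entropy_submodular[OF sE sd sf])
  have "label_entropy M (\<lambda>u. (E u, F u)) \<le> label_entropy M E"
    using label_entropy_comp_le[OF sE, of "\<lambda>w. (w, map g w)"] by (simp add: comp_def F_eq)
  moreover have "label_entropy M (\<lambda>u. (dn u, fn u)) \<le> label_entropy M dn"
    using label_entropy_comp_le[OF sd, of "\<lambda>w. (w, g w)"] by (simp add: comp_def fn_eq)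
  moreover have "label_entropy M (\<lambda>u. (fn u, F u)) \<le> label_entropy M (word T (g \<circ> d) (Suc n))"
    using label_entropy_comp_le[OF sF1, of "\<lambda>w. (last w, butlast w)"]
    by (simp add: comp_def word_Suc F_def fn_def)
  moreover have "label_entropy M (word T d (Suc n)) \<le> label_entropy M (\<lambda>u. (E u, dn u, fn u))"
    using label_entropy_comp_le[OF simple_function_Pair[OF sE simple_function_Pair[OF sd sf]],
      of "\<lambda>(w, l, _). w @ [l]"]
    by (simp add: comp_def word_Suc[abs_def] E_def dn_def)
  moreover have "label_entropy M (\<lambda>u. (E u, fn u)) \<le> label_entropy M (\<lambda>u. (E u, fn u, F u))"
    using label_entropy_comp_le[OF simple_function_Pair[OF sE simple_function_Pair[OF sf sF]],
      of "\<lambda>(w, l, _). (w, l)"]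
    by (simp add: comp_def)
  ultimately have "label_entropy M (word T d (Suc n)) \<le> label_entropy M E - label_entropy M F
     + label_entropy M (word T (g \<circ> d) (Suc n)) + (label_entropy M d - label_entropy M (g \<circ> d))"
    using a b Hd Hf by linarith
  moreover have "label_entropy M E - label_entropy M F \<le> n * (label_entropy M d - label_entropy M (g \<circ> d))"
    using Suc unfolding E_def F_def by linarith
  ultimately have "label_entropy M (word T d (Suc n)) \<le> label_entropy M (word T (g \<circ> d) (Suc n))
      + (n * (label_entropy M d - label_entropy M (g \<circ> d)) + (label_entropy M d - label_entropy M (g \<circ> d)))"
    by linarith
  also have "n * (label_entropy M d - label_entropy M (g \<circ> d)) + (label_entropy M d - label_entropy M (g \<circ> d))
      = Suc n * (label_entropy M d - label_entropy M (g \<circ> d))"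
    by (simp only: of_nat_Suc distrib_right mult_1_left add.commute)
  finally show ?case .
qed

section \<open>Replacing the atoms of a partition by closed subsets\<close>

lemma closed_approximation:
  assumes reg: "\<And>A e. A \<in> sets borel \<Longrightarrow> 0 < e \<Longrightarrow> \<exists>U. open U \<and> A \<subseteq> U \<and> measure M U < measure M A + e"
    and A: "A \<in> sets borel" and e: "0 < (e::real)"
  shows "\<exists>B. closed B \<and> B \<subseteq> A \<and> measure M (A - B) < e"
proof -
  have cA: "- A \<in> sets borel" using A by (simp add: Compl_eq_Diff_UNIV borel_comp)
  obtain U where U: "open U" "- A \<subseteq> U" "measure M U < measure M (- A) + e"
    using reg[OF cA e] by blast
  have "measure M (A - - U) = measure M (U - - A)" by (rule arg_cong[of _ _ "measure M"]) auto
  also have "\<dots> = measure M U - measure M (- A)"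
    using U A cA by (intro finite_measure_Diff) (auto simp: sets_M)
  finally show ?thesis using U by (intro exI[of _ "- U"]) auto
qed

text \<open>Each fibre of \<open>d\<close> is shrunk to a closed set \<open>B l\<close>, and the
  coarser labelling merges everything left over into the single label \<open>None\<close>. What is
  lost is at most the entropy of the leftovers, and regularity makes these as small as
  wanted.\<close>

lemma closed_refinement:
  assumes reg: "\<And>A e. A \<in> sets borel \<Longrightarrow> 0 < e \<Longrightarrow> \<exists>U. open U \<and> A \<subseteq> U \<and> measure M U < measure M A + e"
    and d: "simple_function M d"
  shows "\<exists>B. (\<forall>l. closed (B l) \<and> B l \<subseteq> d -` {l}) \<and>
    simple_function M (\<lambda>x. (d x, x \<in> B (d x))) \<and>
    label_entropy M (\<lambda>x. (d x, x \<in> B (d x)))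
      - label_entropy M ((\<lambda>(l, b). if b then Some l else None) \<circ> (\<lambda>x. (d x, x \<in> B (d x)))) \<le> 1"
proof -
  let ?g = "\<lambda>(l, b). if b then Some l else None"
  let ?\<eta> = "\<lambda>x::real. - x * ln x"
  define r where "r = card (range d)"
  have fin: "finite (range d)" using simple_labelD(1)[OF d] .
  then have r: "0 < r" by (auto simp: r_def card_gt_0_iff)
  \<comment> \<open>There are \<open>r\<close> leftovers, each of mass below \<open>\<kappa>\<close>
    and so of entropy at most \<open>2 * sqrt \<kappa> = 1 / r\<close>, which adds up to at most
    1.\<close>
  define \<kappa> where "\<kappa> = (1 / (2 * real r))\<^sup>2"
  have \<kappa>: "0 < \<kappa>" using r by (simp add: \<kappa>_def)
  have "\<exists>B. closed B \<and> B \<subseteq> d -` {l} \<and> measure M (d -` {l} - B) < \<kappa>" for l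
    using simple_labelD(2)[OF d, of "{l}"] sets_M by (intro closed_approximation reg \<kappa>) auto
  then obtain B where B: "\<And>l. closed (B l)" "\<And>l. B l \<subseteq> d -` {l}" "\<And>l. measure M (d -` {l} - B l) < \<kappa>"
    by metis
  define c where "c x = (d x, x \<in> B (d x))" for x
  have dB: "d x = l" if "x \<in> B l" for x l using B(2)[of l] that by auto
  have core: "{x. x \<in> B (d x)} = (\<Union>l\<in>range d. B l)"
  proof (intro set_eqI iffI)
    fix x assume "x \<in> (\<Union>l\<in>range d. B l)"
    then obtain l where "x \<in> B l" by blast
    then show "x \<in> {x. x \<in> B (d x)}" using dB[of x l] by simp
  qed blast
  have "closed (\<Union>l\<in>range d. B l)" by (intro closed_UN fin ballI B(1))
  then have core_sets: "{x. x \<in> B (d x)} \<in> sets M" unfolding core sets_M by (rule borel_closed)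
  have "simple_function M (\<lambda>x. x \<in> B (d x))"
    unfolding simple_function_def
  proof (intro conjI ballI)
    fix b
    have "(\<lambda>x. x \<in> B (d x)) -` {b} \<inter> space M = (if b then {x. x \<in> B (d x)} else space M - {x. x \<in> B (d x)})"
      by (auto simp: space_UNIV)
    also have "\<dots> \<in> sets M" using core_sets by auto
    finally show "(\<lambda>x. x \<in> B (d x)) -` {b} \<inter> space M \<in> sets M" .
  qed (rule finite_subset[of _ UNIV], auto)
  then have sc: "simple_function M c" unfolding c_def by (intro simple_function_Pair d)
  have p1: "label_prob M c (l, True) = measure M (B l)" for l
  proof -
    have "c x = (l, True) \<longleftrightarrow> x \<in> B l" for x unfolding c_def using dB[of x l] by blast
    then have "c -` {(l, True)} = B l" by blast
    then show ?thesis by (simp add: label_prob_def)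
  qed
  have p2: "label_prob M c (l, False) = measure M (d -` {l} - B l)" for l
    unfolding label_prob_def c_def by (intro arg_cong[of _ _ "measure M"]) auto
  have p3: "label_prob M (?g \<circ> c) (Some l) = measure M (B l)" for l
  proof -
    have "(?g \<circ> c) x = Some l \<longleftrightarrow> x \<in> B l" for x unfolding c_def using dB[of x l] by auto
    then have "(?g \<circ> c) -` {Some l} = B l" by blast
    then show ?thesis by (simp add: label_prob_def)
  qed
  have "label_entropy M c = (\<Sum>(l, b)\<in>range d \<times> UNIV. ?\<eta> (label_prob M c (l, b)))"
    using fin by (subst label_entropy_superset[of "range d \<times> UNIV"]) (auto simp: c_def case_prod_unfold)
  also have "\<dots> = (\<Sum>l\<in>range d. \<Sum>b\<in>UNIV. ?\<eta> (label_prob M c (l, b)))"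
    by (rule sum.cartesian_product[symmetric])
  also have "\<dots> = (\<Sum>l\<in>range d. ?\<eta> (measure M (B l)) + ?\<eta> (measure M (d -` {l} - B l)))"
    by (intro sum.cong refl) (simp only: UNIV_bool p1 p2, simp add: p1 p2)
  finally have Hc: "label_entropy M c = (\<Sum>l\<in>range d. ?\<eta> (measure M (B l))) + (\<Sum>l\<in>range d. ?\<eta> (measure M (d -` {l} - B l)))"
    by (simp only: sum.distrib)
  have "label_entropy M (?g \<circ> c) = (\<Sum>o'\<in>insert None (Some ` range d). ?\<eta> (label_prob M (?g \<circ> c) o'))"
    using fin by (intro label_entropy_superset) (auto simp: c_def)
  also have "\<dots> = ?\<eta> (label_prob M (?g \<circ> c) None) + (\<Sum>l\<in>range d. ?\<eta> (measure M (B l)))"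
    using fin by (subst sum.insert) (auto simp: sum.reindex p3)
  finally have Hg: "label_entropy M (?g \<circ> c) = ?\<eta> (label_prob M (?g \<circ> c) None) + (\<Sum>l\<in>range d. ?\<eta> (measure M (B l)))" .
  have "0 \<le> ?\<eta> (label_prob M (?g \<circ> c) None)"
    using label_prob_nonneg[of "?g \<circ> c" None] label_prob_le_1[of "?g \<circ> c" None]
    by (cases "label_prob M (?g \<circ> c) None = 0") (auto simp: mult_le_0_iff)
  moreover have "(\<Sum>l\<in>range d. ?\<eta> (measure M (d -` {l} - B l))) \<le> (\<Sum>l\<in>range d. 1 / real r)"
  proof (intro sum_mono)
    fix l
    have "?\<eta> (measure M (d -` {l} - B l)) \<le> 2 * sqrt (measure M (d -` {l} - B l))"
      by (rule neg_xlnx_le) simp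
    also have "\<dots> \<le> 2 * sqrt \<kappa>" using B(3)[of l] by simp
    also have "\<dots> = 1 / r" using r by (simp add: \<kappa>_def real_sqrt_power)
    finally show "?\<eta> (measure M (d -` {l} - B l)) \<le> 1 / r" .
  qed
  moreover have "(\<Sum>l\<in>range d. 1 / real r) = 1" using r by (simp add: r_def)
  ultimately have "label_entropy M c - label_entropy M (?g \<circ> c) \<le> 1" unfolding Hc Hg by linarith
  then show ?thesis using B(1,2) sc unfolding c_def by (intro exI[of _ B]) simp
qed

lemma gibbs_integral:
  assumes c: "simple_function M c" and h: "integrable M h" and s: "\<And>x. h x \<le> s (c x)"
  shows "label_entropy M c + (\<integral>x. h x \<partial>M) \<le> ln (\<Sum>l\<in>range c. exp (s l))"
proof -
  note fin = simple_labelD(1)[OF c]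
  have eq: "s (c x) = (\<Sum>l\<in>range c. s l * indicator (c -` {l}) x)" for x
  proof -
    have "(\<Sum>l\<in>range c. s l * indicator (c -` {l}) x) = (\<Sum>l\<in>{c x}. s l * indicator (c -` {l}) x)"
      using fin by (intro sum.mono_neutral_right) auto
    then show ?thesis by simp
  qed
  have ind: "integrable M (\<lambda>x. s l * indicator (c -` {l}) x)" for l
    using simple_labelD(2)[OF c] by (intro integrable_mult_right integrable_real_indicator) (auto simp: less_top[symmetric])
  have "(\<integral>x. h x \<partial>M) \<le> (\<integral>x. (\<Sum>l\<in>range c. s l * indicator (c -` {l}) x) \<partial>M)"
    using s unfolding eq by (intro integral_mono h Bochner_Integration.integrable_sum ind)
  also have "\<dots> = (\<Sum>l\<in>range c. \<integral>x. s l * indicator (c -` {l}) x \<partial>M)"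
    by (rule Bochner_Integration.integral_sum[OF ind])
  also have "\<dots> = (\<Sum>l\<in>range c. label_prob M c l * s l)"
    using simple_labelD(2)[OF c] by (simp add: label_prob_def space_UNIV mult.commute)
  finally show ?thesis using gibbs_inequality[OF c, of s] by linarith
qed

end

context compact_system
begin

section \<open>Counting words by separated points\<close>

lemma continuous_modulus:
  fixes f :: "'a \<Rightarrow> real"
  assumes f: "f \<in> cont_space" and e: "0 < e"
  obtains d where "0 < d" "\<And>x y. dist x y < d \<Longrightarrow> \<bar>f x - f y\<bar> < e"
  using compact_uniformly_continuous[OF _ compact_UNIV, of f] f e
  unfolding uniformly_continuous_on_def cont_space_def dist_real_def by (metis UNIV_I mem_Collect_eq)

text \<open>\<open>d\<close> is a Lebesgue number for the cover by the sets \<open>U k\<close>,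
  where \<open>U k\<close> avoids every closed set of the finite family except \<open>B k\<close>: a
  ball inside \<open>U k\<close> meets none of the others.\<close>

lemma closed_family_gap:
  fixes B :: "'l \<Rightarrow> 'a set"
  assumes "finite I" "\<And>l. closed (B l)" "\<And>l x. x \<in> B l \<Longrightarrow> c x = l"
  obtains d where "0 < d" "\<And>y. \<exists>k. \<forall>x l. dist y x < d \<longrightarrow> l \<in> I \<longrightarrow> x \<in> B l \<longrightarrow> l = k"
proof -
  define U where "U k = - (\<Union>l\<in>I - {k}. B l)" for k
  have U: "open (U k)" for k
    unfolding U_def using assms(1,2) by (intro open_Compl closed_UN) auto
  have "x \<in> U (c x)" for x unfolding U_def using assms(3) by blast
  then have cov: "UNIV \<subseteq> \<Union>(range U)" by blast
  have opn: "open G" if "G \<in> range U" for G using U that by auto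
  have "\<exists>d>0. \<forall>y. \<exists>G\<in>range U. ball y d \<subseteq> G"
  proof (rule Heine_Borel_lemma[OF compact_UNIV cov opn])
    fix d :: real assume "0 < d" "\<And>y. y \<in> UNIV \<Longrightarrow> \<exists>G\<in>range U. ball y d \<subseteq> G"
    then show "\<exists>d>0. \<forall>y. \<exists>G\<in>range U. ball y d \<subseteq> G" by (intro exI[of _ d]) simp
  qed
  then obtain d where d: "0 < d" "\<And>y. \<exists>G\<in>range U. ball y d \<subseteq> G" by auto
  have "\<exists>k. \<forall>x l. dist y x < d \<longrightarrow> l \<in> I \<longrightarrow> x \<in> B l \<longrightarrow> l = k" for y
  proof -
    obtain k where "ball y d \<subseteq> U k" using d(2)[of y] by auto
    then have "x \<in> U k" if "dist y x < d" for x using that by auto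
    then have "l = k" if "dist y x < d" "l \<in> I" "x \<in> B l" for x l using that unfolding U_def by blast
    then show ?thesis by blast
  qed
  then show ?thesis using that d(1) by blast
qed

lemma birkhoff_sum_continuous: "f \<in> cont_space \<Longrightarrow> birkhoff_sum T f n \<in> cont_space"
  unfolding cont_space_def birkhoff_sum_def
  by (auto intro!: continuous_intros continuous_on_compose2[of UNIV f] continuous_iterate_on)

lemma birkhoff_sum_close:
  assumes "\<And>x y. dist x y < d \<Longrightarrow> \<bar>f x - f y\<bar> < e" "0 < n" "bowen_dist T n x y < d"
  shows "birkhoff_sum T f n x \<le> birkhoff_sum T f n y + n * e"
proof -
  have "dist ((T ^^ k) x) ((T ^^ k) y) < d" if "k < n" for k
    using bowen_dist_le_iff[OF assms(2), of T x y "bowen_dist T n x y"] assms(3) that by auto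
  then have "f ((T ^^ k) x) \<le> f ((T ^^ k) y) + e" if "k < n" for k
    using assms(1)[of "(T ^^ k) x" "(T ^^ k) y"] that by auto
  then have "birkhoff_sum T f n x \<le> (\<Sum>k<n. f ((T ^^ k) y) + e)"
    unfolding birkhoff_sum_def by (intro sum_mono) auto
  then show ?thesis by (simp add: birkhoff_sum_def sum.distrib)
qed

text \<open>Every word gets a representative nearly maximising the Birkhoff sum on its fibre, and
  this point is replaced by a nearby one of a maximal separated set \<open>E\<close>. By
  \<open>gap\<close>, a point of \<open>E\<close> leaves at each position only \<open>None\<close>
  or one fixed letter, so at most \<open>2 ^ n\<close> words are sent to it.\<close>

lemma word_weight_le:
  fixes D :: "'a \<Rightarrow> 'l option"
  assumes m: "0 < m" and n: "0 < n" and f: "f \<in> cont_space" and fin: "finite (range (word (T ^^ m) D n))"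
    and d: "0 < d" "d < d'" and f_mod: "\<And>x y. dist x y < d' \<Longrightarrow> \<bar>f x - f y\<bar> < \<tau>"
    and gap: "\<And>y. \<exists>k. \<forall>x l. dist y x < d' \<longrightarrow> D x = Some l \<longrightarrow> l = k"
  shows "\<exists>s. (\<forall>x. birkhoff_sum T f (m * n) x \<le> s (word (T ^^ m) D n x)) \<and>
    (\<Sum>v\<in>range (word (T ^^ m) D n). exp (s v))
      \<le> exp (1 + real (m * n) * \<tau>) * 2 ^ n * partition_sum T f (m * n) d"
proof -
  let ?W = "word (T ^^ m) D n" and ?N = "m * n" and ?S = "birkhoff_sum T f (m * n)"
  have N: "0 < ?N" using m n by simp
  obtain K where K: "\<And>x. \<bar>?S x\<bar> \<le> K"
    using compact_bounded_continuous[OF compact_UNIV birkhoff_sum_continuous[OF f, of ?N]] by metis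
  \<comment> \<open>The supremum over a fibre need not be attained; the slack 1 allowed here is the
    1 in the factor \<open>exp (1 + real (m * n) * \<tau>)\<close>.\<close>
  have "\<exists>x. ?W x = v \<and> (\<forall>x'. ?W x' = v \<longrightarrow> ?S x' \<le> ?S x + 1)" if v: "v \<in> range ?W" for v
  proof -
    let ?A = "?S ` {x. ?W x = v}"
    have ne: "?A \<noteq> {}" using v by auto
    have bdd: "bdd_above ?A" using K by (intro bdd_aboveI2[of _ _ K]) (auto simp: abs_le_iff)
    obtain x where x: "?W x = v" "Sup ?A - 1 < ?S x"
      using less_cSup_iff[OF ne bdd, of "Sup ?A - 1"] by auto
    have "?S x' \<le> Sup ?A" if "?W x' = v" for x' using that by (intro cSup_upper bdd) auto
    then show ?thesis using x by (intro exI[of _ x]) force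
  qed
  then have "\<forall>v. \<exists>x. v \<in> range ?W \<longrightarrow> ?W x = v \<and> (\<forall>x'. ?W x' = v \<longrightarrow> ?S x' \<le> ?S x + 1)" by blast
  then obtain p where p: "\<And>v. v \<in> range ?W \<Longrightarrow> ?W (p v) = v"
    "\<And>v x. v \<in> range ?W \<Longrightarrow> ?W x = v \<Longrightarrow> ?S x \<le> ?S (p v) + 1" by metis
  obtain E where E: "separated T ?N d E" "\<And>x. \<exists>y\<in>E. bowen_dist T ?N x y \<le> d"
    using separated_maximal[OF d(1) N] by metis
  have finE: "finite E" using card_separated_le[OF d(1)] E(1) N by metis
  obtain q where q: "\<And>x. q x \<in> E" "\<And>x. bowen_dist T ?N x (q x) \<le> d" using E(2) by metis
  define y where "y v = q (p v)" for v
  have S_le: "?S (p v) \<le> ?S (y v) + ?N * \<tau>" for v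
    unfolding y_def using q(2)[of "p v"] d by (intro birkhoff_sum_close[OF f_mod N]) auto
  obtain k where k: "\<And>z x l. dist z x < d' \<Longrightarrow> D x = Some l \<Longrightarrow> l = k z" using gap by metis
  have fibre: "card {v \<in> range ?W. y v = z} \<le> 2 ^ n" for z
  proof (rule card_two_choices)
    fix v j assume v: "v \<in> {v \<in> range ?W. y v = z}" and j: "j < n"
    have "((T ^^ m) ^^ j) x = (T ^^ (m * j)) x" for x by (simp add: funpow_mult)
    then have vj: "v ! j = D ((T ^^ (m * j)) (p v))"
      using p(1)[of v] v j nth_word[OF j, of "T ^^ m" D "p v"] by simp
    have "dist ((T ^^ (m * j)) (p v)) ((T ^^ (m * j)) z) \<le> d"
      using q(2)[of "p v"] bowen_dist_le_iff[OF N, of T "p v" z d] v j m by (auto simp: y_def)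
    then have "dist ((T ^^ (m * j)) z) ((T ^^ (m * j)) (p v)) < d'" using d by (simp add: dist_commute)
    from k[OF this] show "v ! j = None \<or> v ! j = Some (k ((T ^^ (m * j)) z))"
      unfolding vj by (cases "D ((T ^^ (m * j)) (p v))") auto
  qed auto
  define s where "s v = ?S (p v) + 1" for v
  have "(\<Sum>v\<in>range ?W. exp (s v)) \<le> (\<Sum>v\<in>range ?W. exp (1 + ?N * \<tau>) * exp (?S (y v)))"
    unfolding s_def exp_add[symmetric] using S_le by (intro sum_mono) (simp add: algebra_simps)
  also have "\<dots> = exp (1 + ?N * \<tau>) * (\<Sum>v\<in>range ?W. exp (?S (y v)))"
    by (rule sum_distrib_left[symmetric])
  also have "(\<Sum>v\<in>range ?W. exp (?S (y v))) = (\<Sum>z\<in>E. \<Sum>v\<in>{v \<in> range ?W. y v = z}. exp (?S (y v)))"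
    using q(1) by (intro sum.group[symmetric] fin finE) (auto simp: y_def)
  also have "\<dots> = (\<Sum>z\<in>E. card {v \<in> range ?W. y v = z} * exp (?S z))"
    by (intro sum.cong refl) simp
  also have "\<dots> \<le> (\<Sum>z\<in>E. 2 ^ n * exp (?S z))"
  proof (intro sum_mono mult_right_mono)
    fix z show "real (card {v \<in> range ?W. y v = z}) \<le> 2 ^ n"
      using of_nat_mono[OF fibre[of z], where ?'a = real] by simp
  qed simp
  also have "\<dots> = 2 ^ n * weight_sum T f ?N E" by (simp add: weight_sum_def sum_distrib_left)
  also have "\<dots> \<le> 2 ^ n * partition_sum T f ?N d"
    by (intro mult_left_mono weight_sum_le_partition_sum d(1) N f E(1)) simp
  finally have "(\<Sum>v\<in>range ?W. exp (s v)) \<le> exp (1 + ?N * \<tau>) * 2 ^ n * partition_sum T f ?N d"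
    by (simp add: mult.assoc)
  moreover have "?S x \<le> s (?W x)" for x unfolding s_def by (rule p(2)) auto
  ultimately show ?thesis by (intro exI[of _ s] conjI allI)
qed

lemma word_concat: "concat (word (T ^^ m) (word T c m) n x) = word T c (m * n) x"
proof (induction n)
  case (Suc n)
  have "word T c (m * Suc n) x = word T c (m * n) x @ word T c m ((T ^^ (m * n)) x)"
    using word_add[of T c "m * n" m x] by (simp add: add.commute)
  then show ?case using Suc by (simp add: word_Suc funpow_mult)
qed (simp add: word_def)

text \<open>The approximation by closed sets costs entropy at most 1 per letter, and the ambiguous
  letters cost ln 2 each. Working with \<open>T ^^ m\<close> and with blocks of \<open>m\<close>
  labels as letters makes these costs occur once in \<open>m\<close> steps, so that they contribute
  only (1 + ln 2)/m.\<close>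

lemma variational_upper_bound:
  assumes \<nu>: "\<nu> \<in> invariant_measures T"
    and reg: "\<And>A e. A \<in> sets borel \<Longrightarrow> 0 < e \<Longrightarrow> \<exists>U. open U \<and> A \<subseteq> U \<and> measure \<nu> U < measure \<nu> A + e"
    and f: "f \<in> cont_space"
    and P: "\<And>e d. 0 < e \<Longrightarrow> 0 < d \<Longrightarrow> eventually (\<lambda>n. finite_pressure f n d < P + e) sequentially"
  shows "measure_entropy \<nu> T \<le> ereal (P - (\<integral>x. f x \<partial>\<nu>))"
proof -
  interpret I: invariant_system T \<nu> using continuous_T \<nu> by unfold_locales
  have f_meas: "g \<in> borel_measurable \<nu>" if "g \<in> cont_space" for g :: "'a \<Rightarrow> real"
    using borel_measurable_continuous_onI[of g] that
    by (simp add: cont_space_def measurable_cong_sets[OF I.sets_M refl])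
  have f_int: "integrable \<nu> g" if g: "g \<in> cont_space" for g :: "'a \<Rightarrow> real"
  proof -
    obtain K where "\<And>x. \<bar>g x\<bar> \<le> K" using compact_bounded_continuous[OF compact_UNIV g] by metis
    then show ?thesis using f_meas[OF g] by (intro I.integrable_const_bound[of _ K]) auto
  qed
  have cont_it: "(\<lambda>x. f ((T ^^ k) x)) \<in> cont_space" for k
    using f unfolding cont_space_def by (auto intro!: continuous_on_compose2[of UNIV f] continuous_iterate_on)
  have birk: "(\<integral>x. birkhoff_sum T f N x \<partial>\<nu>) = N * (\<integral>x. f x \<partial>\<nu>)" for N
    unfolding birkhoff_sum_def
    by (simp add: Bochner_Integration.integral_sum[OF f_int[OF cont_it]] I.integral_iterate[OF f_meas[OF f]])
  show ?thesis
  proof (rule I.measure_entropy_le)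
    fix c :: "'a \<Rightarrow> 'a set" and e :: real assume c: "simple_function \<nu> c" and e: "0 < e"
    obtain m :: nat where large: "(1 + ln 2) / (e / 4) < real m" using reals_Archimedean2 by blast
    \<comment> \<open>Four errors have to fit into \<open>e\<close>: the cost of the blocks, the
      term \<open>1 / real (m * n)\<close>, the modulus of continuity of \<open>f\<close>, and the
      approximation of the pressure.\<close>
    define h where "h = e / 4"
    have h: "0 < h" using e by (simp add: h_def)
    have m: "0 < m" "(1 + ln 2) / m \<le> h"
    proof -
      have "0 < (1 + ln 2) / (e / 4)" using e by (simp add: add_pos_pos)
      then have "0 < real m" using large by linarith
      then show "0 < m" by simp
      have "1 + ln 2 < real m * (e / 4)" using large e by (subst (asm) pos_divide_less_eq) simp_all
      then show "(1 + ln 2) / m \<le> h" using \<open>0 < m\<close> by (simp add: h_def pos_divide_le_eq mult.commute)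
    qed
    interpret S: invariant_system "T ^^ m" \<nu>
    proof
      show "continuous_on UNIV (T ^^ m)" by (rule continuous_iterate_on)
      have "distr \<nu> borel (T ^^ m) = distr \<nu> \<nu> (T ^^ m)"
        by (rule distr_cong) (auto simp: I.sets_M)
      then show "\<nu> \<in> invariant_measures (T ^^ m)"
        using \<nu> I.distr_iterate[of m] by (simp add: invariant_measures_def)
    qed
    define b where "b = word T c m"
    have b: "simple_function \<nu> b"
      unfolding b_def by (rule simple_function_word) (rule I.simple_function_iterate[OF c])
    obtain B where B: "(\<forall>l. closed (B l) \<and> B l \<subseteq> b -` {l}) \<and>
      simple_function \<nu> (\<lambda>x. (b x, x \<in> B (b x))) \<and>
      label_entropy \<nu> (\<lambda>x. (b x, x \<in> B (b x)))
        - label_entropy \<nu> ((\<lambda>(l, b). if b then Some l else None) \<circ> (\<lambda>x. (b x, x \<in> B (b x)))) \<le> 1"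
      using I.closed_refinement[OF reg b] ..
    define b' where "b' = (\<lambda>x. (b x, x \<in> B (b x)))"
    define g :: "'a set list \<times> bool \<Rightarrow> 'a set list option" where "g = (\<lambda>(l, b). if b then Some l else None)"
    define D where "D = g \<circ> b'"
    have b': "simple_function \<nu> b'" and b'_le: "label_entropy \<nu> b' - label_entropy \<nu> D \<le> 1"
      using B by (simp_all add: b'_def g_def D_def)
    have D_Some: "D x = Some l \<Longrightarrow> x \<in> B l \<and> l \<in> range b" for x l
      by (auto simp: D_def g_def b'_def split: if_splits)
    have sD: "simple_function \<nu> D" unfolding D_def by (rule simple_function_compose[OF b'])
    obtain d1 where d1: "0 < d1" "\<And>y. \<exists>k. \<forall>x l. dist y x < d1 \<longrightarrow> l \<in> range b \<longrightarrow> x \<in> B l \<longrightarrow> l = k"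
    proof (rule closed_family_gap[of "range b" B b])
      show "finite (range b)" using I.simple_labelD(1)[OF b] .
      show "closed (B l)" "x \<in> B l \<Longrightarrow> b x = l" for l x using B by auto
    qed blast
    obtain d2 where d2: "0 < d2" "\<And>x y. dist x y < d2 \<Longrightarrow> \<bar>f x - f y\<bar> < h"
      using continuous_modulus[OF f h] by metis
    define d' where "d' = min d1 d2"
    define d where "d = d' / 2"
    have d: "0 < d" "d < d'" using d1(1) d2(1) by (auto simp: d'_def d_def)
    have mod: "\<bar>f x - f y\<bar> < h" if "dist x y < d'" for x y using d2(2) that by (simp add: d'_def)
    have gap: "\<exists>k. \<forall>x l. dist y x < d' \<longrightarrow> D x = Some l \<longrightarrow> l = k" for y
    proof -
      obtain k where k: "\<forall>x l. dist y x < d1 \<longrightarrow> l \<in> range b \<longrightarrow> x \<in> B l \<longrightarrow> l = k" using d1(2) ..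
      have "l = k" if "dist y x < d'" "D x = Some l" for x l
        by (rule k[rule_format]) (use D_Some[OF that(2)] that(1) in \<open>auto simp: d'_def\<close>)
      then show ?thesis by blast
    qed
    have bound: "label_entropy \<nu> (word T c (m * n)) / real (m * n)
        \<le> (1 + ln 2) / m + 1 / real (m * n) + h + finite_pressure f (m * n) d - (\<integral>x. f x \<partial>\<nu>)" if n: "0 < n" for n
    proof -
      have N: "0 < m * n" using m n by simp
      have sW: "simple_function \<nu> (word (T ^^ m) D n)"
        by (rule simple_function_word) (rule S.simple_function_iterate[OF sD])
      obtain s where "(\<forall>x. birkhoff_sum T f (m * n) x \<le> s (word (T ^^ m) D n x)) \<and>
        (\<Sum>v\<in>range (word (T ^^ m) D n). exp (s v)) \<le> exp (1 + real (m * n) * h) * 2 ^ n * partition_sum T f (m * n) d"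
        using word_weight_le[OF m(1) n f I.simple_labelD(1)[OF sW] d mod gap] ..
      note s = conjunct1[OF this, rule_format] conjunct2[OF this]
      have "label_entropy \<nu> (word (T ^^ m) D n) + real (m * n) * (\<integral>x. f x \<partial>\<nu>)
          \<le> ln (\<Sum>v\<in>range (word (T ^^ m) D n). exp (s v))"
        using I.gibbs_integral[OF sW f_int[OF birkhoff_sum_continuous[OF f]] s(1)] by (simp add: birk)
      also have "\<dots> \<le> ln (exp (1 + real (m * n) * h) * 2 ^ n * partition_sum T f (m * n) d)"
        using s(2) I.simple_labelD(1)[OF sW] by (intro ln_mono) (auto intro!: sum_pos)
      also have "\<dots> = 1 + real (m * n) * h + n * ln 2 + ln (partition_sum T f (m * n) d)"
        using partition_sum_pos[OF d(1) N f] by (simp add: ln_mult ln_realpow)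
      finally have 1: "label_entropy \<nu> (word (T ^^ m) D n) + real (m * n) * (\<integral>x. f x \<partial>\<nu>)
        \<le> 1 + real (m * n) * h + n * ln 2 + ln (partition_sum T f (m * n) d)" .
      have sb': "simple_function \<nu> (word (T ^^ m) b' n)"
        by (rule simple_function_word) (rule S.simple_function_iterate[OF b'])
      \<comment> \<open>The letters of \<open>b'\<close> still contain the blocks of
        \<open>c\<close>, so concatenating them recovers the long word.\<close>
      have "word T c (m * n) = (concat \<circ> map fst) \<circ> word (T ^^ m) b' n"
      proof
        fix x
        have "map fst (word (T ^^ m) b' n x) = word (T ^^ m) b n x" by (simp add: word_def b'_def)
        then show "word T c (m * n) x = ((concat \<circ> map fst) \<circ> word (T ^^ m) b' n) x"
          using word_concat[of m c n x] by (simp add: b_def)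
      qed
      then have "label_entropy \<nu> (word T c (m * n)) \<le> label_entropy \<nu> (word (T ^^ m) b' n)"
        using I.label_entropy_comp_le[OF sb', of "concat \<circ> map fst"] by simp
      also have "\<dots> \<le> label_entropy \<nu> (word (T ^^ m) D n) + n * (label_entropy \<nu> b' - label_entropy \<nu> D)"
        unfolding D_def by (rule S.label_entropy_word_refine[OF b'])
      also have "\<dots> \<le> label_entropy \<nu> (word (T ^^ m) D n) + n * 1"
        using mult_left_mono[OF b'_le, of "real n"] by linarith
      finally have "label_entropy \<nu> (word T c (m * n))
        \<le> (1 + ln 2) * n + 1 + real (m * n) * h + ln (partition_sum T f (m * n) d) - real (m * n) * (\<integral>x. f x \<partial>\<nu>)"
        using 1 by (simp add: algebra_simps)
      then have "label_entropy \<nu> (word T c (m * n)) / real (m * n)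
        \<le> ((1 + ln 2) * n + 1 + real (m * n) * h + ln (partition_sum T f (m * n) d) - real (m * n) * (\<integral>x. f x \<partial>\<nu>)) / real (m * n)"
        by (intro divide_right_mono) simp_all
      also have "\<dots> = (1 + ln 2) / m + 1 / real (m * n) + h + finite_pressure f (m * n) d - (\<integral>x. f x \<partial>\<nu>)"
        using m n by (simp add: add_divide_distrib diff_divide_distrib finite_pressure_def)
      finally show ?thesis .
    qed
    have mn: "filterlim (\<lambda>n. m * n) sequentially sequentially"
      using m(1) by (intro filterlim_subseq) (auto simp: strict_mono_def)
    have "eventually (\<lambda>n. finite_pressure f (m * n) d < P + h) sequentially"
      using eventually_compose_filterlim[OF P[OF h d(1)] mn] .
    moreover have "eventually (\<lambda>n. 1 / real (m * n) < h) sequentially"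
      using filterlim_compose[OF lim_1_over_n mn] h by (intro order_tendstoD) auto
    ultimately have "eventually (\<lambda>n. label_entropy \<nu> (word T c (m * n)) / real (m * n) \<le> P - (\<integral>x. f x \<partial>\<nu>) + e) sequentially"
      using eventually_gt_at_top[of 0]
    proof eventually_elim
      case (elim n)
      then have "label_entropy \<nu> (word T c (m * n)) / real (m * n) \<le> h + h + h + (P + h) - (\<integral>x. f x \<partial>\<nu>)"
        using bound[of n] m(2) by linarith
      then show ?case by (simp add: h_def)
    qed
    then have "\<exists>\<^sub>F n in sequentially. label_entropy \<nu> (word T c (m * n)) / real (m * n) \<le> P - (\<integral>x. f x \<partial>\<nu>) + e"
      by (intro eventually_frequently) simp_all
    then show "\<exists>m>0. \<exists>\<^sub>F n in sequentially. label_entropy \<nu> (word T c (m * n)) / real (m * n) \<le> P - (\<integral>x. f x \<partial>\<nu>) + e"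
      using m(1) by blast
  qed
qed

end

section \<open>Orbit averages of Gibbs weights\<close>

context prob_space_UNIV
begin

section \<open>Block entropies for measures that need not be invariant\<close>

lemma label_entropy_word_le:
  assumes c: "\<And>i. simple_function M (\<lambda>x. c ((T ^^ i) x))"
  shows "label_entropy M (\<lambda>x. word T c n ((T ^^ k) x)) \<le> n * ln (card (range c))"
proof -
  let ?W = "\<lambda>x. word T c n ((T ^^ k) x)"
  have fin: "finite (range c)" using simple_labelD(1)[OF c[of 0]] by simp
  then have K: "0 < card (range c)" by (auto simp: card_gt_0_iff)
  have sc: "simple_function M (\<lambda>x. (\<lambda>x. c ((T ^^ k) x)) ((T ^^ i) x))" for i
    using c[of "k + i"] by (simp add: funpow_add)
  have W_eq: "?W = word T (\<lambda>x. c ((T ^^ k) x)) n"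
    by (auto simp: word_def fun_eq_iff funpow_add[THEN fun_cong, simplified, symmetric] add.commute)
  have sW: "simple_function M ?W" unfolding W_eq by (rule simple_function_word[OF sc])
  have sub: "range ?W \<subseteq> {w. set w \<subseteq> range c \<and> length w = n}" by (auto simp: word_def)
  have "label_entropy M ?W \<le> ln (card (range ?W))" by (rule label_entropy_le_ln_card[OF sW])
  also have "\<dots> \<le> ln (real (card (range c) ^ n))"
  proof (rule ln_mono)
    show "0 < real (card (range ?W))" using simple_labelD(1)[OF sW] by (auto simp: card_gt_0_iff)
    show "real (card (range ?W)) \<le> real (card (range c) ^ n)"
      using card_mono[OF finite_lists_length_eq[OF fin] sub] card_lists_length_eq[OF fin, of n] by simp
  qed
  also have "\<dots> = n * ln (card (range c))" using K by (simp add: ln_realpow)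
  finally show ?thesis .
qed

lemma label_entropy_word_blocks:
  assumes c: "\<And>i. simple_function M (\<lambda>x. c ((T ^^ i) x))"
  shows "label_entropy M (\<lambda>x. word T c (q * m) ((T ^^ s) x))
    \<le> (\<Sum>r<m. label_entropy M (\<lambda>x. word T c q ((T ^^ (s + q * r)) x)))"
proof (induction m)
  case 0
  have "(\<lambda>x. word T c 0 ((T ^^ s) x)) = (\<lambda>_. [])" by (auto simp: word_def)
  then show ?case using label_entropy_word_le[of c T 0 s, OF c] by simp
next
  case (Suc m)
  define c' where "c' x = c ((T ^^ s) x)" for x
  have sc': "simple_function M (\<lambda>x. c' ((T ^^ i) x))" for i
    using c[of "s + i"] by (simp add: c'_def funpow_add)
  have W: "word T c' k ((T ^^ i) x) = word T c k ((T ^^ (s + i)) x)" for k i x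
    by (rule nth_equalityI) (simp_all add: c'_def funpow_add[THEN fun_cong, simplified, symmetric] ac_simps)
  have "label_entropy M (word T c' (q * m + q))
      \<le> label_entropy M (word T c' (q * m)) + label_entropy M (\<lambda>x. word T c' q ((T ^^ (q * m)) x))"
    by (rule label_entropy_word_add[OF sc'])
  moreover have "word T c' k = (\<lambda>x. word T c k ((T ^^ s) x))" for k
    using W[of k 0] by (auto simp: fun_eq_iff)
  ultimately show ?case using Suc by (simp add: W add.commute funpow_add)
qed

text \<open>For each offset \<open>s < q\<close> the word is cut into blocks of length
  \<open>q\<close> beginning at time \<open>s\<close>. Summed over all offsets, every time occurs
  exactly once as the start of a block, so an average over starting times takes the place of
  invariance.\<close>

lemma label_entropy_word_average:
  assumes c: "\<And>i. simple_function M (\<lambda>x. c ((T ^^ i) x))" and q: "0 < q"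
  shows "q * label_entropy M (word T c n)
    \<le> (\<Sum>i<n. label_entropy M (\<lambda>x. word T c q ((T ^^ i) x))) + 2 * (real q)\<^sup>2 * ln (card (range c))"
proof -
  define h where "h i = label_entropy M (\<lambda>x. word T c q ((T ^^ i) x))" for i
  define k where "k = ln (real (card (range c)))"
  have h_le: "h i \<le> q * k" for i unfolding h_def k_def by (rule label_entropy_word_le[OF c])
  have h_nn: "0 \<le> h i" for i unfolding h_def by (rule label_entropy_nonneg)
  have k: "0 \<le> k"
    using simple_labelD(1)[OF c[of 0]] by (auto simp: k_def Suc_le_eq card_gt_0_iff)
  \<comment> \<open>With this many blocks the word of length \<open>n\<close> is covered from every
    offset, while the block starts overshoot \<open>n\<close> by at most \<open>q\<close>.\<close>
  define m where "m = n div q + 1"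
  have m: "n \<le> q * m" "q * m \<le> n + q"
  proof -
    have "q * (n div q) + n mod q = n" "n mod q < q" "q * m = q * (n div q) + q"
      using q by (simp_all add: m_def)
    then show "n \<le> q * m" "q * m \<le> n + q" by linarith+
  qed
  have one: "label_entropy M (word T c n) \<le> q * k + (\<Sum>r<m. h (s + q * r))" if s: "s < q" for s
  proof -
    have "take n \<circ> word T c (s + q * m) = word T c n"
      using m(1) by (auto simp: fun_eq_iff word_def take_map)
    then have "label_entropy M (word T c n) \<le> label_entropy M (word T c (s + q * m))"
      using label_entropy_comp_le[OF simple_function_word[of M c T, OF c], of "take n" "s + q * m"] by simp
    also have "\<dots> \<le> label_entropy M (word T c s) + label_entropy M (\<lambda>x. word T c (q * m) ((T ^^ s) x))"
      by (rule label_entropy_word_add[OF c])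
    also have "label_entropy M (word T c s) \<le> s * k"
      using label_entropy_word_le[of c T s 0, OF c] by (simp add: k_def)
    also have "real s * k \<le> q * k" using s k by (intro mult_right_mono) auto
    also have "label_entropy M (\<lambda>x. word T c (q * m) ((T ^^ s) x)) \<le> (\<Sum>r<m. h (s + q * r))"
      unfolding h_def by (rule label_entropy_word_blocks[OF c])
    finally show ?thesis by simp
  qed
  have "q * label_entropy M (word T c n) = (\<Sum>s<q. label_entropy M (word T c n))" by simp
  also have "\<dots> \<le> (\<Sum>s<q. q * k + (\<Sum>r<m. h (s + q * r)))" by (intro sum_mono one) simp
  also have "\<dots> = q * (q * k) + (\<Sum>s<q. \<Sum>r<m. h (s + q * r))" by (simp add: sum.distrib)
  also have "(\<Sum>s<q. \<Sum>r<m. h (s + q * r)) = (\<Sum>r<m. \<Sum>s<q. h (s + q * r))" by (rule sum.swap)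
  also have "\<dots> = (\<Sum>r<m. sum h {r * q..<r * q + q})"
  proof (rule sum.cong[OF refl])
    fix r
    have "(\<Sum>s<q. h (s + q * r)) = (\<Sum>s\<in>{0..<q}. h (s + r * q))"
      by (simp add: lessThan_atLeast0 mult.commute)
    also have "\<dots> = sum h {0 + r * q..<q + r * q}"
      by (rule sum.shift_bounds_nat_ivl[symmetric])
    finally show "(\<Sum>s<q. h (s + q * r)) = sum h {r * q..<r * q + q}" by (simp add: add.commute)
  qed
  also have "\<dots> = sum h {..<m * q}" by (rule sum.nat_group)
  also have "\<dots> = sum h {..<n} + sum h {n..<m * q}"
    using m(1) by (subst sum.union_disjoint[symmetric]) (auto intro!: sum.cong simp: mult.commute)
  also have "sum h {n..<m * q} \<le> (\<Sum>i\<in>{n..<m * q}. q * k)" by (intro sum_mono h_le)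
  also have "\<dots> = real (m * q - n) * (q * k)" by simp
  \<comment> \<open>The overshooting starts cost at most \<open>q * (q * k)\<close>, as do the
    initial pieces of all offsets together; this explains the 2 in the bound.\<close>
  also have "\<dots> \<le> real q * (q * k)" using m(2) k by (intro mult_right_mono) (auto simp: mult.commute)
  finally show ?thesis by (simp add: h_def k_def power2_eq_square algebra_simps)
qed

end

text \<open>The tangent line of -x ln x at the mean \<open>a\<close> lies above the graph, and
  averaging the tangent line returns its value at \<open>a\<close>.\<close>

lemma neg_xlnx_concave:
  fixes p :: "nat \<Rightarrow> real"
  assumes p: "\<And>i. i < n \<Longrightarrow> 0 \<le> p i" and n: "0 < n"
  defines "a \<equiv> (\<Sum>i<n. p i) / n"
  shows "(\<Sum>i<n. - p i * ln (p i)) / n \<le> - a * ln a"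
proof (cases "a = 0")
  case True
  then have "(\<Sum>i<n. p i) = 0" using n by (simp add: a_def)
  then have "\<forall>i\<in>{..<n}. p i = 0" using p by (subst (asm) sum_nonneg_eq_0_iff) auto
  then show ?thesis using True by simp
next
  case False
  have a: "0 < a"
  proof -
    have "0 \<le> (\<Sum>i<n. p i)" using p by (intro sum_nonneg) simp
    then have "0 \<le> a" by (simp add: a_def)
    then show ?thesis using False by linarith
  qed
  have "- p i * ln (p i) \<le> - p i * ln a + a - p i" if i: "i < n" for i
  proof (cases "p i = 0")
    case False
    then have pi: "0 < p i" using p[OF i] by simp
    have "ln a - ln (p i) = ln (a / p i)" using a pi by (simp add: ln_div)
    also have "\<dots> \<le> a / p i - 1" using a pi by (intro ln_le_minus_one) auto
    finally have "p i * (ln a - ln (p i)) \<le> p i * (a / p i - 1)" using pi by (simp add: mult_left_mono)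
    also have "p i * (a / p i - 1) = a - p i" using pi by (simp add: field_simps)
    finally show ?thesis by (simp add: algebra_simps)
  qed (use a in simp)
  then have "(\<Sum>i<n. - p i * ln (p i)) \<le> (\<Sum>i<n. - p i * ln a + a - p i)" by (intro sum_mono) auto
  also have "\<dots> = n * (- a * ln a)"
    using n by (simp add: sum.distrib sum_subtractf sum_negf a_def flip: sum_distrib_right)
  finally show ?thesis using n by (simp add: field_simps)
qed

text \<open>The integral of \<open>g\<close> against the Gibbs weights on \<open>E\<close>, averaged
  over the first \<open>n\<close> images under \<open>T\<close>. It is kept as a functional of
  \<open>g\<close> so that limits can be taken before any measure is constructed.\<close>

definition orbit_average :: "('a \<Rightarrow> 'a) \<Rightarrow> ('a \<Rightarrow> real) \<Rightarrow> nat \<Rightarrow> 'a set \<Rightarrow> ('a \<Rightarrow> real) \<Rightarrow> real" where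
  "orbit_average T f n E g =
     (\<Sum>x\<in>E. exp (birkhoff_sum T f n x) * birkhoff_sum T g n x) / (n * weight_sum T f n E)"

definition gibbs_pmf :: "('a \<Rightarrow> 'a) \<Rightarrow> ('a \<Rightarrow> real) \<Rightarrow> nat \<Rightarrow> 'a set \<Rightarrow> 'a pmf" where
  "gibbs_pmf T f n E = embed_pmf (\<lambda>x. if x \<in> E then exp (birkhoff_sum T f n x) / weight_sum T f n E else 0)"

context
  fixes T :: "'a \<Rightarrow> 'a" and f :: "'a \<Rightarrow> real" and n :: nat and E :: "'a set"
  assumes E: "finite E" "E \<noteq> {}" and n: "0 < n"
begin

lemma weight_sum_pos: "0 < weight_sum T f n E"
  unfolding weight_sum_def using E by (intro sum_pos) auto

lemma pmf_gibbs_pmf: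
  "pmf (gibbs_pmf T f n E) x = (if x \<in> E then exp (birkhoff_sum T f n x) / weight_sum T f n E else 0)"
  unfolding gibbs_pmf_def
proof (rule pmf_embed_pmf)
  fix x show "0 \<le> (if x \<in> E then exp (birkhoff_sum T f n x) / weight_sum T f n E else 0)"
    using weight_sum_pos by simp
next
  have "(\<integral>\<^sup>+ x. ennreal (if x \<in> E then exp (birkhoff_sum T f n x) / weight_sum T f n E else 0) \<partial>count_space UNIV)
    = (\<Sum>x\<in>E. ennreal (if x \<in> E then exp (birkhoff_sum T f n x) / weight_sum T f n E else 0))"
    using E by (intro nn_integral_count_space') auto
  also have "\<dots> = ennreal (\<Sum>x\<in>E. exp (birkhoff_sum T f n x) / weight_sum T f n E)"
    using weight_sum_pos by (subst sum_ennreal[symmetric]) auto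
  also have "(\<Sum>x\<in>E. exp (birkhoff_sum T f n x) / weight_sum T f n E) = 1"
    using weight_sum_pos by (simp add: weight_sum_def flip: sum_divide_distrib)
  finally show "(\<integral>\<^sup>+ x. ennreal (if x \<in> E then exp (birkhoff_sum T f n x) / weight_sum T f n E else 0) \<partial>count_space UNIV) = 1"
    by simp
qed

lemma expectation_gibbs_pmf:
  "measure_pmf.expectation (gibbs_pmf T f n E) h
    = (\<Sum>x\<in>E. exp (birkhoff_sum T f n x) * h x) / weight_sum T f n E"
proof -
  have "measure_pmf.expectation (gibbs_pmf T f n E) h = (\<Sum>x\<in>E. h x * pmf (gibbs_pmf T f n E) x)"
    using E by (intro integral_measure_pmf_real) (auto simp: set_pmf_iff pmf_gibbs_pmf split: if_splits)
  then show ?thesis by (simp add: pmf_gibbs_pmf sum_divide_distrib mult.commute)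
qed

lemma orbit_average_eq:
  "orbit_average T f n E g = (\<Sum>i<n. measure_pmf.expectation (gibbs_pmf T f n E) (\<lambda>x. g ((T ^^ i) x))) / n"
  unfolding expectation_gibbs_pmf orbit_average_def birkhoff_sum_def[of T g]
  by (simp add: sum_distrib_left sum.swap[of _ E] flip: sum_divide_distrib)

lemma orbit_average_indicator:
  "orbit_average T f n E (indicator A) = (\<Sum>i<n. measure (gibbs_pmf T f n E) ((T ^^ i) -` A)) / n"
proof -
  have "measure_pmf.expectation (gibbs_pmf T f n E) (\<lambda>x. indicator A ((T ^^ i) x) :: real)
      = measure (gibbs_pmf T f n E) ((T ^^ i) -` A)" for i
  proof -
    have "(\<lambda>x. indicator A ((T ^^ i) x) :: real) = indicator ((T ^^ i) -` A)" by (auto simp: indicator_def)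
    then show ?thesis by simp
  qed
  then show ?thesis by (simp add: orbit_average_eq)
qed

lemma orbit_average_add: "orbit_average T f n E (\<lambda>x. g x + h x) = orbit_average T f n E g + orbit_average T f n E h"
  by (simp add: orbit_average_def birkhoff_sum_def sum.distrib distrib_left add_divide_distrib)

lemma orbit_average_scale: "orbit_average T f n E (\<lambda>x. a * g x) = a * orbit_average T f n E g"
  by (simp add: orbit_average_def birkhoff_sum_def sum_distrib_left[symmetric] mult.left_commute[of _ a])

lemma orbit_average_mono:
  assumes "\<And>x. g x \<le> h x"
  shows "orbit_average T f n E g \<le> orbit_average T f n E h"
  unfolding orbit_average_def birkhoff_sum_def[of T g] birkhoff_sum_def[of T h]
  using weight_sum_pos assms by (intro divide_right_mono sum_mono mult_left_mono) auto

lemma orbit_average_one: "orbit_average T f n E (\<lambda>_. 1) = 1"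
proof -
  have "(\<Sum>x\<in>E. exp (birkhoff_sum T f n x) * birkhoff_sum T (\<lambda>_. 1) n x) = n * weight_sum T f n E"
    by (simp add: birkhoff_sum_def[of T "\<lambda>_. 1"] weight_sum_def sum_distrib_left mult.commute)
  then show ?thesis using weight_sum_pos n by (simp add: orbit_average_def)
qed

lemma orbit_average_const: "orbit_average T f n E (\<lambda>_. a) = a"
  using orbit_average_scale[of a "\<lambda>_. 1"] orbit_average_one by simp

lemma orbit_average_abs_le:
  assumes "\<And>x. \<bar>g x\<bar> \<le> B"
  shows "\<bar>orbit_average T f n E g\<bar> \<le> B"
proof -
  have "g x \<le> B" "- B \<le> g x" for x using assms[of x] by linarith+
  then show ?thesis
    using orbit_average_mono[of g "\<lambda>_. B"] orbit_average_mono[of "\<lambda>_. - B" g]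
    by (simp add: orbit_average_const abs_le_iff)
qed

text \<open>The Birkhoff sum of \<open>g \<circ> T - g\<close> telescopes to two boundary terms.
  Limits with \<open>n\<close> tending to infinity are therefore invariant.\<close>

lemma orbit_average_shift:
  assumes "\<And>x. \<bar>g x\<bar> \<le> B"
  shows "\<bar>orbit_average T f n E (\<lambda>x. g (T x)) - orbit_average T f n E g\<bar> \<le> 2 * B / n"
proof -
  have tele: "birkhoff_sum T (\<lambda>x. g (T x)) n x - birkhoff_sum T g n x = g ((T ^^ n) x) - g x" for x
    using sum_lessThan_telescope[of "\<lambda>k. g ((T ^^ k) x)" n]
    by (simp add: birkhoff_sum_def sum_subtractf)
  have "orbit_average T f n E (\<lambda>x. g (T x)) - orbit_average T f n E g
      = (\<Sum>x\<in>E. exp (birkhoff_sum T f n x) * (g ((T ^^ n) x) - g x)) / (n * weight_sum T f n E)"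
    unfolding orbit_average_def tele[symmetric]
    by (simp add: right_diff_distrib sum_subtractf diff_divide_distrib)
  also have "\<bar>\<dots>\<bar> \<le> (\<Sum>x\<in>E. exp (birkhoff_sum T f n x) * (2 * B)) / (n * weight_sum T f n E)"
  proof -
    have "\<bar>\<Sum>x\<in>E. exp (birkhoff_sum T f n x) * (g ((T ^^ n) x) - g x)\<bar>
        \<le> (\<Sum>x\<in>E. \<bar>exp (birkhoff_sum T f n x) * (g ((T ^^ n) x) - g x)\<bar>)" by (rule sum_abs)
    also have "\<dots> \<le> (\<Sum>x\<in>E. exp (birkhoff_sum T f n x) * (2 * B))"
    proof (intro sum_mono)
      fix x show "\<bar>exp (birkhoff_sum T f n x) * (g ((T ^^ n) x) - g x)\<bar> \<le> exp (birkhoff_sum T f n x) * (2 * B)"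
        using assms[of x] assms[of "(T ^^ n) x"] by (simp add: abs_mult)
    qed
    finally show ?thesis using weight_sum_pos by (simp add: divide_right_mono)
  qed
  also have "\<dots> = 2 * B / n"
    using weight_sum_pos n by (simp add: weight_sum_def flip: sum_distrib_right)
  finally show ?thesis .
qed

text \<open>Equality case of \<open>gibbs_inequality\<close>, attained by the weights
  \<open>exp (birkhoff_sum T f n x)\<close> themselves. Injectivity of \<open>W\<close> on
  \<open>E\<close> makes the entropy of \<open>W\<close> that of the normalised weights.\<close>

lemma ln_weight_sum_eq:
  assumes W: "finite (range W)" "inj_on W E"
  shows "ln (weight_sum T f n E) = label_entropy (measure_pmf (gibbs_pmf T f n E)) W + real n * orbit_average T f n E f"
proof -
  let ?p = "measure_pmf (gibbs_pmf T f n E)" and ?Z = "weight_sum T f n E" and ?S = "birkhoff_sum T f n"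
  interpret prob_space_UNIV ?p by unfold_locales simp
  have lp: "label_prob ?p W (W x) = exp (?S x) / ?Z" if x: "x \<in> E" for x
  proof -
    have "W -` {W x} \<inter> set_pmf (gibbs_pmf T f n E) \<subseteq> {x}"
      using W(2) x by (auto simp: set_pmf_iff pmf_gibbs_pmf inj_on_def split: if_splits)
    then have "measure ?p (W -` {W x}) = measure ?p {x}"
      using x weight_sum_pos by (intro measure_pmf.finite_measure_eq_AE) (auto simp: AE_measure_pmf_iff)
    then show ?thesis using x by (simp add: label_prob_def measure_pmf_single pmf_gibbs_pmf)
  qed
  have lp0: "label_prob ?p W v = 0" if v: "v \<notin> W ` E" for v
  proof -
    have "W -` {v} \<inter> set_pmf (gibbs_pmf T f n E) = {}"
      using v by (auto simp: set_pmf_iff pmf_gibbs_pmf split: if_splits)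
    then show ?thesis by (simp add: label_prob_def measure_pmf_zero_iff Int_commute)
  qed
  have "label_entropy ?p W = (\<Sum>v\<in>W ` E. - label_prob ?p W v * ln (label_prob ?p W v))"
    unfolding label_entropy_def using W(1) lp0 by (intro sum.mono_neutral_right) auto
  also have "\<dots> = (\<Sum>x\<in>E. - (exp (?S x) / ?Z) * ln (exp (?S x) / ?Z))"
    using W(2) by (subst sum.reindex) (auto simp: lp)
  also have "\<dots> = (\<Sum>x\<in>E. exp (?S x) / ?Z * ln ?Z - exp (?S x) * ?S x / ?Z)"
    using weight_sum_pos by (intro sum.cong refl) (simp add: ln_div right_diff_distrib left_diff_distrib diff_divide_distrib)
  also have "\<dots> = ln ?Z - real n * orbit_average T f n E f"
    using weight_sum_pos n
    by (simp add: sum_subtractf orbit_average_def weight_sum_def flip: sum_distrib_right sum_divide_distrib)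
  finally show ?thesis by simp
qed

text \<open>Misiurewicz's estimate before the limit. \<open>label_entropy_word_average\<close>
  passes from words of length \<open>n\<close> to words of length \<open>q\<close>, and concavity of
  -x ln x moves the average over starting times inside, producing the orbit averages of
  indicators.\<close>

lemma weight_sum_entropy_bound:
  assumes c: "finite (range c)" "inj_on (word T c n) E" and q: "0 < q"
  shows "ln (weight_sum T f n E) / n
    \<le> (\<Sum>v\<in>range (word T c q). - orbit_average T f n E (indicator (word T c q -` {v}))
          * ln (orbit_average T f n E (indicator (word T c q -` {v})))) / q
      + 2 * real q * ln (card (range c)) / n + orbit_average T f n E f"
proof -
  let ?p = "measure_pmf (gibbs_pmf T f n E)" and ?W = "word T c q"
  interpret prob_space_UNIV ?p by unfold_locales simp
  have sc: "simple_function ?p (\<lambda>x. c ((T ^^ i) x))" for i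
    using c(1) by (auto simp: simple_function_def intro: finite_subset[of _ "range c"])
  note sw = simple_function_word[of ?p c T, OF sc]
  have fin: "finite (range ?W)" using simple_labelD(1)[OF sw] .
  define h where "h i = label_entropy ?p (\<lambda>x. ?W ((T ^^ i) x))" for i
  have h_eq: "h i = (\<Sum>v\<in>range ?W. - measure ?p ((T ^^ i) -` ?W -` {v}) * ln (measure ?p ((T ^^ i) -` ?W -` {v})))" for i
    unfolding h_def using fin by (subst label_entropy_superset[of "range ?W"]) (auto simp: label_prob_def vimage_def)
  have "(\<Sum>i<n. h i) / n = (\<Sum>v\<in>range ?W. (\<Sum>i<n. - measure ?p ((T ^^ i) -` ?W -` {v}) * ln (measure ?p ((T ^^ i) -` ?W -` {v}))) / n)"
    unfolding h_eq by (subst sum.swap) (simp add: sum_divide_distrib)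
  also have "\<dots> \<le> (\<Sum>v\<in>range ?W. - orbit_average T f n E (indicator (?W -` {v})) * ln (orbit_average T f n E (indicator (?W -` {v}))))"
    unfolding orbit_average_indicator by (intro sum_mono neg_xlnx_concave n) simp
  finally have avg: "(\<Sum>i<n. h i) / n \<le> (\<Sum>v\<in>range ?W. - orbit_average T f n E (indicator (?W -` {v}))
      * ln (orbit_average T f n E (indicator (?W -` {v}))))" (is "_ \<le> ?H") .
  have fin_n: "finite (range (word T c n))" using simple_labelD(1)[OF sw] .
  have "q * label_entropy ?p (word T c n) \<le> (\<Sum>i<n. h i) + 2 * (real q)\<^sup>2 * ln (card (range c))"
    unfolding h_def by (rule label_entropy_word_average[OF sc q])
  then have "label_entropy ?p (word T c n) \<le> ((\<Sum>i<n. h i) + 2 * (real q)\<^sup>2 * ln (card (range c))) / q"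
    using q by (simp add: field_simps)
  then have "label_entropy ?p (word T c n) / n \<le> ((\<Sum>i<n. h i) + 2 * (real q)\<^sup>2 * ln (card (range c))) / q / n"
    by (rule divide_right_mono) simp
  also have "\<dots> = (\<Sum>i<n. h i) / n / q + 2 * real q * ln (card (range c)) / n"
    using q n by (simp add: field_simps power2_eq_square)
  also have "(\<Sum>i<n. h i) / n / q \<le> ?H / q" using avg by (rule divide_right_mono) simp
  finally have "label_entropy ?p (word T c n) / n \<le> ?H / q + 2 * real q * ln (card (range c)) / n" by simp
  moreover have "ln (weight_sum T f n E) / n = label_entropy ?p (word T c n) / n + orbit_average T f n E f"
    using ln_weight_sum_eq[OF fin_n c(2)] n by (simp add: add_divide_distrib)
  ultimately show ?thesis by linarith
qed

end

section \<open>Limits of orbit averages\<close>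

text \<open>The \<open>F j\<close> are points of a product of compact intervals, so by Tychonoff's
  theorem they have a cluster point \<open>L\<close>. The filter \<open>G\<close> is generated by
  the tails of the sequence and the preimages of neighbourhoods of \<open>L\<close>.\<close>

lemma cluster_filter:
  fixes F :: "nat \<Rightarrow> 'b \<Rightarrow> real"
  assumes F: "\<And>j b. \<bar>F j b\<bar> \<le> B b"
  shows "\<exists>G L. G \<le> sequentially \<and> G \<noteq> bot \<and> (\<forall>b. ((\<lambda>j. F j b) \<longlongrightarrow> L b) G)"
proof -
  let ?K = "PiE UNIV (\<lambda>b. {- B b..B b})"
  have "compactin (product_topology (\<lambda>_. euclidean) UNIV) ?K"
    unfolding compactin_PiE by simp
  then have K: "compact ?K" unfolding euclidean_product_topology by simp
  have ev: "eventually (\<lambda>x. x \<in> ?K) (filtermap F sequentially)"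
  proof -
    have "F j \<in> ?K" for j using F by (auto simp: abs_le_iff minus_le_iff)
    then show ?thesis by (simp add: eventually_filtermap)
  qed
  have nb: "filtermap F sequentially \<noteq> bot" by (simp add: filtermap_bot_iff)
  obtain L where L: "inf (nhds L) (filtermap F sequentially) \<noteq> bot"
    using K ev nb unfolding compact_filter by blast
  define G where "G = inf sequentially (filtercomap F (nhds L))"
  have "G \<noteq> bot"
  proof
    assume "G = bot"
    then have "eventually (\<lambda>_. False) G" by simp
    then obtain P Q where PQ: "eventually P sequentially" "eventually Q (filtercomap F (nhds L))"
      "\<And>j. P j \<Longrightarrow> Q j \<Longrightarrow> False" unfolding G_def eventually_inf by blast
    obtain R where R: "eventually R (nhds L)" "\<And>j. R (F j) \<Longrightarrow> Q j"
      using PQ(2) unfolding eventually_filtercomap by blast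
    have "eventually (\<lambda>x. \<not> R x) (filtermap F sequentially)"
      unfolding eventually_filtermap using PQ(1) by (rule eventually_mono) (use PQ(3) R(2) in blast)
    then have "eventually (\<lambda>_. False) (inf (nhds L) (filtermap F sequentially))"
      unfolding eventually_inf using R(1) by (intro exI[of _ R] exI[of _ "\<lambda>x. \<not> R x"]) simp
    then show False using L by (simp add: eventually_False)
  qed
  moreover have "G \<le> sequentially" by (simp add: G_def)
  moreover have "((\<lambda>j. F j b) \<longlongrightarrow> L b) G" for b
  proof (rule topological_tendstoI)
    fix S :: "real set" assume S: "open S" "L b \<in> S"
    have lim: "filterlim F (nhds L) G"
      unfolding G_def by (rule filterlim_mono[OF filterlim_filtercomap]) auto
    have "open ((\<lambda>x :: 'b \<Rightarrow> real. x b) -` S)"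
      using S(1) by (rule open_vimage[OF _ continuous_on_product_coordinates])
    then have "eventually (\<lambda>x. x b \<in> S) (nhds L)"
      using S(2) unfolding eventually_nhds by (intro exI[of _ "(\<lambda>x. x b) -` S"]) simp
    from eventually_compose_filterlim[OF this lim] show "eventually (\<lambda>j. F j b \<in> S) G" .
  qed
  ultimately show ?thesis by (intro exI[of _ G] exI[of _ L]) simp
qed

text \<open>Continuity of -x ln x including the point 0, where the formula evaluates to 0 and
  \<open>neg_xlnx_le\<close> supplies the upper half of a sandwich.\<close>

lemma tendsto_neg_xlnx:
  fixes p :: "'b \<Rightarrow> real"
  assumes p: "(p \<longlongrightarrow> a) G" and nonneg: "\<And>j. 0 \<le> p j" "\<And>j. p j \<le> 1" and G: "G \<noteq> bot"
  shows "((\<lambda>j. - p j * ln (p j)) \<longlongrightarrow> - a * ln a) G"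
proof (cases "a = 0")
  case True
  have "((\<lambda>j. - p j * ln (p j)) \<longlongrightarrow> 0) G"
  proof (rule tendsto_sandwich)
    show "eventually (\<lambda>j. 0 \<le> - p j * ln (p j)) G"
    proof (intro always_eventually allI)
      fix j show "0 \<le> - p j * ln (p j)"
        using nonneg[of j] by (cases "p j = 0") (auto simp: mult_le_0_iff)
    qed
    show "eventually (\<lambda>j. - p j * ln (p j) \<le> 2 * sqrt (p j)) G"
      by (intro always_eventually allI neg_xlnx_le nonneg)
    have "((\<lambda>j. 2 * sqrt (p j)) \<longlongrightarrow> 2 * sqrt a) G" by (intro tendsto_intros p)
    then show "((\<lambda>j. 2 * sqrt (p j)) \<longlongrightarrow> 0) G" using True by simp
  qed simp
  then show ?thesis using True by simp
next
  case False
  then show ?thesis by (intro tendsto_intros p)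
qed

text \<open>For nonempty \<open>F\<close>, \<open>depth (- F)\<close> is the distance to
  \<open>F\<close>, so \<open>g k\<close> equals 1 on \<open>F\<close> and eventually vanishes at
  each point off \<open>F\<close>; dominated convergence does the rest.\<close>

lemma closed_approx_integral:
  fixes M :: "'a::metric_space measure"
  assumes M: "prob_space M" "sets M = sets borel" and F: "closed F"
  defines "g \<equiv> \<lambda>k x. 1 - min 1 (real k * depth (- F) x)"
  shows "(\<lambda>k. \<integral>x. g k x \<partial>M) \<longlonglongrightarrow> measure M F"
proof -
  interpret prob_space M by fact
  have g_cont: "continuous_on UNIV (g k)" for k
    unfolding g_def by (intro continuous_intros continuous_on_depth)
  have F_sets: "F \<in> sets M" using F M(2) by simp
  have space: "space M = UNIV" using sets_eq_imp_space_eq[OF M(2)] by simp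
  have bnd: "\<bar>g k x\<bar> \<le> 1" for k x using depth_nonneg[of "- F" x] by (auto simp: g_def min_def)
  have "(\<lambda>k. \<integral>x. g k x \<partial>M) \<longlonglongrightarrow> (\<integral>x. indicator F x \<partial>M)"
  proof (rule integral_dominated_convergence[where w = "\<lambda>_. 1"])
    show "g k \<in> borel_measurable M" for k
      using borel_measurable_continuous_onI[OF g_cont] by (simp add: measurable_cong_sets[OF M(2) refl])
    show "AE x in M. (\<lambda>k. g k x) \<longlonglongrightarrow> indicator F x"
    proof (intro AE_I2)
      fix x
      show "(\<lambda>k. g k x) \<longlonglongrightarrow> indicator F x"
      proof (cases "x \<in> F")
        case True
        then have "g k x = 1" for k using depth_eq_0[of "- F" x] F by (simp add: g_def open_Compl)
        then show ?thesis using True by simp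
      next
        case False
        then have d: "0 < depth (- F) x" using depth_pos_iff[of "- F" x] F by (simp add: open_Compl)
        obtain N :: nat where N: "1 / depth (- F) x < N" using reals_Archimedean2 by blast
        have "g k x = 0" if "N \<le> k" for k
        proof -
          have "1 / depth (- F) x \<le> real k" using N that by linarith
          then have "1 \<le> real k * depth (- F) x" using d by (simp add: pos_divide_le_eq)
          then show ?thesis by (simp add: g_def)
        qed
        then have "eventually (\<lambda>k. g k x = 0) sequentially" by (auto simp: eventually_sequentially)
        then show ?thesis using False by (simp add: tendsto_eventually)
      qed
    qed
    show "AE x in M. norm (g k x) \<le> 1" for k using bnd by simp
  qed (use F_sets in auto)
  then show ?thesis using F_sets by (simp add: space)
qed

text \<open>Closed sets form an intersection-stable generator, and
  \<open>closed_approx_integral\<close> recovers their measures from integrals of continuous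
  functions.\<close>

lemma measure_eqI_continuous:
  fixes M N :: "'a::metric_space measure"
  assumes M: "prob_space M" "sets M = sets borel" and N: "prob_space N" "sets N = sets borel"
    and eq: "\<And>f. f \<in> cont_space \<Longrightarrow> (\<integral>x. f x \<partial>M) = (\<integral>x. f x \<partial>N)"
  shows "M = N"
proof (rule measure_eqI_generator_eq[where E = "{F. closed F}" and \<Omega> = UNIV and A = "\<lambda>_. UNIV"])
  interpret M: prob_space M by fact
  interpret N: prob_space N by fact
  show "Int_stable {F :: 'a set. closed F}" by (auto simp: Int_stable_def)
  show "sets M = sigma_sets UNIV {F. closed F}" "sets N = sigma_sets UNIV {F. closed F}"
    using M(2) N(2) by (simp_all add: borel_eq_closed)
  fix F :: "'a set" assume "F \<in> {F. closed F}"
  then have F: "closed F" by simp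
  have "(\<lambda>x. 1 - min 1 (real k * depth (- F) x)) \<in> cont_space" for k
    unfolding cont_space_def by (auto intro!: continuous_intros continuous_on_depth)
  then have "measure M F = measure N F"
    using closed_approx_integral[OF M F] closed_approx_integral[OF N F] eq by (simp add: LIMSEQ_unique)
  then show "emeasure M F = emeasure N F" by (simp add: M.emeasure_eq_measure N.emeasure_eq_measure)
next
  interpret M: prob_space M by fact
  show "emeasure M UNIV \<noteq> \<infinity>" for i :: nat by simp
qed auto

text \<open>One half of the portmanteau theorem bounds the limit by the measure of the closure;
  applied to \<open>A\<close> and to its complement, it gives convergence for a null frontier. It is
  phrased for functionals with a monotonicity and a complement rule, so that orbit averages can be
  inserted directly.\<close>

lemma portmanteau_continuity_set:
  fixes M :: "'a::metric_space measure" and \<Lambda> :: "'j \<Rightarrow> ('a \<Rightarrow> real) \<Rightarrow> real"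
  assumes M: "prob_space M" "sets M = sets borel"
    and mono: "\<And>j g h. (\<And>x. g x \<le> h x) \<Longrightarrow> \<Lambda> j g \<le> \<Lambda> j h"
    and compl: "\<And>j A. \<Lambda> j (indicator (- A)) = 1 - \<Lambda> j (indicator A)"
    and conv: "\<And>g. g \<in> cont_space \<Longrightarrow> ((\<lambda>j. \<Lambda> j g) \<longlongrightarrow> (\<integral>x. g x \<partial>M)) G"
    and A: "A \<in> sets borel" "measure M (frontier A) = 0"
  shows "((\<lambda>j. \<Lambda> j (indicator A)) \<longlongrightarrow> measure M A) G"
proof -
  interpret prob_space M by fact
  have space: "space M = UNIV" using sets_eq_imp_space_eq[OF M(2)] by simp
  have upper: "eventually (\<lambda>j. \<Lambda> j (indicator B) < measure M (closure B) + e) G" if e: "0 < e" for e B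
  proof -
    let ?g = "\<lambda>k x. 1 - min 1 (real k * depth (- closure B) x)"
    have "eventually (\<lambda>k. (\<integral>x. ?g k x \<partial>M) < measure M (closure B) + e) sequentially"
      using closed_approx_integral[OF M closed_closure[of B]] e by (intro order_tendstoD(2)) auto
    then obtain k where k: "(\<integral>x. ?g k x \<partial>M) < measure M (closure B) + e"
      by (auto simp: eventually_sequentially)
    have "?g k \<in> cont_space"
      unfolding cont_space_def by (auto intro!: continuous_intros continuous_on_depth)
    then have "eventually (\<lambda>j. \<Lambda> j (?g k) < measure M (closure B) + e) G"
      using conv k by (intro order_tendstoD(2)) auto
    moreover have "\<Lambda> j (indicator B) \<le> \<Lambda> j (?g k)" for j
    proof (rule mono)
      fix x
      show "indicator B x \<le> ?g k x"
      proof (cases "x \<in> B")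
        case True
        then have "x \<in> closure B" using closure_subset by blast
        then have "depth (- closure B) x = 0" by (intro depth_eq_0) auto
        then show ?thesis using True by simp
      qed simp
    qed
    ultimately show ?thesis by (auto elim!: eventually_mono intro: le_less_trans)
  qed
  have fr: "frontier A \<in> sets M" "closure A \<in> sets M" "interior A \<in> sets M" "A \<in> sets M"
    using M(2) A(1) by auto
  have cl: "measure M (closure A) = measure M A"
  proof (rule antisym)
    have "measure M (closure A) \<le> measure M (A \<union> frontier A)"
      using fr closure_subset[of A] interior_subset[of A] by (intro finite_measure_mono) (auto simp: frontier_def)
    also have "\<dots> \<le> measure M A + measure M (frontier A)" using fr by (intro measure_Un_le)
    finally show "measure M (closure A) \<le> measure M A" using A(2) by simp
    show "measure M A \<le> measure M (closure A)" using fr closure_subset[of A] by (intro finite_measure_mono)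
  qed
  have "measure M (closure (- A)) = 1 - measure M (interior A)"
  proof -
    have "closure (- A) = space M - interior A"
      by (simp add: closure_complement space Compl_eq_Diff_UNIV[of "interior A"])
    then show ?thesis using fr prob_compl[of "interior A"] by (simp only:)
  qed
  moreover have "measure M A \<le> measure M (interior A)"
  proof -
    have "measure M A \<le> measure M (interior A \<union> frontier A)"
      using fr closure_subset[of A] by (intro finite_measure_mono) (auto simp: frontier_def)
    also have "\<dots> \<le> measure M (interior A) + measure M (frontier A)" using fr by (intro measure_Un_le)
    finally show ?thesis using A(2) by simp
  qed
  ultimately have cl': "measure M (closure (- A)) \<le> 1 - measure M A" by simp
  show ?thesis
  proof (rule order_tendstoI)
    fix a assume a: "measure M A < a"
    then show "eventually (\<lambda>j. \<Lambda> j (indicator A) < a) G"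
      using upper[of "a - measure M A" A] cl by simp
  next
    fix a assume a: "a < measure M A"
    have "eventually (\<lambda>j. \<Lambda> j (indicator (- A)) < measure M (closure (- A)) + (measure M A - a)) G"
      using a by (intro upper) simp
    then show "eventually (\<lambda>j. a < \<Lambda> j (indicator A)) G"
    proof (rule eventually_mono)
      fix j assume "\<Lambda> j (indicator (- A)) < measure M (closure (- A)) + (measure M A - a)"
      then show "a < \<Lambda> j (indicator A)" using compl[of j A] cl' by linarith
    qed
  qed
qed

section \<open>Continuity sets of an invariant measure\<close>

definition null_frontier :: "'a::metric_space measure \<Rightarrow> 'a set \<Rightarrow> bool" where
  "null_frontier M A \<longleftrightarrow> A \<in> sets borel \<and> measure M (frontier A) = 0"

context invariant_system
begin

lemma measure_subset_null:
  assumes "measure M B = 0" "A \<subseteq> B" "B \<in> sets M"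
  shows "measure M A = 0"
proof -
  have "measure M A \<le> measure M B" using assms by (intro finite_measure_mono)
  then show ?thesis using assms(1) measure_nonneg[of M A] by linarith
qed

lemma null_frontier_UNIV: "null_frontier M UNIV"
  by (simp add: null_frontier_def)

lemma null_frontier_empty: "null_frontier M {}"
  by (simp add: null_frontier_def)

lemma null_frontier_Compl: "null_frontier M A \<Longrightarrow> null_frontier M (- A)"
  by (simp add: null_frontier_def frontier_complement borel_comp)

lemma null_frontier_Int:
  assumes "null_frontier M A" "null_frontier M B"
  shows "null_frontier M (A \<inter> B)"
proof -
  have "frontier A \<in> sets M" "frontier B \<in> sets M" using sets_M by auto
  then have "measure M (frontier A \<union> frontier B) \<le> measure M (frontier A) + measure M (frontier B)"
    by (rule measure_Un_le)
  then have "measure M (frontier A \<union> frontier B) \<le> 0"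
    using assms by (simp add: null_frontier_def)
  then have "measure M (frontier A \<union> frontier B) = 0" by (rule antisym) simp
  then have "measure M (frontier (A \<inter> B)) = 0"
    by (rule measure_subset_null) (use sets_M frontier_Int_subset[of A B] in auto)
  then show ?thesis using assms by (simp add: null_frontier_def sets.Int)
qed

lemma null_frontier_INT:
  assumes "finite I" "\<And>i. i \<in> I \<Longrightarrow> null_frontier M (A i)"
  shows "null_frontier M (\<Inter>i\<in>I. A i)"
  using assms by (induction I) (auto intro: null_frontier_UNIV null_frontier_Int)

text \<open>By continuity the frontier of a preimage lies in the preimage of the frontier, and
  invariance makes the latter null.\<close>

lemma null_frontier_iterate:
  assumes "null_frontier M A"
  shows "null_frontier M ((T ^^ i) -` A)"
proof -
  let ?S = "T ^^ i"
  note cont = continuous_iterate[of UNIV i]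
  have "closure (?S -` A) \<subseteq> ?S -` closure A"
    using closure_subset[of A] by (intro closure_minimal closed_vimage cont) auto
  moreover have "?S -` interior A \<subseteq> interior (?S -` A)"
    using interior_subset[of A] by (intro interior_maximal open_vimage cont) auto
  ultimately have sub: "frontier (?S -` A) \<subseteq> ?S -` frontier A"
    unfolding frontier_def by blast
  have "frontier A \<in> sets M" using sets_M by simp
  then have "measure M (?S -` frontier A) = 0"
    using measure_iterate[of "frontier A" i] assms by (simp add: null_frontier_def)
  then have "measure M (frontier (?S -` A)) = 0"
    by (rule measure_subset_null[OF _ sub])
      (use measurable_sets[OF measurable_iterate \<open>frontier A \<in> sets M\<close>, of i] in \<open>simp add: space_UNIV\<close>)
  moreover have "?S -` A \<in> sets borel"
    using measurable_sets[OF measurable_iterate, of A i] assms sets_M space_UNIV by (simp add: null_frontier_def)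
  ultimately show ?thesis by (simp add: null_frontier_def)
qed

lemma null_frontier_word:
  assumes "\<And>l. null_frontier M (c -` {l})"
  shows "null_frontier M (word T c q -` {v})"
proof (cases "length v = q")
  case True
  then have "word T c q -` {v} = (\<Inter>i\<in>{..<q}. (T ^^ i) -` (c -` {v ! i}))"
    by (auto simp: word_eq_iff)
  then show ?thesis using assms by (simp only: null_frontier_INT null_frontier_iterate finite_lessThan)
next
  case False
  then have "word T c q -` {v} = {}" by (auto simp: word_eq_iff)
  then show ?thesis by (simp add: null_frontier_empty)
qed

text \<open>Spheres around \<open>x\<close> with different radii are disjoint, so only countably
  many of them have positive mass; the frontier of a ball lies in such a sphere.\<close>

lemma null_sphere:
  assumes "0 < e"
  shows "\<exists>r>0. r < e \<and> null_frontier M (ball x r)"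
proof -
  have dm: "dist x \<in> borel_measurable M"
    by (simp add: measurable_cong_sets[OF sets_M refl] borel_measurable_continuous_onI continuous_intros)
  interpret D: prob_space "distr M borel (dist x)" by (rule prob_space_distr[OF dm])
  have "countable {r. measure (distr M borel (dist x)) {r} \<noteq> 0}" by (rule D.countable_support)
  moreover have "uncountable {0<..<e}" using assms by (simp add: uncountable_open_interval)
  ultimately have "\<not> {0<..<e} \<subseteq> {r. measure (distr M borel (dist x)) {r} \<noteq> 0}"
    using countable_subset by blast
  then obtain r where r: "0 < r" "r < e" "measure (distr M borel (dist x)) {r} = 0" by auto
  have "measure M (dist x -` {r}) = 0"
    using r(3) measure_distr[OF dm, of "{r}"] by (simp add: space_UNIV)
  moreover have "frontier (ball x r) \<subseteq> dist x -` {r}"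
  proof -
    have "closure (ball x r) \<subseteq> cball x r" by (intro closure_minimal ball_subset_cball closed_cball)
    then show ?thesis by (auto simp: frontier_def interior_open)
  qed
  moreover have "dist x -` {r} \<in> sets M"
    using measurable_sets[OF dm, of "{r}"] by (simp add: space_UNIV)
  ultimately have "measure M (frontier (ball x r)) = 0" by (rule measure_subset_null)
  then show ?thesis using r by (intro exI[of _ r]) (simp add: null_frontier_def)
qed

text \<open>Supplies the partition for Misiurewicz's argument: cells small enough for itineraries to
  distinguish separated points, with null frontiers so that their weights converge.\<close>

lemma null_frontier_labelling:
  assumes "compact (UNIV :: 'a set)" "0 < e"
  shows "\<exists>c :: 'a \<Rightarrow> 'a set. finite (range c) \<and> (\<forall>x y. c x = c y \<longrightarrow> dist x y \<le> e) \<and> (\<forall>l. null_frontier M (c -` {l}))"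
proof -
  have "\<exists>r. 0 < r \<and> r < e / 2 \<and> null_frontier M (ball x r)" for x
    using null_sphere[of "e / 2" x] assms(2) by simp
  then obtain r where r: "\<And>x. 0 < r x" "\<And>x. r x < e / 2" "\<And>x. null_frontier M (ball x (r x))" by metis
  have "x \<in> ball x (r x)" for x using r(1) by simp
  then have cov: "(UNIV :: 'a set) \<subseteq> (\<Union>x. ball x (r x))" by blast
  have "\<exists>I. finite I \<and> (UNIV :: 'a set) \<subseteq> (\<Union>x\<in>I. ball x (r x))"
    by (rule compact_finite_subcover[where U = "\<lambda>x. ball x (r x)", OF assms(1) open_ball cov])
  then obtain I where "finite I \<and> (UNIV :: 'a set) \<subseteq> (\<Union>x\<in>I. ball x (r x))" ..
  note I = conjunct1[OF this] conjunct2[OF this]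
  \<comment> \<open>A point is labelled by the set of balls that contain it. Two points with the
    same label share a ball of radius below e/2, and each nonempty fibre is a finite intersection of
    balls and complements of balls.\<close>
  define c where "c y = {x \<in> I. y \<in> ball x (r x)}" for y
  have "range c \<subseteq> Pow I" by (auto simp: c_def)
  then have "finite (range c)" using I(1) finite_subset by blast
  moreover have "dist y z \<le> e" if "c y = c z" for y z
  proof -
    obtain x where "x \<in> I" "y \<in> ball x (r x)" using I(2) by blast
    then have "x \<in> c y" by (simp add: c_def)
    then have "dist x y < r x" "dist x z < r x" using that by (auto simp: c_def)
    then show ?thesis using dist_triangle3[of y z x] r(2)[of x] by simp
  qed
  moreover have "null_frontier M (c -` {l})" for l
  proof (cases "l \<subseteq> I")
    case True
    have "c -` {l} = (\<Inter>x\<in>I. if x \<in> l then ball x (r x) else - ball x (r x))"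
    proof (rule set_eqI)
      fix y
      have "y \<in> c -` {l} \<longleftrightarrow> (\<forall>x\<in>I. x \<in> l \<longleftrightarrow> y \<in> ball x (r x))"
        unfolding c_def using True by blast
      also have "\<dots> \<longleftrightarrow> y \<in> (\<Inter>x\<in>I. if x \<in> l then ball x (r x) else - ball x (r x))"
        unfolding INT_iff by (rule ball_cong[OF refl]) simp
      finally show "y \<in> c -` {l} \<longleftrightarrow> y \<in> (\<Inter>x\<in>I. if x \<in> l then ball x (r x) else - ball x (r x))" .
    qed
    moreover have "null_frontier M (\<Inter>x\<in>I. if x \<in> l then ball x (r x) else - ball x (r x))"
      using r(3) by (intro null_frontier_INT I(1)) (simp add: null_frontier_Compl)
    ultimately show ?thesis by simp
  next
    case False
    then have "c -` {l} = {}" by (auto simp: c_def)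
    then show ?thesis by (simp add: null_frontier_empty)
  qed
  ultimately show ?thesis by (intro exI[of _ c]) simp
qed

end

context compact_system
begin

text \<open>
  Compactness comes from Tychonoff's theorem for functionals, so the filter \<open>G\<close> replaces a
  convergent subsequence and no separability of the space of continuous functions is needed.
\<close>

lemma orbit_average_limit:
  assumes n: "filterlim n at_top sequentially" "\<And>j. 0 < n j" and E: "\<And>j. finite (E j)" "\<And>j. E j \<noteq> {}"
  shows "\<exists>\<nu> G. \<nu> \<in> invariant_measures T \<and>
    (\<forall>A e. A \<in> sets borel \<longrightarrow> 0 < e \<longrightarrow> (\<exists>U. open U \<and> A \<subseteq> U \<and> measure \<nu> U < measure \<nu> A + e)) \<and>
    G \<le> sequentially \<and> G \<noteq> bot \<and>
    (\<forall>g\<in>cont_space. ((\<lambda>j. orbit_average T (f j) (n j) (E j) g) \<longlongrightarrow> (\<integral>x. g x \<partial>\<nu>)) G)"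
proof -
  let ?\<Lambda> = "\<lambda>j. orbit_average T (f j) (n j) (E j)"
  have "\<exists>B. \<forall>x. \<bar>g x\<bar> \<le> B" if "g \<in> cont_space" for g :: "'a \<Rightarrow> real"
    using compact_bounded_continuous[OF compact_UNIV that] by metis
  then obtain B where B: "\<And>g x. g \<in> cont_space \<Longrightarrow> \<bar>g x\<bar> \<le> B (g :: 'a \<Rightarrow> real)" by metis
  \<comment> \<open>\<open>cluster_filter\<close> asks for a bound at every index, while
    discontinuous functions may be unbounded; they are sent to 0.\<close>
  define F where "F j g = (if g \<in> cont_space then ?\<Lambda> j g else 0)" for j g
  have "\<bar>F j g\<bar> \<le> (if g \<in> cont_space then B g else 0)" for j g
    using orbit_average_abs_le[OF E n(2), of g "B g"] B[of g] by (auto simp: F_def)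
  from cluster_filter[of F, OF this] obtain G L where GL: "G \<le> sequentially" "G \<noteq> bot"
    "\<And>g. ((\<lambda>j. F j g) \<longlongrightarrow> L g) G" by auto
  have conv: "((\<lambda>j. ?\<Lambda> j g) \<longlongrightarrow> L g) G" if "g \<in> cont_space" for g
    using GL(3)[of g] that by (simp add: F_def)
  have uniq: "L g = a" if "g \<in> cont_space" "((\<lambda>j. ?\<Lambda> j g) \<longlongrightarrow> a) G" for g a
    using tendsto_unique[OF GL(2) conv[OF that(1)] that(2)] .
  interpret L: positive_functional L
  proof
    show "compact (UNIV :: 'a set)" by (rule compact_UNIV)
    show "L (\<lambda>x. g x + h x) = L g + L h" if "g \<in> cont_space" "h \<in> cont_space" for g h
      using that tendsto_add[OF conv conv, of g h]
      by (intro uniq) (auto simp: orbit_average_add[OF E n(2)] cont_space_def intro!: continuous_intros)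
    show "L (\<lambda>x. a * g x) = a * L g" if "g \<in> cont_space" for g a
      using that tendsto_mult_left[OF conv, of g a]
      by (intro uniq) (auto simp: orbit_average_scale[OF E n(2)] cont_space_def intro!: continuous_intros)
    show "0 \<le> L g" if "g \<in> cont_space" "\<And>x. 0 \<le> g x" for g
    proof (rule tendsto_lowerbound[OF conv[OF that(1)] _ GL(2)])
      have "0 \<le> ?\<Lambda> j g" for j
      proof -
        have "?\<Lambda> j (\<lambda>_. 0) \<le> ?\<Lambda> j g" by (rule orbit_average_mono[OF E n(2) that(2)])
        then show ?thesis by (simp add: orbit_average_const[OF E n(2)])
      qed
      then show "eventually (\<lambda>j. 0 \<le> ?\<Lambda> j g) G" by simp
    qed
    show "L (\<lambda>_. 1) = 1"
      by (rule uniq) (simp_all add: cont_space_def orbit_average_one[OF E n(2)])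
  qed
  let ?\<nu> = "L.riesz_measure"
  have inv: "L (\<lambda>x. g (T x)) = L g" if g: "g \<in> cont_space" for g
  proof -
    have gT: "(\<lambda>x. g (T x)) \<in> cont_space"
      using g continuous_T unfolding cont_space_def by (auto intro: continuous_on_compose2)
    have "((\<lambda>j. ?\<Lambda> j (\<lambda>x. g (T x)) - ?\<Lambda> j g) \<longlongrightarrow> 0) G"
    proof (rule Lim_null_comparison)
      show "eventually (\<lambda>j. norm (?\<Lambda> j (\<lambda>x. g (T x)) - ?\<Lambda> j g) \<le> 2 * B g / n j) G"
        using orbit_average_shift[OF E n(2), of g "B g"] B[OF g] by simp
      have "((\<lambda>j. 2 * B g / real (n j)) \<longlongrightarrow> 0) sequentially"
        using filterlim_compose[OF lim_const_over_n[of "2 * B g"] n(1)] by simp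
      then show "((\<lambda>j. 2 * B g / real (n j)) \<longlongrightarrow> 0) G" by (rule tendsto_mono[OF GL(1)])
    qed
    moreover have "((\<lambda>j. ?\<Lambda> j (\<lambda>x. g (T x)) - ?\<Lambda> j g) \<longlongrightarrow> L (\<lambda>x. g (T x)) - L g) G"
      by (intro tendsto_diff conv g gT)
    ultimately show ?thesis using tendsto_unique[OF GL(2)] by fastforce
  qed
  have T_meas: "T \<in> measurable ?\<nu> borel"
    using borel_measurable_continuous_onI[OF continuous_T]
    by (simp add: measurable_cong_sets[OF L.sets_riesz_measure refl])
  have "distr ?\<nu> borel T = ?\<nu>"
  proof (rule measure_eqI_continuous)
    show "prob_space (distr ?\<nu> borel T)"
      by (rule prob_space.prob_space_distr[OF L.prob_space_riesz_measure T_meas])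
    fix g :: "'a \<Rightarrow> real" assume g: "g \<in> cont_space"
    then have "(\<integral>x. g x \<partial>distr ?\<nu> borel T) = (\<integral>x. g (T x) \<partial>?\<nu>)"
      using borel_measurable_continuous_onI[of g] by (intro integral_distr[OF T_meas]) (simp add: cont_space_def)
    also have "\<dots> = L (\<lambda>x. g (T x))"
      using g continuous_T unfolding cont_space_def
      by (intro L.L_eq_integral[symmetric]) (auto simp: cont_space_def intro: continuous_on_compose2)
    also have "\<dots> = (\<integral>x. g x \<partial>?\<nu>)" using inv[OF g] L.L_eq_integral[OF g] by simp
    finally show "(\<integral>x. g x \<partial>distr ?\<nu> borel T) = (\<integral>x. g x \<partial>?\<nu>)" .
  qed (simp_all add: L.prob_space_riesz_measure L.sets_riesz_measure)
  then have "?\<nu> \<in> invariant_measures T"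
    by (simp add: invariant_measures_def L.prob_space_riesz_measure L.sets_riesz_measure)
  moreover have "\<exists>U. open U \<and> A \<subseteq> U \<and> measure ?\<nu> U < measure ?\<nu> A + e" if "A \<in> sets borel" "0 < e" for A e
    using L.riesz_measure_outer_regular[OF that] by metis
  moreover have "\<forall>g\<in>cont_space. ((\<lambda>j. ?\<Lambda> j g) \<longlongrightarrow> (\<integral>x. g x \<partial>?\<nu>)) G"
    using conv by (simp add: L.L_eq_integral[symmetric])
  ultimately show ?thesis using GL(1,2) by (intro exI[of _ ?\<nu>] exI[of _ G]) simp
qed

text \<open>For fixed \<open>q\<close> the inequality \<open>weight_sum_entropy_bound\<close> is
  passed to the limit along \<open>G\<close>: the entropies converge because the fibres of words
  have null frontiers, the boundary term vanishes, and \<open>f j\<close> may be exchanged for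
  \<open>\<phi>\<close> by uniform convergence. The resulting bound holds for every
  \<open>q\<close>, which is what \<open>measure_entropy_ge\<close> asks for.\<close>

lemma misiurewicz:
  assumes n: "filterlim n at_top sequentially" "\<And>j. 0 < n j" and E: "\<And>j. E j \<noteq> {}"
    and e: "0 < e" and sep: "\<And>j. separated T (n j) e (E j)" and \<phi>: "\<phi> \<in> cont_space"
    and close: "\<And>h. 0 < h \<Longrightarrow> eventually (\<lambda>j. \<forall>x. \<bar>f j x - \<phi> x\<bar> \<le> h) sequentially"
    and lower: "\<And>h. 0 < h \<Longrightarrow> eventually (\<lambda>j. P - h < ln (weight_sum T (f j) (n j) (E j)) / n j) sequentially"
  shows "\<exists>\<nu>\<in>invariant_measures T.
    (\<forall>A e. A \<in> sets borel \<longrightarrow> 0 < e \<longrightarrow> (\<exists>U. open U \<and> A \<subseteq> U \<and> measure \<nu> U < measure \<nu> A + e)) \<and>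
    ereal (P - (\<integral>x. \<phi> x \<partial>\<nu>)) \<le> measure_entropy \<nu> T \<and>
    (\<forall>g\<in>cont_space. \<forall>h>0. \<exists>\<^sub>F j in sequentially. \<bar>orbit_average T (f j) (n j) (E j) g - (\<integral>x. g x \<partial>\<nu>)\<bar> < h)"
proof -
  let ?\<Lambda> = "\<lambda>j. orbit_average T (f j) (n j) (E j)"
  have fin: "finite (E j)" for j using card_separated_le[OF e] sep n(2) by metis
  obtain \<nu> G where "\<nu> \<in> invariant_measures T \<and>
    (\<forall>A e. A \<in> sets borel \<longrightarrow> 0 < e \<longrightarrow> (\<exists>U. open U \<and> A \<subseteq> U \<and> measure \<nu> U < measure \<nu> A + e)) \<and>
    G \<le> sequentially \<and> G \<noteq> bot \<and>
    (\<forall>g\<in>cont_space. ((\<lambda>j. ?\<Lambda> j g) \<longlongrightarrow> (\<integral>x. g x \<partial>\<nu>)) G)"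
    using orbit_average_limit[of n E f, OF n fin E] by auto
  then have inv: "\<nu> \<in> invariant_measures T"
    and reg: "\<forall>A e. A \<in> sets borel \<longrightarrow> 0 < e \<longrightarrow> (\<exists>U. open U \<and> A \<subseteq> U \<and> measure \<nu> U < measure \<nu> A + e)"
    and G: "G \<le> sequentially" "G \<noteq> bot"
    and conv: "\<And>g. g \<in> cont_space \<Longrightarrow> ((\<lambda>j. ?\<Lambda> j g) \<longlongrightarrow> (\<integral>x. g x \<partial>\<nu>)) G"
    by simp_all
  interpret I: invariant_system T \<nu> using continuous_T inv by unfold_locales
  \<comment> \<open>Convergence along the finer filter \<open>G\<close> is weakened to a statement
    about infinitely many indices, enough to pick one of them later.\<close>
  have freq: "\<exists>\<^sub>F j in sequentially. \<bar>?\<Lambda> j g - (\<integral>x. g x \<partial>\<nu>)\<bar> < h" if "g \<in> cont_space" "0 < h" for g h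
  proof -
    have "eventually (\<lambda>j. \<bar>?\<Lambda> j g - (\<integral>x. g x \<partial>\<nu>)\<bar> < h) G"
      using tendstoD[OF conv[OF that(1)] that(2)] by (simp add: dist_real_def)
    then have "\<exists>\<^sub>F j in G. \<bar>?\<Lambda> j g - (\<integral>x. g x \<partial>\<nu>)\<bar> < h" by (rule eventually_frequently[OF G(2)])
    then show ?thesis using G(1) by (auto simp: frequently_def le_filter_def)
  qed
  obtain c :: "'a \<Rightarrow> 'a set" where "finite (range c) \<and> (\<forall>x y. c x = c y \<longrightarrow> dist x y \<le> e) \<and> (\<forall>l. null_frontier \<nu> (c -` {l}))"
    using I.null_frontier_labelling[OF compact_UNIV e] ..
  then have c: "finite (range c)" "\<And>x y. c x = c y \<Longrightarrow> dist x y \<le> e" "\<And>l. null_frontier \<nu> (c -` {l})" by simp_all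
  have sc: "simple_function \<nu> c"
    using c(1,3) I.sets_M by (simp add: simple_function_def I.space_UNIV null_frontier_def)
  have entropy: "P - (\<integral>x. \<phi> x \<partial>\<nu>) \<le> label_entropy \<nu> (word T c q) / q" if q: "0 < q" for q
  proof -
    let ?W = "word T c q"
    have sW: "simple_function \<nu> ?W" by (rule simple_function_word) (rule I.simple_function_iterate[OF sc])
    have ind: "((\<lambda>j. ?\<Lambda> j (indicator (?W -` {v}))) \<longlongrightarrow> label_prob \<nu> ?W v) G" for v
      unfolding label_prob_def
    proof (rule portmanteau_continuity_set)
      show "prob_space \<nu>" by unfold_locales
      show "sets \<nu> = sets borel" by (rule I.sets_M)
      show "?\<Lambda> j g \<le> ?\<Lambda> j h" if "\<And>x. g x \<le> h x" for j g h
        by (rule orbit_average_mono[OF fin E n(2) that])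
      show "?\<Lambda> j (indicator (- A)) = 1 - ?\<Lambda> j (indicator A)" for j A
      proof -
        have "(\<lambda>_. 1) = (\<lambda>x. indicator A x + indicator (- A) x :: real)" by (auto simp: indicator_def)
        then show ?thesis
          using orbit_average_add[OF fin E n(2), where g = "indicator A" and h = "indicator (- A)"]
            orbit_average_one[OF fin E n(2)] by (metis add_diff_cancel_left')
      qed
      show "?W -` {v} \<in> sets borel" "measure \<nu> (frontier (?W -` {v})) = 0"
        using I.null_frontier_word[of c q v, OF c(3)] by (simp_all add: null_frontier_def)
    qed (rule conv)
    have ind_bnd: "0 \<le> ?\<Lambda> j (indicator A)" "?\<Lambda> j (indicator A) \<le> 1" for j A
    proof -
      show "0 \<le> ?\<Lambda> j (indicator A)"
      proof -
        have "?\<Lambda> j (\<lambda>_. 0) \<le> ?\<Lambda> j (indicator A)" by (rule orbit_average_mono[OF fin E n(2)]) simp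
        then show ?thesis by (simp add: orbit_average_const[OF fin E n(2)])
      qed
      show "?\<Lambda> j (indicator A) \<le> 1"
      proof -
        have "?\<Lambda> j (indicator A) \<le> ?\<Lambda> j (\<lambda>_. 1)"
          by (rule orbit_average_mono[OF fin E n(2)]) (simp add: indicator_def)
        then show ?thesis by (simp add: orbit_average_one[OF fin E n(2)])
      qed
    qed
    let ?H = "\<lambda>j. \<Sum>v\<in>range ?W. - ?\<Lambda> j (indicator (?W -` {v})) * ln (?\<Lambda> j (indicator (?W -` {v})))"
    have H: "(?H \<longlongrightarrow> label_entropy \<nu> ?W) G"
      unfolding label_entropy_def by (intro tendsto_sum tendsto_neg_xlnx ind ind_bnd G(2))
    have gap: "((\<lambda>j. 2 * real q * ln (card (range c)) / n j) \<longlongrightarrow> 0) G"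
      using filterlim_compose[OF lim_const_over_n[of "2 * real q * ln (card (range c))"] n(1)]
      by (intro tendsto_mono[OF G(1)]) simp
    have pot: "((\<lambda>j. ?\<Lambda> j (f j)) \<longlongrightarrow> (\<integral>x. \<phi> x \<partial>\<nu>)) G"
    proof -
      have "((\<lambda>j. ?\<Lambda> j (f j) - ?\<Lambda> j \<phi>) \<longlongrightarrow> 0) G"
      proof (rule tendsto_mono[OF G(1)], rule LIMSEQ_I)
        fix h :: real assume h: "0 < h"
        have "eventually (\<lambda>j. \<forall>x. \<bar>f j x - \<phi> x\<bar> \<le> h / 2) sequentially" using close[of "h / 2"] h by simp
        then have "eventually (\<lambda>j. norm (?\<Lambda> j (f j) - ?\<Lambda> j \<phi> - 0) < h) sequentially"
        proof (rule eventually_mono)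
          fix j assume "\<forall>x. \<bar>f j x - \<phi> x\<bar> \<le> h / 2"
          then have "\<bar>?\<Lambda> j (\<lambda>x. f j x + (- 1) * \<phi> x)\<bar> \<le> h / 2"
            by (intro orbit_average_abs_le[OF fin E n(2)]) simp
          also have "?\<Lambda> j (\<lambda>x. f j x + (- 1) * \<phi> x) = ?\<Lambda> j (f j) + (- 1) * ?\<Lambda> j \<phi>"
            by (simp only: orbit_average_add[OF fin E n(2)] orbit_average_scale[OF fin E n(2)])
          finally show "norm (?\<Lambda> j (f j) - ?\<Lambda> j \<phi> - 0) < h" using h by simp
        qed
        then show "\<exists>N. \<forall>j\<ge>N. norm (?\<Lambda> j (f j) - ?\<Lambda> j \<phi> - 0) < h" by (simp add: eventually_sequentially)
      qed
      from tendsto_add[OF this conv[OF \<phi>]] show ?thesis by simp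
    qed
    have upper: "ln (weight_sum T (f j) (n j) (E j)) / n j \<le> ?H j / q + 2 * real q * ln (card (range c)) / n j + ?\<Lambda> j (f j)" for j
      by (rule weight_sum_entropy_bound[OF fin E n(2) c(1) separated_word_inj_on[OF sep n(2) c(2)] q])
    have lim: "((\<lambda>j. ?H j / q + 2 * real q * ln (card (range c)) / n j + ?\<Lambda> j (f j))
        \<longlongrightarrow> label_entropy \<nu> ?W / q + 0 + (\<integral>x. \<phi> x \<partial>\<nu>)) G"
      using q by (intro tendsto_add tendsto_divide H gap pot tendsto_const) simp
    have "P \<le> label_entropy \<nu> ?W / q + (\<integral>x. \<phi> x \<partial>\<nu>)"
    proof (rule field_le_epsilon)
      fix h :: real assume h: "0 < h"
      have "eventually (\<lambda>j. P - h < ln (weight_sum T (f j) (n j) (E j)) / n j) G"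
        using lower[OF h] G(1) by (simp add: le_filter_def)
      then have "eventually (\<lambda>j. P - h \<le> ?H j / q + 2 * real q * ln (card (range c)) / n j + ?\<Lambda> j (f j)) G"
        by (rule eventually_mono) (use upper in \<open>meson less_imp_le order_trans\<close>)
      from tendsto_lowerbound[OF lim this G(2)] show "P \<le> label_entropy \<nu> ?W / q + (\<integral>x. \<phi> x \<partial>\<nu>) + h" by simp
    qed
    then show ?thesis by simp
  qed
  have "ereal (P - (\<integral>x. \<phi> x \<partial>\<nu>)) \<le> measure_entropy \<nu> T"
    by (rule I.measure_entropy_ge[OF sc entropy])
  then show ?thesis using inv reg freq by blast
qed

end

section \<open>Differentiability of the pressure\<close>

text \<open>The logarithm of the weight sum is convex in \<open>t\<close>, and the bound uses its
  slope at the endpoint \<open>t\<close>, which is an average for the perturbed potential. Jensen's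
  inequality appears as the tangent inequality for exp at \<open>m\<close>, the Gibbs mean of the
  Birkhoff sums of \<open>- t * \<psi>\<close>.\<close>

lemma weight_sum_tangent:
  assumes E: "finite E" "E \<noteq> {}" and n: "0 < n"
  shows "ln (weight_sum T (\<lambda>x. f x + t * \<psi> x) n E) - ln (weight_sum T f n E)
    \<le> n * (t * orbit_average T (\<lambda>x. f x + t * \<psi> x) n E \<psi>)"
proof -
  define g where "g = (\<lambda>x. f x + t * \<psi> x)"
  let ?S = "birkhoff_sum T g n" and ?R = "birkhoff_sum T \<psi> n"
  define Z where "Z = weight_sum T g n E"
  define m where "m = - (t * (n * orbit_average T g n E \<psi>))"
  have Z: "0 < Z" unfolding Z_def by (rule weight_sum_pos[OF E n])
  have f_eq: "birkhoff_sum T f n x = ?S x - t * ?R x" for x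
    by (simp add: birkhoff_sum_def g_def sum.distrib sum_distrib_left)
  have avg: "(\<Sum>x\<in>E. exp (?S x) * ?R x) = n * orbit_average T g n E \<psi> * Z"
    using Z n by (simp add: orbit_average_def Z_def)
  have "exp m * Z = (\<Sum>x\<in>E. exp (?S x) * (exp m * (1 - t * ?R x - m)))"
  proof -
    have "(\<Sum>x\<in>E. exp (?S x) * (exp m * (1 - t * ?R x - m)))
        = exp m * ((1 - m) * (\<Sum>x\<in>E. exp (?S x)) - t * (\<Sum>x\<in>E. exp (?S x) * ?R x))"
      by (simp add: sum_distrib_left sum_subtractf[symmetric] algebra_simps)
    also have "\<dots> = exp m * ((1 - m) * Z + m * Z)"
      unfolding avg by (simp add: Z_def weight_sum_def m_def)
    finally show ?thesis by (simp add: algebra_simps)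
  qed
  also have "\<dots> \<le> weight_sum T f n E"
    unfolding weight_sum_def
  proof (rule sum_mono)
    fix x
    have "exp m * (1 - t * ?R x - m) \<le> exp m * exp (- (t * ?R x) - m)"
    proof (rule mult_left_mono)
      show "1 - t * ?R x - m \<le> exp (- (t * ?R x) - m)"
        using exp_ge_add_one_self[of "- (t * ?R x) - m"] by linarith
    qed simp
    also have "\<dots> = exp (- (t * ?R x))" by (simp flip: exp_add)
    finally have "exp (?S x) * (exp m * (1 - t * ?R x - m)) \<le> exp (?S x) * exp (- (t * ?R x))"
      by (rule mult_left_mono) simp
    then show "exp (?S x) * (exp m * (1 - t * ?R x - m)) \<le> exp (birkhoff_sum T f n x)"
      by (simp add: f_eq flip: exp_add)
  qed
  finally have "ln (exp m * Z) \<le> ln (weight_sum T f n E)" using Z by (intro ln_mono) auto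
  then have "m + ln Z \<le> ln (weight_sum T f n E)" using Z by (simp add: ln_mult)
  then show ?thesis by (simp add: m_def Z_def g_def mult.left_commute)
qed

text \<open>Cauchy-Schwarz for the square roots of the weights of \<open>f + h\<close> and
  \<open>f - h\<close>: log-convexity at the midpoint.\<close>

lemma weight_sum_midpoint:
  "(weight_sum T f n E)\<^sup>2 \<le> weight_sum T (\<lambda>x. f x + h x) n E * weight_sum T (\<lambda>x. f x - h x) n E"
proof -
  let ?a = "\<lambda>x. exp ((birkhoff_sum T f n x + birkhoff_sum T h n x) / 2)"
  let ?b = "\<lambda>x. exp ((birkhoff_sum T f n x - birkhoff_sum T h n x) / 2)"
  have "?a x * ?b x = exp (birkhoff_sum T f n x)" for x
    by (simp flip: exp_add add: field_simps)
  moreover have "(?a x)\<^sup>2 = exp (birkhoff_sum T (\<lambda>x. f x + h x) n x)" for x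
    by (simp add: power2_eq_square birkhoff_sum_def sum.distrib flip: exp_add)
  moreover have "(?b x)\<^sup>2 = exp (birkhoff_sum T (\<lambda>x. f x - h x) n x)" for x
    by (simp add: power2_eq_square birkhoff_sum_def sum_subtractf flip: exp_add)
  ultimately show ?thesis
    using Cauchy_Schwarz_ineq_sum[of ?a ?b E] by (simp add: weight_sum_def)
qed

text \<open>What the later arguments retain of expansiveness: one scale \<open>c\<close> that
  computes the pressure of every continuous potential.\<close>

locale pressure_system = compact_system T for T :: "'a::metric_space \<Rightarrow> 'a" +
  fixes c :: real
  assumes c_pos: "0 < c"
    and pressure_scale: "f \<in> cont_space \<Longrightarrow> \<exists>P. pressure T f = ereal P \<and>
      (\<forall>e>0. \<forall>d>0. eventually (\<lambda>n. finite_pressure f n d < P + e) sequentially) \<and>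
      (\<forall>e>0. \<exists>\<^sub>F n in sequentially. P - e < finite_pressure f n c)"
begin

definition real_pressure :: "('a \<Rightarrow> real) \<Rightarrow> real" where
  "real_pressure f = real_of_ereal (pressure T f)"

lemma
  assumes f: "f \<in> cont_space"
  shows pressure_eq: "pressure T f = ereal (real_pressure f)"
    and eventually_finite_pressure: "0 < e \<Longrightarrow> 0 < d \<Longrightarrow> eventually (\<lambda>n. finite_pressure f n d < real_pressure f + e) sequentially"
    and frequently_finite_pressure: "0 < e \<Longrightarrow> \<exists>\<^sub>F n in sequentially. real_pressure f - e < finite_pressure f n c"
proof -
  obtain P where P: "pressure T f = ereal P \<and>
      (\<forall>e>0. \<forall>d>0. eventually (\<lambda>n. finite_pressure f n d < P + e) sequentially) \<and>
      (\<forall>e>0. \<exists>\<^sub>F n in sequentially. P - e < finite_pressure f n c)"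
    using pressure_scale[OF f] ..
  then have "real_pressure f = P" by (simp add: real_pressure_def)
  with P show "pressure T f = ereal (real_pressure f)"
    and "0 < e \<Longrightarrow> 0 < d \<Longrightarrow> eventually (\<lambda>n. finite_pressure f n d < real_pressure f + e) sequentially"
    and "0 < e \<Longrightarrow> \<exists>\<^sub>F n in sequentially. real_pressure f - e < finite_pressure f n c"
    by simp_all
qed

section \<open>Lipschitz continuity and convexity of the pressure\<close>

lemma real_pressure_le:
  assumes f: "f \<in> cont_space" and g: "g \<in> cont_space" and le: "\<And>x. f x \<le> g x + B"
  shows "real_pressure f \<le> real_pressure g + B"
proof (rule field_le_epsilon)
  fix e :: real assume e: "0 < e"
  have fin: "finite_pressure f n c \<le> finite_pressure g n c + B" if n: "0 < n" for n
  proof -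
    have "partition_sum T f n c \<le> exp (n * B) * partition_sum T g n c"
      unfolding partition_sum_weight[of f]
    proof (rule cSUP_least)
      show "{E. separated T n c E} \<noteq> {}" using separated_singleton by blast
      fix E assume "E \<in> {E. separated T n c E}"
      then have E: "separated T n c E" by simp
      have "weight_sum T f n E \<le> (\<Sum>x\<in>E. exp (n * B) * exp (birkhoff_sum T g n x))"
        unfolding weight_sum_def exp_add[symmetric]
      proof (intro sum_mono)
        fix x
        have "birkhoff_sum T f n x \<le> (\<Sum>k<n. g ((T ^^ k) x) + B)"
          unfolding birkhoff_sum_def by (intro sum_mono le)
        then show "exp (birkhoff_sum T f n x) \<le> exp (n * B + birkhoff_sum T g n x)"
          by (simp add: birkhoff_sum_def sum.distrib add.commute)
      qed
      also have "\<dots> = exp (n * B) * weight_sum T g n E" by (simp add: weight_sum_def sum_distrib_left)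
      also have "\<dots> \<le> exp (n * B) * partition_sum T g n c"
        by (intro mult_left_mono weight_sum_le_partition_sum c_pos n g E) simp
      finally show "weight_sum T f n E \<le> exp (n * B) * partition_sum T g n c" .
    qed
    then have "ln (partition_sum T f n c) \<le> ln (exp (n * B) * partition_sum T g n c)"
      using partition_sum_pos[OF c_pos n f] by (intro ln_mono) auto
    also have "\<dots> = n * B + ln (partition_sum T g n c)"
      using partition_sum_pos[OF c_pos n g] by (simp add: ln_mult)
    finally have "ln (partition_sum T f n c) / n \<le> (n * B + ln (partition_sum T g n c)) / n"
      by (rule divide_right_mono) simp
    then show ?thesis using n by (simp add: finite_pressure_def add_divide_distrib add.commute)
  qed
  have "\<exists>\<^sub>F n in sequentially. real_pressure f - e / 2 < finite_pressure f n c"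
    using e by (intro frequently_finite_pressure f) simp
  moreover have "eventually (\<lambda>n. finite_pressure g n c < real_pressure g + e / 2 \<and> 0 < n) sequentially"
    using e by (intro eventually_conj eventually_finite_pressure g c_pos eventually_gt_at_top) simp
  \<comment> \<open>The lower estimate for \<open>f\<close> holds infinitely often and the upper one
    for \<open>g\<close> eventually, so some \<open>n\<close> satisfies both.\<close>
  ultimately have "\<exists>\<^sub>F n in sequentially. real_pressure f - e / 2 < finite_pressure f n c \<and>
      (finite_pressure g n c < real_pressure g + e / 2 \<and> 0 < n)"
    by (rule frequently_eventually_frequently)
  then obtain n where n: "real_pressure f - e / 2 < finite_pressure f n c"
    "finite_pressure g n c < real_pressure g + e / 2" "0 < n"
    by (auto dest: frequently_ex)
  then show "real_pressure f \<le> real_pressure g + B + e" using fin[OF n(3)] by linarith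
qed

lemma real_pressure_lipschitz:
  assumes f: "f \<in> cont_space" and g: "g \<in> cont_space" and le: "\<And>x. \<bar>f x - g x\<bar> \<le> B"
  shows "\<bar>real_pressure f - real_pressure g\<bar> \<le> B"
proof -
  have "f x \<le> g x + B" "g x \<le> f x + B" for x using le[of x] by linarith+
  from real_pressure_le[OF f g this(1)] real_pressure_le[OF g f this(2)] show ?thesis by linarith
qed

lemma real_pressure_midpoint:
  assumes f: "f \<in> cont_space" and h: "h \<in> cont_space"
  shows "2 * real_pressure f \<le> real_pressure (\<lambda>x. f x + h x) + real_pressure (\<lambda>x. f x - h x)"
proof (rule field_le_epsilon)
  fix e :: real assume e: "0 < e"
  define p where "p = (\<lambda>x. f x + h x)"
  define m where "m = (\<lambda>x. f x - h x)"
  have p: "p \<in> cont_space" and m: "m \<in> cont_space"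
    using f h by (auto simp: p_def m_def cont_space_def intro!: continuous_intros)
  have fin: "2 * finite_pressure f n c \<le> finite_pressure p n c + finite_pressure m n c" if n: "0 < n" for n
  proof -
    let ?Q = "\<lambda>f. partition_sum T f n c"
    note pos = partition_sum_pos[OF c_pos n f] partition_sum_pos[OF c_pos n p] partition_sum_pos[OF c_pos n m]
    have "?Q f \<le> sqrt (?Q p * ?Q m)"
      unfolding partition_sum_weight[of f]
    proof (rule cSUP_least)
      show "{E. separated T n c E} \<noteq> {}" using separated_singleton by blast
      fix E assume "E \<in> {E. separated T n c E}"
      then have E: "separated T n c E" by simp
      have "(weight_sum T f n E)\<^sup>2 \<le> weight_sum T p n E * weight_sum T m n E"
        unfolding p_def m_def by (rule weight_sum_midpoint)
      also have "\<dots> \<le> ?Q p * ?Q m"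
      proof (rule mult_mono)
        show "weight_sum T p n E \<le> ?Q p" "weight_sum T m n E \<le> ?Q m"
          by (intro weight_sum_le_partition_sum c_pos n p m E)+
        show "0 \<le> weight_sum T m n E" by (simp add: weight_sum_def sum_nonneg)
      qed (use pos in simp)
      finally show "weight_sum T f n E \<le> sqrt (?Q p * ?Q m)" by (rule real_le_rsqrt)
    qed
    then have "ln (?Q f) \<le> ln (sqrt (?Q p * ?Q m))" using pos by (intro ln_mono) auto
    also have "\<dots> = (ln (?Q p) + ln (?Q m)) / 2" using pos by (simp add: ln_sqrt ln_mult)
    finally have "2 * ln (?Q f) / n \<le> (ln (?Q p) + ln (?Q m)) / n"
      by (intro divide_right_mono) simp_all
    then show ?thesis by (simp add: finite_pressure_def add_divide_distrib)
  qed
  have "\<exists>\<^sub>F n in sequentially. real_pressure f - e / 4 < finite_pressure f n c"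
    using e by (intro frequently_finite_pressure f) simp
  moreover have "eventually (\<lambda>n. (finite_pressure p n c < real_pressure p + e / 4 \<and>
      finite_pressure m n c < real_pressure m + e / 4) \<and> 0 < n) sequentially"
    using e by (intro eventually_conj eventually_finite_pressure p m c_pos eventually_gt_at_top) simp_all
  ultimately have "\<exists>\<^sub>F n in sequentially. real_pressure f - e / 4 < finite_pressure f n c \<and>
      ((finite_pressure p n c < real_pressure p + e / 4 \<and> finite_pressure m n c < real_pressure m + e / 4) \<and> 0 < n)"
    by (rule frequently_eventually_frequently)
  then obtain n where n: "real_pressure f - e / 4 < finite_pressure f n c"
    "finite_pressure p n c < real_pressure p + e / 4" "finite_pressure m n c < real_pressure m + e / 4" "0 < n"
    by (auto dest: frequently_ex)
  then show "2 * real_pressure f \<le> real_pressure (\<lambda>x. f x + h x) + real_pressure (\<lambda>x. f x - h x) + e"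
    using fin[OF n(4)] unfolding p_def[symmetric] m_def[symmetric] by linarith
qed

text \<open>One \<open>n\<close> has to serve twice: the weights of \<open>f\<close> on
  \<open>E\<close> nearly reach the pressure of \<open>f\<close>, and the partition sum of
  \<open>\<phi>\<close> at the same time and scale is not too large. The first can be had
  frequently, the second eventually.\<close>

lemma nearly_optimal_separated_set:
  assumes f: "f \<in> cont_space" and \<phi>: "\<phi> \<in> cont_space" and e: "0 < e"
  shows "\<exists>n E. N \<le> n \<and> 0 < n \<and> separated T n c E \<and> E \<noteq> {} \<and>
    real_pressure f - e < ln (weight_sum T f n E) / n \<and> finite_pressure \<phi> n c < real_pressure \<phi> + e"
proof -
  have "\<exists>\<^sub>F n in sequentially. real_pressure f - e < finite_pressure f n c"
    using e by (intro frequently_finite_pressure f)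
  moreover have "eventually (\<lambda>n. finite_pressure \<phi> n c < real_pressure \<phi> + e \<and> max 1 N \<le> n) sequentially"
    using e by (intro eventually_conj eventually_finite_pressure \<phi> c_pos eventually_ge_at_top)
  ultimately have "\<exists>\<^sub>F n in sequentially. real_pressure f - e < finite_pressure f n c \<and>
      (finite_pressure \<phi> n c < real_pressure \<phi> + e \<and> max 1 N \<le> n)"
    by (rule frequently_eventually_frequently)
  then obtain n where n: "real_pressure f - e < finite_pressure f n c"
    "finite_pressure \<phi> n c < real_pressure \<phi> + e" "max 1 N \<le> n"
    by (auto dest: frequently_ex)
  then have n0: "0 < n" "N \<le> n" by auto
  let ?K = "n * (real_pressure f - e)"
  have "?K < ln (partition_sum T f n c)"
    using n(1) n0(1) by (simp add: finite_pressure_def pos_less_divide_eq mult.commute)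
  then have "exp ?K < partition_sum T f n c"
    using partition_sum_pos[OF c_pos n0(1) f] by (metis exp_less_mono exp_ln)
  then obtain E where E: "separated T n c E" "exp ?K < weight_sum T f n E"
    unfolding partition_sum_weight
    using less_cSUP_iff[OF _ bdd_above_weight_sums[OF c_pos n0(1) f], of "exp ?K"] separated_singleton by blast
  have "E \<noteq> {}" using E(2) by (auto simp: weight_sum_def)
  moreover have "?K < ln (weight_sum T f n E)"
    using E(2) by (metis exp_gt_zero exp_less_cancel_iff exp_ln less_trans)
  then have "real_pressure f - e < ln (weight_sum T f n E) / n"
    using n0(1) by (simp add: pos_less_divide_eq mult.commute)
  ultimately show ?thesis using E(1) n0 n(2) by blast
qed

lemma directional_upper_bound:
  assumes \<phi>: "\<phi> \<in> cont_space" and unique: "\<And>\<nu>. equilibrium_state T \<phi> \<nu> \<Longrightarrow> \<nu> = \<mu>"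
    and \<psi>: "\<psi> \<in> cont_space" and e: "0 < e"
  shows "\<exists>d>0. \<forall>t. 0 < t \<and> t < d \<longrightarrow>
    real_pressure (\<lambda>x. \<phi> x + t * \<psi> x) - real_pressure \<phi> \<le> t * ((\<integral>x. \<psi> x \<partial>\<mu>) + e)"
proof (rule ccontr)
  assume neg: "\<not> ?thesis"
  have "\<exists>t. 0 < t \<and> t < inverse (real (Suc j)) \<and>
      t * ((\<integral>x. \<psi> x \<partial>\<mu>) + e) < real_pressure (\<lambda>x. \<phi> x + t * \<psi> x) - real_pressure \<phi>" for j
  proof (rule ccontr)
    assume no: "\<not> ?thesis"
    have "real_pressure (\<lambda>x. \<phi> x + t * \<psi> x) - real_pressure \<phi> \<le> t * ((\<integral>x. \<psi> x \<partial>\<mu>) + e)"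
      if "0 < t" "t < inverse (real (Suc j))" for t
      using no that not_less by blast
    moreover have "0 < inverse (real (Suc j))" by simp
    ultimately show False using neg by blast
  qed
  then obtain t where t: "\<And>j. 0 < t j" "\<And>j. t j < inverse (real (Suc j))"
    "\<And>j. t j * ((\<integral>x. \<psi> x \<partial>\<mu>) + e) < real_pressure (\<lambda>x. \<phi> x + t j * \<psi> x) - real_pressure \<phi>"
    by metis
  define f where "f j = (\<lambda>x. \<phi> x + t j * \<psi> x)" for j
  have f: "f j \<in> cont_space" for j
    using \<phi> \<psi> by (auto simp: f_def cont_space_def intro!: continuous_intros)
  have t_lim: "t \<longlonglongrightarrow> 0"
  proof (rule tendsto_sandwich[of "\<lambda>_. 0" t sequentially "\<lambda>j. inverse (real (Suc j))"])
    show "(\<lambda>j. inverse (real (Suc j))) \<longlonglongrightarrow> 0" by (rule LIMSEQ_inverse_real_of_nat)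
    show "eventually (\<lambda>j. 0 \<le> t j) sequentially" using t(1) by (simp add: less_imp_le)
    show "eventually (\<lambda>j. t j \<le> inverse (real (Suc j))) sequentially"
      using t(2) by (intro always_eventually allI less_imp_le)
  qed simp
  \<comment> \<open>The tolerance \<open>(t j)\<^sup>2\<close> is of smaller order than
    \<open>t j\<close>, so it disappears from the difference quotient.\<close>
  have "\<exists>n E. j \<le> n \<and> 0 < n \<and> separated T n c E \<and> E \<noteq> {} \<and>
    real_pressure (f j) - (t j)\<^sup>2 < ln (weight_sum T (f j) n E) / n \<and>
    finite_pressure \<phi> n c < real_pressure \<phi> + (t j)\<^sup>2" for j
    using t(1)[of j] by (intro nearly_optimal_separated_set f \<phi>) simp
  then obtain n E where nE: "\<And>j. j \<le> n j" "\<And>j. 0 < n j" "\<And>j. separated T (n j) c (E j)" "\<And>j. E j \<noteq> {}"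
    "\<And>j. real_pressure (f j) - (t j)\<^sup>2 < ln (weight_sum T (f j) (n j) (E j)) / n j"
    "\<And>j. finite_pressure \<phi> (n j) c < real_pressure \<phi> + (t j)\<^sup>2"
    by metis
  have n_lim: "filterlim n at_top sequentially"
    by (rule filterlim_at_top_mono[OF filterlim_ident]) (simp add: nE(1))
  obtain B where B: "0 < B" "\<And>x. \<bar>\<psi> x\<bar> \<le> B" using compact_bounded_continuous[OF compact_UNIV \<psi>] by metis
  have f_close: "\<bar>f j x - \<phi> x\<bar> \<le> t j * B" for j x
    using B(2)[of x] t(1)[of j] by (simp add: f_def abs_mult)
  have close: "eventually (\<lambda>j. \<forall>x. \<bar>f j x - \<phi> x\<bar> \<le> h) sequentially" if h: "0 < h" for h
  proof -
    have "(\<lambda>j. t j * B) \<longlonglongrightarrow> 0" using tendsto_mult_left_zero[OF t_lim, of B] .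
    then have "eventually (\<lambda>j. t j * B < h) sequentially" using h by (rule order_tendstoD(2))
    then show ?thesis
    proof (rule eventually_mono, intro allI)
      fix j x assume "t j * B < h"
      then show "\<bar>f j x - \<phi> x\<bar> \<le> h" using f_close[of j x] by linarith
    qed
  qed
  have lower: "eventually (\<lambda>j. real_pressure \<phi> - h < ln (weight_sum T (f j) (n j) (E j)) / n j) sequentially"
    if h: "0 < h" for h
  proof -
    have "(\<lambda>j. t j * B + (t j)\<^sup>2) \<longlonglongrightarrow> 0 * B + 0\<^sup>2" by (intro tendsto_intros t_lim)
    then have "eventually (\<lambda>j. t j * B + (t j)\<^sup>2 < h) sequentially" using h by (intro order_tendstoD(2)) simp_all
    then show ?thesis
    proof (rule eventually_mono)
      fix j assume "t j * B + (t j)\<^sup>2 < h"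
      then show "real_pressure \<phi> - h < ln (weight_sum T (f j) (n j) (E j)) / n j"
        using nE(5)[of j] real_pressure_lipschitz[OF f[of j] \<phi> f_close[of j]] by linarith
    qed
  qed
  obtain \<nu> where \<nu>: "\<nu> \<in> invariant_measures T"
    "\<forall>A e. A \<in> sets borel \<longrightarrow> 0 < e \<longrightarrow> (\<exists>U. open U \<and> A \<subseteq> U \<and> measure \<nu> U < measure \<nu> A + e)"
    "ereal (real_pressure \<phi> - (\<integral>x. \<phi> x \<partial>\<nu>)) \<le> measure_entropy \<nu> T"
    "\<forall>g\<in>cont_space. \<forall>h>0. \<exists>\<^sub>F j in sequentially. \<bar>orbit_average T (f j) (n j) (E j) g - (\<integral>x. g x \<partial>\<nu>)\<bar> < h"
    using misiurewicz[OF n_lim nE(2,4) c_pos nE(3) \<phi> close lower] by auto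
  have "measure_entropy \<nu> T \<le> ereal (real_pressure \<phi> - (\<integral>x. \<phi> x \<partial>\<nu>))"
    by (rule variational_upper_bound[OF \<nu>(1) _ \<phi>]) (use \<nu>(2) eventually_finite_pressure[OF \<phi>] in blast)+
  with \<nu>(3) have "measure_entropy \<nu> T = ereal (real_pressure \<phi> - (\<integral>x. \<phi> x \<partial>\<nu>))" by (rule antisym[rotated])
  then have "equilibrium_state T \<phi> \<nu>"
    using \<nu>(1) pressure_eq[OF \<phi>] by (simp add: equilibrium_state_def)
  then have eq: "\<nu> = \<mu>" by (rule unique)
  have "\<exists>\<^sub>F j in sequentially. \<bar>orbit_average T (f j) (n j) (E j) \<psi> - (\<integral>x. \<psi> x \<partial>\<mu>)\<bar> < e / 2"
    using \<nu>(4)[rule_format, OF \<psi>, of "e / 2"] e unfolding eq by simp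
  \<comment> \<open>The two tolerances add up to \<open>2 * (t j)\<^sup>2\<close>, that is to
    \<open>2 * t j < e / 2\<close> after division by \<open>t j\<close>; the other half of
    \<open>e\<close> goes to the orbit average.\<close>
  moreover have "eventually (\<lambda>j. t j < e / 4) sequentially"
    using order_tendstoD(2)[OF t_lim, of "e / 4"] e by simp
  ultimately have "\<exists>\<^sub>F j in sequentially. \<bar>orbit_average T (f j) (n j) (E j) \<psi> - (\<integral>x. \<psi> x \<partial>\<mu>)\<bar> < e / 2 \<and> t j < e / 4"
    by (rule frequently_eventually_frequently)
  then obtain j where j: "\<bar>orbit_average T (f j) (n j) (E j) \<psi> - (\<integral>x. \<psi> x \<partial>\<mu>)\<bar> < e / 2" "t j < e / 4"
    by (auto dest: frequently_ex)
  have fin: "finite (E j)" using card_separated_le[OF c_pos] nE(2,3) by metis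
  let ?a = "orbit_average T (f j) (n j) (E j) \<psi>"
  \<comment> \<open>Both potentials are compared on the same set \<open>E j\<close>: the tangent
    estimate leads from \<open>f j\<close> to \<open>\<phi>\<close>, whose weights there are at most
    its partition sum.\<close>
  have "ln (weight_sum T (f j) (n j) (E j)) \<le> ln (weight_sum T \<phi> (n j) (E j)) + n j * (t j * ?a)"
    using weight_sum_tangent[OF fin nE(4) nE(2)[of j], of T \<phi> "t j" \<psi>] unfolding f_def by linarith
  also have "ln (weight_sum T \<phi> (n j) (E j)) \<le> ln (partition_sum T \<phi> (n j) c)"
    using weight_sum_le_partition_sum[OF c_pos nE(2) \<phi> nE(3)] weight_sum_pos[OF fin nE(4) nE(2)]
    by (intro ln_mono)
  finally have "ln (weight_sum T (f j) (n j) (E j)) / n j \<le> (ln (partition_sum T \<phi> (n j) c) + n j * (t j * ?a)) / n j"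
    by (intro divide_right_mono) simp_all
  also have "\<dots> = finite_pressure \<phi> (n j) c + t j * ?a"
    using nE(2)[of j] by (simp add: finite_pressure_def add_divide_distrib)
  finally have "real_pressure (f j) - real_pressure \<phi> < t j * ?a + 2 * (t j)\<^sup>2"
    using nE(5,6)[of j] by linarith
  also have "\<dots> = t j * (?a + 2 * t j)" by (simp add: power2_eq_square algebra_simps)
  also have "\<dots> \<le> t j * ((\<integral>x. \<psi> x \<partial>\<mu>) + e)"
    using t(1)[of j] j by (intro mult_left_mono) linarith+
  finally show False using t(3)[of j] by (simp add: f_def)
qed

text \<open>The upper bound is applied to \<open>\<psi>\<close> and to its negative; midpoint
  convexity turns each of the two into the lower bound for the other.\<close>

lemma directional_derivative:
  assumes \<phi>: "\<phi> \<in> cont_space" and unique: "\<And>\<nu>. equilibrium_state T \<phi> \<nu> \<Longrightarrow> \<nu> = \<mu>"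
    and \<psi>: "\<psi> \<in> cont_space" and e: "0 < e"
  shows "\<exists>d>0. \<forall>t. \<bar>t\<bar> < d \<longrightarrow>
    \<bar>real_pressure (\<lambda>x. \<phi> x + t * \<psi> x) - real_pressure \<phi> - t * (\<integral>x. \<psi> x \<partial>\<mu>)\<bar> \<le> e * \<bar>t\<bar>"
proof -
  let ?I = "\<integral>x. \<psi> x \<partial>\<mu>"
  have \<psi>': "(\<lambda>x. - \<psi> x) \<in> cont_space" using \<psi> by (auto simp: cont_space_def intro!: continuous_intros)
  obtain d1 where d1: "0 < d1" "\<And>t. 0 < t \<Longrightarrow> t < d1 \<Longrightarrow>
      real_pressure (\<lambda>x. \<phi> x + t * \<psi> x) - real_pressure \<phi> \<le> t * (?I + e)"
    using directional_upper_bound[OF \<phi> unique \<psi> e] by blast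
  obtain d2 where d2: "0 < d2" "\<And>t. 0 < t \<Longrightarrow> t < d2 \<Longrightarrow>
      real_pressure (\<lambda>x. \<phi> x - t * \<psi> x) - real_pressure \<phi> \<le> t * (- ?I + e)"
    using directional_upper_bound[OF \<phi> unique \<psi>' e] by auto
  have both: "\<bar>real_pressure (\<lambda>x. \<phi> x + t * \<psi> x) - real_pressure \<phi> - t * ?I\<bar> \<le> e * t \<and>
      \<bar>real_pressure (\<lambda>x. \<phi> x - t * \<psi> x) - real_pressure \<phi> + t * ?I\<bar> \<le> e * t"
    if t: "0 < t" "t < min d1 d2" for t
  proof -
    have "(\<lambda>x. t * \<psi> x) \<in> cont_space" using \<psi> by (auto simp: cont_space_def intro!: continuous_intros)
    from real_pressure_midpoint[OF \<phi> this]
    have "2 * real_pressure \<phi> \<le> real_pressure (\<lambda>x. \<phi> x + t * \<psi> x) + real_pressure (\<lambda>x. \<phi> x - t * \<psi> x)" .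
    moreover have "real_pressure (\<lambda>x. \<phi> x + t * \<psi> x) - real_pressure \<phi> \<le> t * ?I + e * t"
      using d1(2)[of t] t by (simp add: algebra_simps)
    moreover have "real_pressure (\<lambda>x. \<phi> x - t * \<psi> x) - real_pressure \<phi> \<le> - (t * ?I) + e * t"
      using d2(2)[of t] t by (simp add: algebra_simps)
    ultimately show ?thesis unfolding abs_le_iff by linarith
  qed
  have "\<bar>real_pressure (\<lambda>x. \<phi> x + t * \<psi> x) - real_pressure \<phi> - t * ?I\<bar> \<le> e * \<bar>t\<bar>" if "\<bar>t\<bar> < min d1 d2" for t
  proof (cases t "0 :: real" rule: linorder_cases)
    case less
    then show ?thesis using both[of "- t"] that by simp
  next
    case greater
    then show ?thesis using both[of t] that by simp
  qed simp
  then show ?thesis using d1(1) d2(1) by (intro exI[of _ "min d1 d2"]) simp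
qed

end

section \<open>Hoelder functions in the sup norm\<close>

lemma sup_norm_upper:
  fixes f :: "'a::metric_space \<Rightarrow> real"
  assumes "compact (UNIV :: 'a set)" "f \<in> cont_space"
  shows "\<bar>f x\<bar> \<le> sup_norm f"
proof -
  obtain B where "\<And>x. \<bar>f x\<bar> \<le> B" using compact_bounded_continuous[OF assms] by metis
  then show ?thesis unfolding sup_norm_def by (intro cSUP_upper bdd_aboveI2[of _ _ B]) auto
qed

lemma holder_space_subset_cont_space:
  assumes "0 < \<alpha>"
  shows "holder_space \<alpha> \<subseteq> cont_space"
proof
  fix f :: "'a \<Rightarrow> real" assume "f \<in> holder_space \<alpha>"
  then obtain K where K: "\<And>x y. \<bar>f x - f y\<bar> \<le> K * dist x y powr \<alpha>" by (auto simp: holder_space_def)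
  have "isCont f x" for x
  proof -
    have "((\<lambda>y. K * dist y x powr \<alpha>) \<longlongrightarrow> K * 0 powr \<alpha>) (at x)"
    proof (intro tendsto_mult tendsto_const)
      have "((\<lambda>y. dist y x) \<longlongrightarrow> dist x x) (at x)" by (intro tendsto_intros)
      then show "((\<lambda>y. dist y x powr \<alpha>) \<longlongrightarrow> 0 powr \<alpha>) (at x)"
        using assms by (intro tendsto_powr2) (auto intro: tendsto_const)
    qed
    then have lim: "((\<lambda>y. K * dist y x powr \<alpha>) \<longlongrightarrow> 0) (at x)" by simp
    have "((\<lambda>y. f y - f x) \<longlongrightarrow> 0) (at x)"
      by (rule Lim_null_comparison[OF _ lim]) (simp add: K)
    then show ?thesis by (simp add: isCont_def LIM_zero_iff)
  qed
  then show "f \<in> cont_space" by (simp add: cont_space_def continuous_on_eq_continuous_at)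
qed

lemma holder_seminorm_upper:
  assumes "f \<in> holder_space \<alpha>"
  shows "\<bar>f x - f y\<bar> \<le> holder_seminorm \<alpha> f * dist x y powr \<alpha>" and "0 \<le> holder_seminorm \<alpha> f"
proof -
  let ?q = "\<lambda>(x, y). \<bar>f x - f y\<bar> / dist x y powr \<alpha>"
  obtain K where K: "\<And>x y. \<bar>f x - f y\<bar> \<le> K * dist x y powr \<alpha>" using assms by (auto simp: holder_space_def)
  \<comment> \<open>The maximum with 0 covers the diagonal, where the quotient is 0; on a one-point
    space \<open>K\<close> may be negative.\<close>
  have "?q p \<le> max K 0" for p
  proof (cases "fst p = snd p")
    case False
    then have "0 < dist (fst p) (snd p) powr \<alpha>" by simp
    then have "?q p \<le> K" using K[of "fst p" "snd p"] by (simp add: case_prod_unfold pos_divide_le_eq)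
    then show ?thesis by simp
  qed (simp add: case_prod_unfold)
  then have "bdd_above (range ?q)" by (intro bdd_aboveI2[of _ _ "max K 0"]) auto
  then have le: "?q (x, y) \<le> holder_seminorm \<alpha> f" for x y
    unfolding holder_seminorm_def by (intro cSUP_upper) auto
  from le[of x x] show "0 \<le> holder_seminorm \<alpha> f" by simp
  show "\<bar>f x - f y\<bar> \<le> holder_seminorm \<alpha> f * dist x y powr \<alpha>"
  proof (cases "x = y")
    case False
    then have "0 < dist x y powr \<alpha>" by simp
    then show ?thesis using le[of x y] by (simp add: pos_divide_le_eq)
  qed simp
qed

text \<open>A quantitative Arzela-Ascoli argument. The mesh \<open>\<rho>\<close> of a finite net is
  chosen so that its power \<alpha> is \<open>h\<close>, and values on the net are rounded down to
  multiples of \<open>h\<close>. Functions with equal codes differ by less than \<open>h\<close> on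
  the net, hence by at most \<open>3 * h = e\<close> everywhere.\<close>

lemma holder_ball_finite_net:
  fixes \<alpha> :: real
  assumes X: "compact (UNIV :: 'a::metric_space set)" and \<alpha>: "0 < \<alpha>" and e: "0 < e"
  defines "U \<equiv> {u :: 'a \<Rightarrow> real. (\<forall>x. \<bar>u x\<bar> \<le> 1) \<and> (\<forall>x y. \<bar>u x - u y\<bar> \<le> dist x y powr \<alpha>)}"
  shows "\<exists>R. finite R \<and> R \<subseteq> U \<and> (\<forall>u\<in>U. \<exists>r\<in>R. \<forall>x. \<bar>u x - r x\<bar> \<le> e)"
proof -
  define h where "h = e / 3"
  have h: "0 < h" using e by (simp add: h_def)
  define \<rho> where "\<rho> = h powr (1 / \<alpha>)"
  have \<rho>: "0 < \<rho>" "\<rho> powr \<alpha> = h" using h \<alpha> by (simp_all add: \<rho>_def powr_powr)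
  \<comment> \<open>\<open>finite_net\<close> concerns only the space, so the identity serves as the
    map.\<close>
  interpret compact_system "\<lambda>x :: 'a. x" using X by unfold_locales (simp_all add: continuous_on_id)
  obtain F and g :: "'a \<Rightarrow> 'a" where F: "finite F" "range g \<subseteq> F" "\<And>x. dist x (g x) < \<rho>"
    using finite_net[OF \<rho>(1)] by metis
  define code where "code u = (\<lambda>p\<in>F. \<lfloor>u p / h\<rfloor>)" for u :: "'a \<Rightarrow> real"
  let ?C = "PiE F (\<lambda>_. {\<lfloor>- 1 / h\<rfloor>..\<lfloor>1 / h\<rfloor>})"
  have "code ` U \<subseteq> ?C"
  proof
    fix k assume "k \<in> code ` U"
    then obtain u where u: "\<And>x. \<bar>u x\<bar> \<le> 1" "k = code u" unfolding U_def by blast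
    have "\<lfloor>- 1 / h\<rfloor> \<le> \<lfloor>u p / h\<rfloor> \<and> \<lfloor>u p / h\<rfloor> \<le> \<lfloor>1 / h\<rfloor>" for p
    proof -
      have "- 1 \<le> u p" "u p \<le> 1" using u(1)[of p] by linarith+
      then show ?thesis using h by (intro conjI floor_mono divide_right_mono) simp_all
    qed
    then show "k \<in> ?C" by (auto simp: u(2) code_def)
  qed
  moreover have "finite ?C" using F(1) by (intro finite_PiE) simp_all
  ultimately have "finite (code ` U)" by (rule finite_subset)
  \<comment> \<open>Only finitely many codes occur, so finitely many members of \<open>U\<close>
    realise them all.\<close>
  then obtain R where R: "R \<subseteq> U" "finite R" "code ` U = code ` R"
    using finite_subset_image[of "code ` U" code U] by auto
  have "\<exists>r\<in>R. \<forall>x. \<bar>u x - r x\<bar> \<le> e" if u: "u \<in> U" for u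
  proof -
    have "code u \<in> code ` R" using u R(3) by blast
    then obtain r where r: "r \<in> R" "code u = code r" by blast
    have "\<bar>u x - r x\<bar> \<le> e" for x
    proof -
      have near: "\<bar>v x - v (g x)\<bar> \<le> h" if "v \<in> U" for v
      proof -
        have "\<bar>v x - v (g x)\<bar> \<le> dist x (g x) powr \<alpha>" using that by (simp add: U_def)
        also have "\<dots> \<le> \<rho> powr \<alpha>" using F(3)[of x] \<alpha> by (intro powr_mono2) simp_all
        finally show ?thesis by (simp add: \<rho>(2))
      qed
      have "g x \<in> F" using F(2) by blast
      then have "\<lfloor>u (g x) / h\<rfloor> = \<lfloor>r (g x) / h\<rfloor>" using fun_cong[OF r(2), of "g x"] by (simp add: code_def)
      then have "\<bar>u (g x) / h - r (g x) / h\<bar> < 1" by linarith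
      then have "\<bar>u (g x) - r (g x)\<bar> / h < 1" using h by (simp add: diff_divide_distrib[symmetric])
      then have "\<bar>u (g x) - r (g x)\<bar> < h" using h by (simp add: pos_divide_less_eq)
      moreover have "r \<in> U" using R(1) r(1) by blast
      moreover have "e = 3 * h" by (simp add: h_def)
      ultimately show ?thesis using near[OF u] near[of r] by linarith
    qed
    then show ?thesis using r(1) by blast
  qed
  then show ?thesis using R by blast
qed

lemma bounded_linear_functional_integral:
  assumes X: "compact (UNIV :: 'a::metric_space set)" and M: "prob_space M" "sets M = sets borel"
    and V: "V \<subseteq> cont_space" and N: "\<And>f. f \<in> V \<Longrightarrow> sup_norm f \<le> N f"
  shows "bounded_linear_functional V N (\<lambda>f :: 'a \<Rightarrow> real. \<integral>x. f x \<partial>M)"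
proof -
  interpret prob_space M by fact
  have int: "integrable M f" if "f \<in> cont_space" for f :: "'a \<Rightarrow> real"
  proof -
    have "f \<in> borel_measurable M"
      using that borel_measurable_continuous_onI[of f] by (simp add: cont_space_def measurable_cong_sets[OF M(2) refl])
    then show ?thesis using sup_norm_upper[OF X that] by (intro integrable_const_bound[of _ "sup_norm f"]) auto
  qed
  have "\<bar>\<integral>x. f x \<partial>M\<bar> \<le> 1 * N f" if f: "f \<in> V" for f
  proof -
    have fc: "f \<in> cont_space" using f V by blast
    have "\<bar>\<integral>x. f x \<partial>M\<bar> \<le> (\<integral>x. \<bar>f x\<bar> \<partial>M)" by (rule integral_abs_bound)
    also have "\<dots> \<le> (\<integral>x. sup_norm f \<partial>M)"
      by (intro integral_mono integrable_abs int[OF fc] sup_norm_upper[OF X fc]) simp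
    also have "\<dots> \<le> N f" using N[OF f] prob_space by simp
    finally show ?thesis by simp
  qed
  then show ?thesis
    unfolding bounded_linear_functional_def
  proof (intro conjI ballI allI)
    show "(\<integral>x. f x + g x \<partial>M) = (\<integral>x. f x \<partial>M) + (\<integral>x. g x \<partial>M)" if "f \<in> V" "g \<in> V" for f g
      using V that by (intro Bochner_Integration.integral_add int subsetD[OF V])
  qed (auto intro: exI[of _ 1])
qed

context pressure_system
begin

lemma gateaux_derivative:
  assumes \<phi>: "\<phi> \<in> cont_space" and \<mu>: "\<mu> \<in> invariant_measures T"
    and unique: "\<And>\<nu>. equilibrium_state T \<phi> \<nu> \<Longrightarrow> \<nu> = \<mu>"
  shows "has_gateaux_derivative cont_space sup_norm real_pressure \<phi> (\<lambda>\<psi>. \<integral>x. \<psi> x \<partial>\<mu>)"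
  unfolding has_gateaux_derivative_def
proof (intro conjI ballI)
  show "bounded_linear_functional cont_space sup_norm (\<lambda>\<psi> :: 'a \<Rightarrow> real. \<integral>x. \<psi> x \<partial>\<mu>)"
    using \<mu> by (intro bounded_linear_functional_integral compact_UNIV) (auto simp: invariant_measures_def)
  fix \<psi> :: "'a \<Rightarrow> real" assume \<psi>: "\<psi> \<in> cont_space"
  let ?F = "\<lambda>t. real_pressure (\<lambda>x. \<phi> x + t * \<psi> x)" and ?I = "\<integral>x. \<psi> x \<partial>\<mu>"
  have "(\<lambda>t. (?F (0 + t) - ?F 0) / t) \<midarrow>0\<rightarrow> ?I"
  proof (rule LIM_I)
    fix e :: real assume e: "0 < e"
    \<comment> \<open>Half of \<open>e\<close> turns the weak inequality into the strict one in the
      definition of the limit.\<close>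
    obtain d where d: "0 < d" "\<And>t. \<bar>t\<bar> < d \<Longrightarrow> \<bar>?F t - real_pressure \<phi> - t * ?I\<bar> \<le> e / 2 * \<bar>t\<bar>"
      using directional_derivative[OF \<phi> unique \<psi>, of "e / 2"] e by auto
    have "norm ((?F (0 + t) - ?F 0) / t - ?I) < e" if t: "t \<noteq> 0 \<and> norm (t - 0) < d" for t
    proof -
      have "(?F (0 + t) - ?F 0) / t - ?I = (?F t - real_pressure \<phi> - t * ?I) / t"
        using t by (simp add: diff_divide_distrib)
      then have "norm ((?F (0 + t) - ?F 0) / t - ?I) = \<bar>?F t - real_pressure \<phi> - t * ?I\<bar> / \<bar>t\<bar>"
        by (simp add: abs_divide)
      also have "\<dots> \<le> e / 2" using d(2)[of t] t by (simp add: pos_divide_le_eq)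
      also have "\<dots> < e" using e by simp
      finally show ?thesis .
    qed
    then show "\<exists>s>0. \<forall>t. t \<noteq> 0 \<and> norm (t - 0) < s \<longrightarrow> norm ((?F (0 + t) - ?F 0) / t - ?I) < e"
      using d(1) by blast
  qed
  then show "(?F has_real_derivative ?I) (at 0)" by (simp add: DERIV_def)
qed

text \<open>
  Frechet differentiability is Gateaux differentiability made uniform over directions: the Hoelder
  unit ball is totally bounded for the sup norm, in which the pressure is 1-Lipschitz.
\<close>

lemma frechet_derivative:
  assumes \<alpha>: "0 < \<alpha>" and \<phi>: "\<phi> \<in> cont_space" and \<mu>: "\<mu> \<in> invariant_measures T"
    and unique: "\<And>\<nu>. equilibrium_state T \<phi> \<nu> \<Longrightarrow> \<nu> = \<mu>"
  shows "has_frechet_derivative (holder_space \<alpha>) (holder_norm \<alpha>) real_pressure \<phi> (\<lambda>\<psi>. \<integral>x. \<psi> x \<partial>\<mu>)"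
  unfolding has_frechet_derivative_def
proof (intro conjI allI impI)
  note sub = holder_space_subset_cont_space[OF \<alpha>]
  have sup_le: "sup_norm f \<le> holder_norm \<alpha> f" if "f \<in> holder_space \<alpha>" for f :: "'a \<Rightarrow> real"
    using holder_seminorm_upper(2)[OF that] by (simp add: holder_norm_def)
  show "bounded_linear_functional (holder_space \<alpha>) (holder_norm \<alpha>) (\<lambda>\<psi> :: 'a \<Rightarrow> real. \<integral>x. \<psi> x \<partial>\<mu>)"
    using \<mu> sub sup_le by (intro bounded_linear_functional_integral compact_UNIV) (auto simp: invariant_measures_def)
  interpret M: prob_space \<mu> using \<mu> by (simp add: invariant_measures_def)
  have sets: "sets \<mu> = sets borel" using \<mu> by (simp add: invariant_measures_def)
  have lip: "\<bar>(\<integral>x. u x \<partial>\<mu>) - (\<integral>x. v x \<partial>\<mu>)\<bar> \<le> B"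
    if u: "u \<in> cont_space" and v: "v \<in> cont_space" and B: "\<And>x. \<bar>u x - v x\<bar> \<le> B" for u v :: "'a \<Rightarrow> real" and B
  proof -
    have meas: "w \<in> borel_measurable \<mu>" if "w \<in> cont_space" for w :: "'a \<Rightarrow> real"
      using that borel_measurable_continuous_onI[of w] by (simp add: cont_space_def measurable_cong_sets[OF sets refl])
    have int: "integrable \<mu> w" if w: "w \<in> cont_space" for w :: "'a \<Rightarrow> real"
      using sup_norm_upper[OF compact_UNIV w] by (intro M.integrable_const_bound[of _ "sup_norm w"] meas[OF w]) auto
    have "\<bar>\<integral>x. u x - v x \<partial>\<mu>\<bar> \<le> (\<integral>x. \<bar>u x - v x\<bar> \<partial>\<mu>)" by (rule integral_abs_bound)
    also have "\<dots> \<le> (\<integral>x. B \<partial>\<mu>)"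
      by (intro integral_mono integrable_abs Bochner_Integration.integrable_diff M.integrable_const int[OF u] int[OF v] B)
    finally show ?thesis using M.prob_space by (simp add: Bochner_Integration.integral_diff[OF int[OF u] int[OF v]])
  qed
  fix e :: real assume e: "0 < e"
  define U where "U = {u :: 'a \<Rightarrow> real. (\<forall>x. \<bar>u x\<bar> \<le> 1) \<and> (\<forall>x y. \<bar>u x - u y\<bar> \<le> dist x y powr \<alpha>)}"
  obtain R where R: "finite R" "R \<subseteq> U" "\<And>u. u \<in> U \<Longrightarrow> \<exists>r\<in>R. \<forall>x. \<bar>u x - r x\<bar> \<le> e / 3"
    using holder_ball_finite_net[OF compact_UNIV \<alpha>, of "e / 3"] e unfolding U_def by auto
  have U_cont: "U \<subseteq> cont_space"
  proof
    fix u assume "u \<in> U"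
    then have "u \<in> holder_space \<alpha>" unfolding U_def holder_space_def by (auto intro!: exI[of _ 1])
    then show "u \<in> cont_space" using sub by blast
  qed
  have "\<exists>d>0. \<forall>t. \<bar>t\<bar> < d \<longrightarrow>
      \<bar>real_pressure (\<lambda>x. \<phi> x + t * r x) - real_pressure \<phi> - t * (\<integral>x. r x \<partial>\<mu>)\<bar> \<le> e / 3 * \<bar>t\<bar>" if "r \<in> R" for r
    using that R(2) U_cont e by (intro directional_derivative[OF \<phi> unique]) auto
  then obtain D where D: "\<And>r. r \<in> R \<Longrightarrow> 0 < D r" "\<And>r t. r \<in> R \<Longrightarrow> \<bar>t\<bar> < D r \<Longrightarrow>
      \<bar>real_pressure (\<lambda>x. \<phi> x + t * r x) - real_pressure \<phi> - t * (\<integral>x. r x \<partial>\<mu>)\<bar> \<le> e / 3 * \<bar>t\<bar>"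
    by metis
  \<comment> \<open>The minimum over the finite net makes the radius uniform over directions; the
    element 1 keeps the set nonempty without a look at \<open>R\<close>.\<close>
  define d where "d = Min (insert 1 (D ` R))"
  have d: "0 < d" "\<And>r. r \<in> R \<Longrightarrow> d \<le> D r" using R(1) D(1) by (auto simp: d_def)
  have "\<bar>real_pressure (\<lambda>x. \<phi> x + \<psi> x) - real_pressure \<phi> - (\<integral>x. \<psi> x \<partial>\<mu>)\<bar> \<le> e * holder_norm \<alpha> \<psi>"
    if \<psi>: "\<psi> \<in> holder_space \<alpha>" "holder_norm \<alpha> \<psi> < d" for \<psi>
  proof -
    have \<psi>c: "\<psi> \<in> cont_space" using \<psi>(1) sub by blast
    define s where "s = holder_norm \<alpha> \<psi>"
    have sup: "\<bar>\<psi> x\<bar> \<le> s" for x using sup_norm_upper[OF compact_UNIV \<psi>c, of x] sup_le[OF \<psi>(1)] by (simp add: s_def)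
    then have s0: "0 \<le> s" using abs_ge_zero order_trans by blast
    have sem: "\<bar>\<psi> x - \<psi> y\<bar> \<le> s * dist x y powr \<alpha>" for x y
    proof -
      have "0 \<le> sup_norm \<psi>" using sup_norm_upper[OF compact_UNIV \<psi>c, of x] by linarith
      then have "holder_seminorm \<alpha> \<psi> * dist x y powr \<alpha> \<le> s * dist x y powr \<alpha>"
        by (intro mult_right_mono) (simp_all add: s_def holder_norm_def)
      then show ?thesis using holder_seminorm_upper(1)[OF \<psi>(1), of x y] by linarith
    qed
    show ?thesis
    proof (cases "s = 0")
      case True
      then have "\<psi> = (\<lambda>_. 0)" using sup by (auto simp: fun_eq_iff)
      then show ?thesis using True by (simp add: s_def)
    next
      case False
      then have s: "0 < s" using s0 by simp
      \<comment> \<open>The normalised direction lies in \<open>U\<close>, since both the sup norm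
        and the seminorm of \<open>\<psi>\<close> are at most \<open>s\<close>; the number
        \<open>s\<close> becomes the step length.\<close>
      define u where "u x = \<psi> x / s" for x
      have \<psi>_eq: "\<psi> = (\<lambda>x. s * u x)" using s by (simp add: u_def fun_eq_iff)
      have "u \<in> U"
      proof -
        have "\<bar>u x\<bar> \<le> 1" for x using sup[of x] s by (simp add: u_def abs_divide)
        moreover have "\<bar>u x - u y\<bar> \<le> dist x y powr \<alpha>" for x y
          using sem[of x y] s by (simp add: u_def abs_divide pos_divide_le_eq mult.commute flip: diff_divide_distrib)
        ultimately show ?thesis by (simp add: U_def)
      qed
      then obtain r where r: "r \<in> R" "\<And>x. \<bar>u x - r x\<bar> \<le> e / 3" using R(3) by blast
      have uc: "u \<in> cont_space" and rc: "r \<in> cont_space" using \<open>u \<in> U\<close> r(1) R(2) U_cont by auto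
      \<comment> \<open>Three errors of size \<open>s * (e / 3)\<close> follow: exchanging
        \<open>u\<close> for the net point \<open>r\<close> in the pressure, differentiating along
        \<open>r\<close>, and exchanging back in the integral.\<close>
      have 1: "\<bar>real_pressure (\<lambda>x. \<phi> x + s * u x) - real_pressure (\<lambda>x. \<phi> x + s * r x)\<bar> \<le> s * (e / 3)"
      proof (rule real_pressure_lipschitz)
        show "(\<lambda>x. \<phi> x + s * u x) \<in> cont_space" "(\<lambda>x. \<phi> x + s * r x) \<in> cont_space"
          using \<phi> uc rc by (auto simp: cont_space_def intro!: continuous_intros)
        fix x
        have "\<bar>\<phi> x + s * u x - (\<phi> x + s * r x)\<bar> = s * \<bar>u x - r x\<bar>"
          using s by (simp add: abs_mult flip: right_diff_distrib)
        also have "\<dots> \<le> s * (e / 3)" using r(2)[of x] s by (intro mult_left_mono) simp_all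
        finally show "\<bar>\<phi> x + s * u x - (\<phi> x + s * r x)\<bar> \<le> s * (e / 3)" .
      qed
      have 2: "\<bar>real_pressure (\<lambda>x. \<phi> x + s * r x) - real_pressure \<phi> - s * (\<integral>x. r x \<partial>\<mu>)\<bar> \<le> s * (e / 3)"
        using D(2)[OF r(1), of s] d(2)[OF r(1)] \<psi>(2) s by (simp add: s_def mult.commute)
      have "s * \<bar>(\<integral>x. u x \<partial>\<mu>) - (\<integral>x. r x \<partial>\<mu>)\<bar> \<le> s * (e / 3)"
        using lip[OF uc rc r(2)] s by (intro mult_left_mono) simp_all
      then have 3: "\<bar>s * (\<integral>x. u x \<partial>\<mu>) - s * (\<integral>x. r x \<partial>\<mu>)\<bar> \<le> s * (e / 3)"
        using s by (simp add: abs_mult flip: right_diff_distrib)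
      have "(\<integral>x. \<psi> x \<partial>\<mu>) = s * (\<integral>x. u x \<partial>\<mu>)" unfolding \<psi>_eq by simp
      moreover have "s * (e / 3) + s * (e / 3) + s * (e / 3) = e * s" by simp
      ultimately have "\<bar>real_pressure (\<lambda>x. \<phi> x + s * u x) - real_pressure \<phi> - (\<integral>x. \<psi> x \<partial>\<mu>)\<bar> \<le> e * s"
        using 1 2 3 by linarith
      then show ?thesis unfolding s_def[symmetric] \<psi>_eq[symmetric] using \<psi>_eq by metis
    qed
  qed
  then show "\<exists>d>0. \<forall>\<psi>\<in>holder_space \<alpha>. holder_norm \<alpha> \<psi> < d \<longrightarrow>
      \<bar>real_pressure (\<lambda>x. \<phi> x + \<psi> x) - real_pressure \<phi> - (\<integral>x. \<psi> x \<partial>\<mu>)\<bar> \<le> e * holder_norm \<alpha> \<psi>"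
    using d(1) by blast
qed

end

theorem theorem3p17:
  fixes T :: "'a::metric_space \<Rightarrow> 'a" and \<alpha> :: real and \<phi> :: "'a \<Rightarrow> real" and \<mu> :: "'a measure"
  assumes "compact (UNIV :: 'a set)"
    and "continuous_on UNIV T"
    and "expansive T"
    and "specification_property T"
    and "0 < \<alpha>" and "\<alpha> \<le> 1"
    and "\<phi> \<in> holder_space \<alpha>"
    and "equilibrium_state T \<phi> \<mu>"
    and "\<And>\<nu>. equilibrium_state T \<phi> \<nu> \<Longrightarrow> \<nu> = \<mu>"
    and "exponential_decay_of_correlations \<alpha> T \<mu>"
  shows "(\<forall>\<psi>\<in>holder_space \<alpha>. \<bar>pressure T \<psi>\<bar> \<noteq> \<infinity>) \<and>
    has_frechet_derivative (holder_space \<alpha>) (holder_norm \<alpha>)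
      (\<lambda>\<psi>. real_of_ereal (pressure T \<psi>)) \<phi> (\<lambda>\<psi>. \<integral>x. \<psi> x \<partial>\<mu>) \<and>
    (\<forall>\<psi>\<in>cont_space. \<bar>pressure T \<psi>\<bar> \<noteq> \<infinity>) \<and>
    has_gateaux_derivative cont_space sup_norm
      (\<lambda>\<psi>. real_of_ereal (pressure T \<psi>)) \<phi> (\<lambda>\<psi>. \<integral>x. \<psi> x \<partial>\<mu>)"
proof -
  interpret C: compact_system T using assms(1,2) by unfold_locales
  obtain c where c: "0 < c" "\<And>f. f \<in> cont_space \<Longrightarrow> \<exists>P. pressure T f = ereal P \<and>
    (\<forall>e>0. \<forall>d>0. eventually (\<lambda>n. C.finite_pressure f n d < P + e) sequentially) \<and>
    (\<forall>e>0. \<exists>\<^sub>F n in sequentially. P - e < C.finite_pressure f n c)"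
    using C.expansive_pressure[OF assms(3)] by blast
  interpret pressure_system T c using c by unfold_locales
  have sub: "holder_space \<alpha> \<subseteq> (cont_space :: ('a \<Rightarrow> real) set)" by (rule holder_space_subset_cont_space[OF assms(5)])
  have \<phi>: "\<phi> \<in> cont_space" using sub assms(7) by blast
  have \<mu>: "\<mu> \<in> invariant_measures T" using assms(8) by (simp add: equilibrium_state_def)
  have finite: "\<bar>pressure T \<psi>\<bar> \<noteq> \<infinity>" if "\<psi> \<in> cont_space" for \<psi> using pressure_eq[OF that] by simp
  have eq: "(\<lambda>\<psi>. real_of_ereal (pressure T \<psi>)) = real_pressure" by (simp add: real_pressure_def fun_eq_iff)
  show ?thesis
    unfolding eq
  proof (intro conjI ballI)
    show "\<bar>pressure T \<psi>\<bar> \<noteq> \<infinity>" if "\<psi> \<in> holder_space \<alpha>" for \<psi>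
      using finite[OF subsetD[OF sub that]] .
    show "\<bar>pressure T \<psi>\<bar> \<noteq> \<infinity>" if "\<psi> \<in> cont_space" for \<psi>
      using that by (rule finite)
  qed (use gateaux_derivative[OF \<phi> \<mu> assms(9)] frechet_derivative[OF assms(5) \<phi> \<mu> assms(9)] in blast)+
qed

end
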